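(* Let $s>\frac32$ and $R>0$, let $U_R=\{\phi\in H^s(\mathbb{R}):\|\phi\|_{H^s(\mathbb{R})}\le R\}$, and let $T=T(R,s)>0$ be a common existence time for data in $U_R$, as specified in the context. For $u_0\in U_R$ and $\alpha\in(0,1)$, let $\mathbf{S}^\alpha_t(u_0)$ and $\mathbf{S}^0_t(u_0)$ be the solutions in $\mathcal{C}([0,T];H^s(\mathbb{R}))$ of the Camassa--Holm equation with filter parameter $\alpha$ and of the inviscid Burgers equation, respectively, with the same initial data $u_0$. Then the family of solution maps $$\mathbf{S}^\alpha_t:\ U_R\to\mathcal{C}([0,T];H^s(\mathbb{R})),\qquad u_0\mapsto \mathbf{S}^\alpha_t(u_0),$$ does not converge as $\alpha\to0$ to $\mathbf{S}^0_t$ in $L^\infty(0,T;H^s(\mathbb{R}))$ uniformly with respect to the initial data $u_0\in U_R$. More precisely, there exist a sequence of initial data $\{u_0^n\}_{n=1}^\infty\subset U_R$, a sequence $\alpha_n\in(0,1)$ with $\alpha_n\to0$ as $n\to\infty$, a time $T_0\in(0,T]$ and a constant $\eta_0>0$ such that $$\liminf_{n\to\infty}\left\|\mathbf{S}^{\alpha_n}_t(u_0^n)-\mathbf{S}^0_t(u_0^n)\right\|_{L^\infty(0,T_0;H^s(\mathbb{R}))}\ge\eta_0 .$$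
   Context: The Sobolev norm is $\|f\|_{H^s(\mathbb{R})}^2=\int_{\mathbb{R}}(1+|\xi|^2)^s|\widehat f(\xi)|^2\,d\xi$. The operator $(1-\alpha^2\partial_x^2)^{-1}$ is the Fourier multiplier with symbol $(1+\alpha^2|\xi|^2)^{-1}$. The Camassa--Holm equation with filter parameter $\alpha>0$, for $(t,x)\in\mathbb{R}^+\times\mathbb{R}$, is $$u_t+3u\,\partial_xu=-\alpha^2\partial_x^3(1-\alpha^2\partial_x^2)^{-1}(u^2)-\frac{\alpha^2}{2}\partial_x(1-\alpha^2\partial_x^2)^{-1}\big((\partial_xu)^2\big),\qquad u(0,x)=u_0(x).$$ The inviscid Burgers equation (the case $\alpha=0$) is $u_t+3u\,\partial_xu=0$, $u(0,x)=u_0(x)$. Common existence time: for $s>\frac32$ and $R>0$, $T=T(R,s)>0$ denotes a time, independent of $\alpha$, such that for every $\alpha\in[0,1)$ and every $u_0\in U_R$ the corresponding equation (Camassa--Holm if $\alpha>0$, Burgers if $\alpha=0$) has a unique solution $\mathbf{S}^\alpha_t(u_0)\in\mathcal{C}([0,T];H^s(\mathbb{R}))$, and moreover, with constants independent of $\alpha$: $\|\mathbf{S}^\alpha_t(u_0)\|_{L^\infty(0,T;H^s)}\le C_1\|u_0\|_{H^s}$, and if in addition $u_0\in H^\gamma$ for some $\gamma\ge s-1$, then $\|\mathbf{S}^\alpha_t(u_0)\|_{L^\infty(0,T;H^\gamma)}\le C_2(\|u_0\|_{H^s})\|u_0\|_{H^\gamma}$. The existence of such a $T$ is known. *)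

theory Defs
  imports "HOL-Analysis.Analysis" "HOL-Probability.Essential_Supremum"
begin

text \<open>
  Elements of the function spaces are represented by Borel functions; identities between such
  elements are understood almost everywhere.
\<close>

definition square_integrable :: "(real \<Rightarrow> 'a::{real_normed_vector, second_countable_topology}) \<Rightarrow> bool"
  where "square_integrable f \<longleftrightarrow>
    f \<in> borel_measurable lborel \<and> integrable lborel (\<lambda>x. (norm (f x))\<^sup>2)"

text \<open>
  The Fourier--Plancherel transform with the convention
  \<open>\<integral> f(x) exp(- i x \<xi>) dx\<close>: the truncated integrals converge to \<open>g\<close> in the mean.  The integral
  over \<open>\<xi>\<close> is a nonnegative (extended) one, so no integrability is left implicit.
\<close>

definition has_fourier_transform :: "(real \<Rightarrow> complex) \<Rightarrow> (real \<Rightarrow> complex) \<Rightarrow> bool"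
  where "has_fourier_transform f g \<longleftrightarrow>
    square_integrable f \<and> square_integrable g \<and>
    ((\<lambda>r. \<integral>\<^sup>+ \<xi>. ennreal ((cmod ((LINT x:{-r..r}|lborel. f x * cis (- (x * \<xi>))) - g \<xi>))\<^sup>2) \<partial>lborel)
       \<longlongrightarrow> 0) at_top"

text \<open>The choice only fixes a representative: the transform is unique almost everywhere.\<close>

definition fourier :: "(real \<Rightarrow> real) \<Rightarrow> real \<Rightarrow> complex"
  where "fourier f = (SOME g. has_fourier_transform (\<lambda>x. complex_of_real (f x)) g)"

text \<open>
  Only orders \<open>s \<ge> 0\<close> are needed below; for these the Sobolev space consists of
  square-integrable functions.
\<close>

definition sobolev :: "real \<Rightarrow> (real \<Rightarrow> real) set"
  where "sobolev s = {f. square_integrable f \<and>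
    integrable lborel (\<lambda>\<xi>. (1 + \<bar>\<xi>\<bar>\<^sup>2) powr s * (cmod (fourier f \<xi>))\<^sup>2)}"

definition sobolev_norm :: "real \<Rightarrow> (real \<Rightarrow> real) \<Rightarrow> real"
  where "sobolev_norm s f =
    sqrt (LINT \<xi>|lborel. (1 + \<bar>\<xi>\<bar>\<^sup>2) powr s * (cmod (fourier f \<xi>))\<^sup>2)"

definition sobolev_ball :: "real \<Rightarrow> real \<Rightarrow> (real \<Rightarrow> real) set"
  where "sobolev_ball s R = {\<phi> \<in> sobolev s. sobolev_norm s \<phi> \<le> R}"

text \<open>
  The multiplier with symbol \<open>m\<close>, as a real function.  Such a function exists whenever
  \<open>m \<cdot> fourier f\<close> is square-integrable and \<open>m (- \<xi>) = cnj (m \<xi>)\<close>, which holds for both symbols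
  below, and it is then unique almost everywhere.
\<close>

definition fourier_multiplier :: "(real \<Rightarrow> complex) \<Rightarrow> (real \<Rightarrow> real) \<Rightarrow> real \<Rightarrow> real"
  where "fourier_multiplier m f =
    (SOME g. square_integrable g \<and> (AE \<xi> in lborel. fourier g \<xi> = m \<xi> * fourier f \<xi>))"

definition Dx :: "(real \<Rightarrow> real) \<Rightarrow> real \<Rightarrow> real"
  where "Dx = fourier_multiplier (\<lambda>\<xi>. \<i> * complex_of_real \<xi>)"

text \<open>The operator \<open>(1 - \<alpha>\<^sup>2 \<partial>\<^sub>x\<^sup>2)\<close> inverted.\<close>

definition inv_helmholtz :: "real \<Rightarrow> (real \<Rightarrow> real) \<Rightarrow> real \<Rightarrow> real"
  where "inv_helmholtz \<alpha> = fourier_multiplier (\<lambda>\<xi>. complex_of_real (1 / (1 + \<alpha>\<^sup>2 * \<bar>\<xi>\<bar>\<^sup>2)))"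

text \<open>Curves \<open>u t\<close> with values in a Sobolev space: the space \<open>C([0,T]; H\<^sup>s)\<close> and the (one-sided at
  the endpoints) time derivative with respect to the Sobolev norm.\<close>

definition continuous_sobolev :: "real \<Rightarrow> real \<Rightarrow> (real \<Rightarrow> real \<Rightarrow> real) \<Rightarrow> bool"
  where "continuous_sobolev s T u \<longleftrightarrow>
    (\<forall>t\<in>{0..T}. u t \<in> sobolev s \<and>
       ((\<lambda>\<tau>. sobolev_norm s (\<lambda>x. u \<tau> x - u t x)) \<longlongrightarrow> 0) (at t within {0..T}))"

definition has_sobolev_derivative ::
    "real \<Rightarrow> real \<Rightarrow> (real \<Rightarrow> real \<Rightarrow> real) \<Rightarrow> (real \<Rightarrow> real) \<Rightarrow> real \<Rightarrow> bool"
  where "has_sobolev_derivative s T u v t \<longleftrightarrow>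
    v \<in> sobolev s \<and>
    ((\<lambda>\<tau>. sobolev_norm s (\<lambda>x. (u \<tau> x - u t x) / (\<tau> - t) - v x)) \<longlongrightarrow> 0) (at t within {0..T})"

text \<open>
  A solution in \<open>C([0,T]; H\<^sup>s)\<close>, \<open>s > 3/2\<close>: all terms of the equations other than \<open>u\<^sub>t\<close> lie in
  \<open>C([0,T]; H\<^sup>s\<^sup>-\<^sup>1)\<close>, so \<open>u\<^sub>t\<close> is taken as the derivative of \<open>u\<close> in \<open>H\<^sup>s\<^sup>-\<^sup>1\<close>.
\<close>

definition camassa_holm_solution ::
    "real \<Rightarrow> real \<Rightarrow> real \<Rightarrow> (real \<Rightarrow> real) \<Rightarrow> (real \<Rightarrow> real \<Rightarrow> real) \<Rightarrow> bool"
  where "camassa_holm_solution s T \<alpha> u0 u \<longleftrightarrow>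
    continuous_sobolev s T u \<and>
    (AE x in lborel. u 0 x = u0 x) \<and>
    (\<exists>u\<^sub>t. \<forall>t\<in>{0..T}. has_sobolev_derivative (s - 1) T u (u\<^sub>t t) t \<and>
      (AE x in lborel. u\<^sub>t t x + 3 * u t x * Dx (u t) x =
         - \<alpha>\<^sup>2 * Dx (Dx (Dx (inv_helmholtz \<alpha> (\<lambda>y. (u t y)\<^sup>2)))) x
         - \<alpha>\<^sup>2 / 2 * Dx (inv_helmholtz \<alpha> (\<lambda>y. (Dx (u t) y)\<^sup>2)) x))"

definition burgers_solution ::
    "real \<Rightarrow> real \<Rightarrow> (real \<Rightarrow> real) \<Rightarrow> (real \<Rightarrow> real \<Rightarrow> real) \<Rightarrow> bool"
  where "burgers_solution s T u0 u \<longleftrightarrow>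
    continuous_sobolev s T u \<and>
    (AE x in lborel. u 0 x = u0 x) \<and>
    (\<exists>u\<^sub>t. \<forall>t\<in>{0..T}. has_sobolev_derivative (s - 1) T u (u\<^sub>t t) t \<and>
      (AE x in lborel. u\<^sub>t t x + 3 * u t x * Dx (u t) x = 0))"

definition filtered_solution ::
    "real \<Rightarrow> real \<Rightarrow> real \<Rightarrow> (real \<Rightarrow> real) \<Rightarrow> (real \<Rightarrow> real \<Rightarrow> real) \<Rightarrow> bool"
  where "filtered_solution s T \<alpha> u0 u \<longleftrightarrow>
    (if \<alpha> = 0 then burgers_solution s T u0 u else camassa_holm_solution s T \<alpha> u0 u)"

text \<open>
  The norm of \<open>L\<^sup>\<infinity>(0,T; H\<^sup>s)\<close>, infinite if \<open>u t\<close> fails to lie in \<open>H\<^sup>s\<close> for almost every \<open>t\<close>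
  (the real-valued \<open>sobolev_norm\<close> is meaningless outside the space).
\<close>

definition Linf_sobolev_norm :: "real \<Rightarrow> real \<Rightarrow> (real \<Rightarrow> real \<Rightarrow> real) \<Rightarrow> ennreal"
  where "Linf_sobolev_norm s T u =
    (if AE t in restrict_space lborel {0<..<T}. u t \<in> sobolev s
     then esssup (restrict_space lborel {0<..<T}) (\<lambda>t. ennreal (sobolev_norm s (u t)))
     else \<infinity>)"

text \<open>
  The constants may depend on \<open>s\<close>, \<open>R\<close>, \<open>T\<close> and, in the last clause, on the order \<open>\<gamma>\<close>, but neither
  on \<open>\<alpha>\<close> nor on the datum other than as displayed.
\<close>

definition common_existence_time :: "real \<Rightarrow> real \<Rightarrow> real \<Rightarrow> bool"
  where "common_existence_time s R T \<longleftrightarrow>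
    T > 0 \<and>
    (\<forall>\<alpha>\<in>{0..<1}. \<forall>u0\<in>sobolev_ball s R.
       (\<exists>u. filtered_solution s T \<alpha> u0 u) \<and>
       (\<forall>u v. filtered_solution s T \<alpha> u0 u \<and> filtered_solution s T \<alpha> u0 v \<longrightarrow>
          (\<forall>t\<in>{0..T}. AE x in lborel. u t x = v t x))) \<and>
    (\<exists>C1. \<forall>\<alpha>\<in>{0..<1}. \<forall>u0\<in>sobolev_ball s R. \<forall>u. filtered_solution s T \<alpha> u0 u \<longrightarrow>
       Linf_sobolev_norm s T u \<le> ennreal (C1 * sobolev_norm s u0)) \<and>
    (\<forall>\<gamma>\<ge>s - 1. \<exists>C2 :: real \<Rightarrow> real.
       \<forall>\<alpha>\<in>{0..<1}. \<forall>u0\<in>sobolev_ball s R \<inter> sobolev \<gamma>. \<forall>u. filtered_solution s T \<alpha> u0 u \<longrightarrow>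
       Linf_sobolev_norm \<gamma> T u \<le> ennreal (C2 (sobolev_norm s u0) * sobolev_norm \<gamma> u0))"

end

theory Submission
  imports Defs "HOL-Probability.Probability"
begin

text \<open>
  The third-order term of the Camassa--Holm equation acts on frequencies of order \<open>1 / \<alpha>\<close> like a first-order
  flux term: there the symbol \<open>\<alpha>\<^sup>2\<xi>\<^sup>2 / (1 + \<alpha>\<^sup>2\<xi>\<^sup>2)\<close> is bounded below, however small \<open>\<alpha>\<close> is.  On such
  frequencies the flux differs from \<open>3/2 u\<^sup>2\<close>, the flux of Burgers' equation, by a fixed fraction of
  \<open>u\<^sup>2\<close>.  To see the difference in \<open>H\<^sup>s\<close> one needs data that live at frequency \<open>N = 1 / \<alpha>\<close> with an
  \<open>H\<^sup>s\<close> norm of order one, together with a low-frequency part of height \<open>A / N\<close> that interacts with it: the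
  product of the two parts has frequency \<open>N\<close> and, after the derivative in front of the flux, an \<open>H\<^sup>s\<close> norm
  of order one again.  So the two solutions separate at a rate bounded below independently of \<open>N\<close>.

  This first-order picture has to survive for a time that does not depend on \<open>N\<close>.  Along such data the
  norms of order \<open>s - 1\<close> and \<open>s\<close> are of size \<open>1 / N\<close> and \<open>1\<close>, and by the a priori bounds they remain so.
  Since \<open>s - 1 > 1/2\<close>, the space \<open>H\<^sup>s\<^sup>-\<^sup>1\<close> is an algebra, and the tame product estimate
  (\<open>sobolev_product\<close>) shows that the time derivative is of size \<open>1 / N\<close> in it (\<open>evolves_bound\<close>); hence
  the squares of the solutions change by \<open>O(t / N\<^sup>2)\<close> in \<open>H\<^sup>s\<^sup>-\<^sup>1\<close>, which is small compared with the main
  term for small \<open>t\<close>.  The gradient term \<open>\<alpha>\<^sup>2 (u\<^sub>x)\<^sup>2\<close> is the only error that is not small in time; it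
  does not involve \<open>A\<close> and is beaten by choosing \<open>A\<close> large.

  The separation is measured by a single linear functional, the imaginary part of the integral of the
  transform over the band \<open>[N - 1, N + 1]\<close>.  It is differentiable in time along solutions, its derivative
  is bounded below by \<open>band_mass_derivative_lower\<close>, and the scalar mean value theorem gives the growth
  (\<open>band_mass_growth\<close>).  As a functional on \<open>H\<^sup>s\<close> it has norm of order \<open>N powr (- s)\<close>, which turns the growth into a
  lower bound for the \<open>H\<^sup>s\<close> norm of the difference (\<open>uniform_separation\<close>).

  All of this takes place on the Fourier side and rests on Plancherel's theorem for the transform defined by
  limits in the mean.  Boundedness on \<open>L\<^sup>2\<close> comes from a Gaussian regularisation (\<open>ft_bounded\<close>), inversion from
  testing against modulated Gaussians and Levy's uniqueness theorem (\<open>fourier_inversion\<close>); surjectivity onto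
  Hermitian functions makes the multipliers meaningful, and Parseval's identity gives the convolution formula
  for products (\<open>fourier_product\<close>).
\<close>

section \<open>Square-integrable functions\<close>

definition l2norm :: "(real \<Rightarrow> complex) \<Rightarrow> real"
  where "l2norm f = sqrt (LINT x|lborel. (cmod (f x))\<^sup>2)"

lemma sqint_measurable:
  "square_integrable f \<Longrightarrow> f \<in> borel_measurable borel"
  by (auto simp: square_integrable_def)

lemma square_integrable_of_real [simp]:
  "square_integrable (\<lambda>x. complex_of_real (f x)) \<longleftrightarrow> square_integrable f"
proof -
  have "(\<lambda>x. complex_of_real (f x)) \<in> borel_measurable borel \<longleftrightarrow> f \<in> borel_measurable borel"
    (is "?l \<longleftrightarrow> _")
  proof
    assume ?l
    then have "(\<lambda>x. Re (complex_of_real (f x))) \<in> borel_measurable borel"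
      by (rule measurable_compose) simp
    then show "f \<in> borel_measurable borel" by simp
  qed simp
  then show ?thesis
    by (simp add: square_integrable_def)
qed

lemma square_integrableI_bound:
  fixes g :: "real \<Rightarrow> complex"
  assumes [measurable]: "g \<in> borel_measurable borel"
    and f: "square_integrable f" and le: "AE x in lborel. cmod (g x) \<le> B * cmod (f x)"
  shows "square_integrable g"
  unfolding square_integrable_def
proof
  note [measurable] = sqint_measurable[OF f]
  show "integrable lborel (\<lambda>x. (norm (g x))\<^sup>2)"
  proof (rule Bochner_Integration.integrable_bound)
    show "integrable lborel (\<lambda>x. B\<^sup>2 * (cmod (f x))\<^sup>2)"
      using f by (auto simp: square_integrable_def)
    show "AE x in lborel. norm ((cmod (g x))\<^sup>2) \<le> norm (B\<^sup>2 * (cmod (f x))\<^sup>2)"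
      using le
    proof eventually_elim
      case (elim x)
      from power_mono[OF this, of 2] show ?case by (simp add: power_mult_distrib)
    qed
  qed measurable
qed simp

lemma square_integrable_cmult [intro]:
  fixes f :: "real \<Rightarrow> complex"
  assumes f: "square_integrable f"
  shows "square_integrable (\<lambda>x. c * f x)"
proof -
  note [measurable] = sqint_measurable[OF f]
  show ?thesis
    by (rule square_integrableI_bound[OF _ f, of _ "cmod c"]) (auto simp: norm_mult)
qed

lemma square_integrable_add [intro]:
  fixes f g :: "real \<Rightarrow> complex"
  assumes f: "square_integrable f" and g: "square_integrable g"
  shows "square_integrable (\<lambda>x. f x + g x)"
  unfolding square_integrable_def
proof
  note [measurable] = sqint_measurable[OF f] sqint_measurable[OF g]
  show "(\<lambda>x. f x + g x) \<in> borel_measurable lborel" by simp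
  show "integrable lborel (\<lambda>x. (norm (f x + g x))\<^sup>2)"
  proof (rule Bochner_Integration.integrable_bound)
    show "integrable lborel (\<lambda>x. 2 * (cmod (f x))\<^sup>2 + 2 * (cmod (g x))\<^sup>2)"
      using f g by (auto simp: square_integrable_def)
    show "AE x in lborel. norm ((cmod (f x + g x))\<^sup>2) \<le> norm (2 * (cmod (f x))\<^sup>2 + 2 * (cmod (g x))\<^sup>2)"
    proof (rule AE_I2)
      fix x
      have "(cmod (f x + g x))\<^sup>2 \<le> (cmod (f x) + cmod (g x))\<^sup>2"
        by (intro power_mono norm_triangle_ineq) auto
      also have "\<dots> \<le> 2 * (cmod (f x))\<^sup>2 + 2 * (cmod (g x))\<^sup>2"
        using sum_squares_bound[of "cmod (f x)" "cmod (g x)"] by (simp add: power2_sum)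
      finally show "norm ((cmod (f x + g x))\<^sup>2) \<le> norm (2 * (cmod (f x))\<^sup>2 + 2 * (cmod (g x))\<^sup>2)"
        by simp
    qed
  qed measurable
qed

lemma square_integrable_diff [intro]:
  fixes f g :: "real \<Rightarrow> complex"
  assumes f: "square_integrable f" and g: "square_integrable g"
  shows "square_integrable (\<lambda>x. f x - g x)"
  using square_integrable_add[OF f square_integrable_cmult[OF g, of "-1"]] by simp

lemma square_integrable_iff_nn:
  fixes f :: "real \<Rightarrow> complex"
  assumes [measurable]: "f \<in> borel_measurable borel"
  shows "square_integrable f \<longleftrightarrow> (\<integral>\<^sup>+x. ennreal ((cmod (f x))\<^sup>2) \<partial>lborel) < \<infinity>"
  by (simp add: square_integrable_def integrable_iff_bounded)

lemma l2norm_nonneg [simp]: "0 \<le> l2norm f"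
  by (simp add: l2norm_def)

lemma l2norm_sq: "(l2norm f)\<^sup>2 = (LINT x|lborel. (cmod (f x))\<^sup>2)"
  by (simp add: l2norm_def)

lemma nn_l2norm:
  assumes "square_integrable f"
  shows "(\<integral>\<^sup>+x. ennreal ((cmod (f x))\<^sup>2) \<partial>lborel) = ennreal ((l2norm f)\<^sup>2)"
  using assms by (simp add: l2norm_sq nn_integral_eq_integral square_integrable_def)

lemma l2norm_le_nn:
  fixes f :: "real \<Rightarrow> complex"
  assumes [measurable]: "f \<in> borel_measurable borel"
    and le: "(\<integral>\<^sup>+x. ennreal ((cmod (f x))\<^sup>2) \<partial>lborel) \<le> ennreal (c\<^sup>2)" and c: "0 \<le> c"
  shows "square_integrable f \<and> l2norm f \<le> c"
proof
  show f: "square_integrable f"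
    using le by (simp add: square_integrable_iff_nn le_less_trans)
  show "l2norm f \<le> c"
    using le nn_l2norm[OF f] c by (auto intro: power2_le_imp_le)
qed

lemma l2norm_mono:
  fixes f g :: "real \<Rightarrow> complex"
  assumes [measurable]: "f \<in> borel_measurable borel"
    and g: "square_integrable g" and le: "AE x in lborel. cmod (f x) \<le> B * cmod (g x)" and B: "0 \<le> B"
  shows "l2norm f \<le> B * l2norm g"
proof (rule conjunct2[OF l2norm_le_nn])
  note [measurable] = sqint_measurable[OF g]
  have "(\<integral>\<^sup>+x. ennreal ((cmod (f x))\<^sup>2) \<partial>lborel) \<le> (\<integral>\<^sup>+x. ennreal (B\<^sup>2) * ennreal ((cmod (g x))\<^sup>2) \<partial>lborel)"
  proof (rule nn_integral_mono_AE)
    show "AE x in lborel. ennreal ((cmod (f x))\<^sup>2) \<le> ennreal (B\<^sup>2) * ennreal ((cmod (g x))\<^sup>2)"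
      using le
    proof eventually_elim
      case (elim x)
      from power_mono[OF this, of 2] show ?case
        by (simp add: power_mult_distrib flip: ennreal_mult)
    qed
  qed
  also have "\<dots> = ennreal (B\<^sup>2) * ennreal ((l2norm g)\<^sup>2)"
    by (subst nn_integral_cmult) (auto simp: nn_l2norm[OF g])
  finally show "(\<integral>\<^sup>+x. ennreal ((cmod (f x))\<^sup>2) \<partial>lborel) \<le> ennreal ((B * l2norm g)\<^sup>2)"
    by (simp add: power_mult_distrib flip: ennreal_mult)
qed (use B in auto)

lemma square_integrable_AE_cong:
  fixes f g :: "real \<Rightarrow> complex"
  assumes "f \<in> borel_measurable borel" "square_integrable g" "AE x in lborel. f x = g x"
  shows "square_integrable f"
  using assms by (intro square_integrableI_bound[OF assms(1,2), of 1]) auto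

lemma l2norm_cong_AE:
  assumes "square_integrable f" "square_integrable g" "AE x in lborel. f x = g x"
  shows "l2norm f = l2norm g"
proof -
  note [measurable] = sqint_measurable[OF assms(1)] sqint_measurable[OF assms(2)]
  show ?thesis
    unfolding l2norm_def using assms(3)
    by (intro arg_cong[where f=sqrt] integral_cong_AE) auto
qed

lemma l2norm_cmult: "l2norm (\<lambda>x. c * f x) = cmod c * l2norm f"
  by (simp add: l2norm_def norm_mult power_mult_distrib real_sqrt_mult)

lemma ennreal_power2_le_imp_le:
  fixes X :: ennreal
  assumes "X\<^sup>2 \<le> (ennreal c)\<^sup>2"
  shows "X \<le> ennreal c"
proof (cases X)
  case (real r)
  then show ?thesis
    using assms by (cases "c \<ge> 0") (auto simp: ennreal_power ennreal_neg intro: power2_le_imp_le)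
next
  case top
  have "(ennreal c)\<^sup>2 < \<top>"
    by (simp add: power_less_top_ennreal)
  then show ?thesis using assms top by (simp add: top_unique)
qed

lemma
  fixes f g :: "real \<Rightarrow> complex"
  assumes f: "square_integrable f" and g: "square_integrable g"
  shows integrable_mult_sqint: "integrable lborel (\<lambda>x. f x * g x)"
    and l2norm_Cauchy_Schwarz: "(LINT x|lborel. cmod (f x * g x)) \<le> l2norm f * l2norm g"
    and nn_Cauchy_Schwarz: "(\<integral>\<^sup>+x. ennreal (cmod (f x * g x)) \<partial>lborel) \<le> ennreal (l2norm f * l2norm g)"
proof -
  note [measurable] = sqint_measurable[OF f] sqint_measurable[OF g]
  have "(\<integral>\<^sup>+x. ennreal (cmod (f x)) * ennreal (cmod (g x)) \<partial>lborel)\<^sup>2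
      \<le> (\<integral>\<^sup>+x. (ennreal (cmod (f x)))\<^sup>2 \<partial>lborel) * (\<integral>\<^sup>+x. (ennreal (cmod (g x)))\<^sup>2 \<partial>lborel)"
    by (rule Cauchy_Schwarz_nn_integral) auto
  also have "\<dots> = (ennreal (l2norm f * l2norm g))\<^sup>2"
    by (simp add: ennreal_power nn_l2norm f g power_mult_distrib flip: ennreal_mult)
  finally show *: "(\<integral>\<^sup>+x. ennreal (cmod (f x * g x)) \<partial>lborel) \<le> ennreal (l2norm f * l2norm g)"
    unfolding norm_mult ennreal_mult'[OF norm_ge_zero] by (rule ennreal_power2_le_imp_le)
  show **: "integrable lborel (\<lambda>x. f x * g x)"
    using * by (intro integrableI_bounded) (auto simp: le_less_trans)
  show "(LINT x|lborel. cmod (f x * g x)) \<le> l2norm f * l2norm g"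
    using * ** by (subst (asm) nn_integral_eq_integral) auto
qed

lemma norm_integral_mult_le:
  fixes f g :: "real \<Rightarrow> complex"
  assumes f: "square_integrable f" and g: "square_integrable g"
  shows "cmod (LINT x|lborel. f x * g x) \<le> l2norm f * l2norm g"
  using l2norm_Cauchy_Schwarz[OF f g] integral_norm_bound[of lborel "\<lambda>x. f x * g x"] by linarith

lemma l2norm_triangle:
  fixes f g :: "real \<Rightarrow> complex"
  assumes f: "square_integrable f" and g: "square_integrable g"
  shows "l2norm (\<lambda>x. f x + g x) \<le> l2norm f + l2norm g"
proof (rule power2_le_imp_le)
  note fg = square_integrable_add[OF f g]
  have i: "integrable lborel (\<lambda>x. (cmod (f x))\<^sup>2)" "integrable lborel (\<lambda>x. (cmod (g x))\<^sup>2)"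
    "integrable lborel (\<lambda>x. (cmod (f x + g x))\<^sup>2)"
    using f g fg by (auto simp: square_integrable_def)
  have j: "integrable lborel (\<lambda>x. cmod (f x * g x))"
    using integrable_mult_sqint[OF f g] by auto
  have "(l2norm (\<lambda>x. f x + g x))\<^sup>2 \<le> (LINT x|lborel. (cmod (f x))\<^sup>2 + 2 * cmod (f x * g x) + (cmod (g x))\<^sup>2)"
    unfolding l2norm_sq
  proof (rule integral_mono)
    fix x
    have "(cmod (f x + g x))\<^sup>2 \<le> (cmod (f x) + cmod (g x))\<^sup>2"
      by (intro power_mono norm_triangle_ineq) auto
    then show "(cmod (f x + g x))\<^sup>2 \<le> (cmod (f x))\<^sup>2 + 2 * cmod (f x * g x) + (cmod (g x))\<^sup>2"
      by (simp add: power2_sum norm_mult)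
  qed (use i j in auto)
  also have "\<dots> = (l2norm f)\<^sup>2 + 2 * (LINT x|lborel. cmod (f x * g x)) + (l2norm g)\<^sup>2"
    using i j by (simp add: l2norm_sq)
  also have "\<dots> \<le> (l2norm f + l2norm g)\<^sup>2"
    using l2norm_Cauchy_Schwarz[OF f g] by (simp add: power2_sum)
  finally show "(l2norm (\<lambda>x. f x + g x))\<^sup>2 \<le> (l2norm f + l2norm g)\<^sup>2" .
qed simp

lemma l2norm_minus_commute: "l2norm (\<lambda>x. f x - g x) = l2norm (\<lambda>x. g x - f x)"
  by (simp add: l2norm_def norm_minus_commute)

lemma l2norm_triangle_diff:
  fixes f g h :: "real \<Rightarrow> complex"
  assumes f: "square_integrable f" and g: "square_integrable g" and h: "square_integrable h"
  shows "l2norm (\<lambda>x. f x - h x) \<le> l2norm (\<lambda>x. f x - g x) + l2norm (\<lambda>x. g x - h x)"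
  using l2norm_triangle[OF square_integrable_diff[OF f g] square_integrable_diff[OF g h]] by simp

lemma l2norm_eq_0:
  assumes f: "square_integrable f" and 0: "l2norm f = 0"
  shows "AE x in lborel. f x = 0"
proof -
  have "integrable lborel (\<lambda>x. (cmod (f x))\<^sup>2)" "(LINT x|lborel. (cmod (f x))\<^sup>2) = 0"
    using f 0 by (auto simp: square_integrable_def l2norm_def)
  then have "AE x in lborel. (cmod (f x))\<^sup>2 = 0"
    by (subst (asm) integral_nonneg_eq_0_iff_AE) auto
  then show ?thesis by simp
qed

text \<open>The Riesz--Fischer argument: along a rapidly Cauchy subsequence the weighted squares of the
  increments have a finite integral, so the increments are almost everywhere dominated by a
  geometric series; Fatou's lemma identifies the pointwise limit as the limit in the mean.\<close>

lemma l2_complete: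
  fixes f :: "nat \<Rightarrow> real \<Rightarrow> complex"
  assumes f: "\<And>n. square_integrable (f n)"
    and cauchy: "\<And>e. e > 0 \<Longrightarrow> \<exists>N. \<forall>m\<ge>N. \<forall>n\<ge>N. l2norm (\<lambda>x. f m x - f n x) < e"
  shows "\<exists>g. square_integrable g \<and> (\<lambda>n. l2norm (\<lambda>x. f n x - g x)) \<longlonglongrightarrow> 0"
proof -
  note [measurable] = sqint_measurable[OF f]
  have "\<exists>N. \<forall>m\<ge>N. \<forall>n\<ge>N. l2norm (\<lambda>x. f m x - f n x) < (1/2) ^ j" for j
    by (rule cauchy) simp
  then obtain N where N: "\<And>j m n. m \<ge> N j \<Longrightarrow> n \<ge> N j \<Longrightarrow> l2norm (\<lambda>x. f m x - f n x) < (1/2) ^ j"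
    by metis
  \<comment> \<open>A sum instead of \<open>N\<close> itself, because both \<open>k j\<close> and \<open>k (Suc j)\<close> have to be at least \<open>N j\<close>.\<close>
  define k where "k j = (\<Sum>i\<le>j. N i) + j" for j
  have k_ge: "N j \<le> k j" "N j \<le> k (Suc j)" "j \<le> k j" for j
    using member_le_sum[of j "{..j}" N] by (auto simp: k_def)
  define d where "d j x = f (k (Suc j)) x - f (k j) x" for j x
  have d: "square_integrable (d j)" for j
    unfolding d_def by (intro square_integrable_diff f)
  note [measurable] = sqint_measurable[OF d]
  have dj: "(l2norm (d j))\<^sup>2 \<le> ((1/2) ^ j)\<^sup>2" for j
    unfolding d_def using N[OF k_ge(2,1), of j] by (intro power_mono) auto
  \<comment> \<open>The increments satisfy \<open>\<parallel>d j\<parallel>\<^sup>2 \<le> 4^-j\<close>; half of this decay is spent on the weight \<open>2^j\<close>.\<close>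
  have "(\<integral>\<^sup>+x. (\<Sum>j. ennreal (2 ^ j * (cmod (d j x))\<^sup>2)) \<partial>lborel)
      = (\<Sum>j. \<integral>\<^sup>+x. ennreal (2 ^ j * (cmod (d j x))\<^sup>2) \<partial>lborel)"
    by (rule nn_integral_suminf) auto
  also have "\<dots> = (\<Sum>j. ennreal (2 ^ j * (l2norm (d j))\<^sup>2))"
    by (simp add: ennreal_mult nn_integral_cmult nn_l2norm[OF d])
  also have "\<dots> \<le> (\<Sum>j. ennreal ((1/2) ^ j))"
  proof (intro suminf_le ennreal_leI)
    fix j
    have "2 ^ j * (l2norm (d j))\<^sup>2 \<le> 2 ^ j * ((1/2) ^ j)\<^sup>2"
      by (intro mult_left_mono dj) auto
    also have "\<dots> = (1/2) ^ j"
      by (simp add: power2_eq_square power_divide)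
    finally show "2 ^ j * (l2norm (d j))\<^sup>2 \<le> (1/2) ^ j" .
  qed auto
  also have "\<dots> < \<infinity>"
    by (subst suminf_ennreal2) auto
  finally have "AE x in lborel. (\<Sum>j. ennreal (2 ^ j * (cmod (d j x))\<^sup>2)) \<noteq> \<infinity>"
    by (intro nn_integral_PInf_AE) auto
  then have conv: "AE x in lborel. convergent (\<lambda>j. f (k j) x)"
  proof eventually_elim
    case (elim x)
    then have "summable (\<lambda>j. 2 ^ j * (cmod (d j x))\<^sup>2)"
      by (intro summable_suminf_not_top) auto
    then have "(\<lambda>j. 2 ^ j * (cmod (d j x))\<^sup>2) \<longlonglongrightarrow> 0"
      by (rule summable_LIMSEQ_zero)
    then have "\<forall>\<^sub>F j in sequentially. 2 ^ j * (cmod (d j x))\<^sup>2 < 1"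
      by (rule order_tendstoD) simp
    then have "\<forall>\<^sub>F j in sequentially. norm (d j x) \<le> (1 / sqrt 2) ^ j"
    proof eventually_elim
      case (elim j)
      then have "(cmod (d j x))\<^sup>2 \<le> (1/2) ^ j"
        by (simp add: power_divide field_simps)
      also have "\<dots> = ((1 / sqrt 2) ^ j)\<^sup>2"
      proof -
        have "((1 / sqrt 2) ^ j)\<^sup>2 = ((1 / sqrt 2)\<^sup>2) ^ j"
          by (simp only: power_mult[symmetric] mult.commute)
        then show ?thesis by (simp add: power_divide)
      qed
      finally show ?case by (rule power2_le_imp_le) simp
    qed
    then have "summable (\<lambda>j. d j x)"
      by (rule summable_comparison_test_ev) (simp add: summable_geometric)
    then have "convergent (\<lambda>n. f (k 0) x + (\<Sum>j<n. d j x))"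
      by (intro convergent_add convergent_const) (simp add: summable_iff_convergent)
    moreover have "f (k 0) x + (\<Sum>j<n. d j x) = f (k n) x" for n
      by (induction n) (auto simp: d_def algebra_simps)
    ultimately show ?case by simp
  qed
  define g where "g x = lim (\<lambda>j. f (k j) x)" for x
  have [measurable]: "g \<in> borel_measurable borel"
    unfolding g_def by (rule borel_measurable_lim_metric) simp
  have lim: "AE x in lborel. (\<lambda>j. f (k j) x) \<longlonglongrightarrow> g x"
    using conv by eventually_elim (simp add: g_def convergent_LIMSEQ_iff)
  have close: "square_integrable (\<lambda>x. f n x - g x) \<and> l2norm (\<lambda>x. f n x - g x) \<le> e"
    if e: "e > 0" and M: "\<forall>m\<ge>M. \<forall>n\<ge>M. l2norm (\<lambda>x. f m x - f n x) < e" and n: "n \<ge> M" for e n M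
  proof (rule l2norm_le_nn)
    have "(\<integral>\<^sup>+x. ennreal ((cmod (f n x - g x))\<^sup>2) \<partial>lborel)
       = (\<integral>\<^sup>+x. liminf (\<lambda>j. ennreal ((cmod (f n x - f (k j) x))\<^sup>2)) \<partial>lborel)"
    proof (rule nn_integral_cong_AE, use lim in eventually_elim)
      case (elim x)
      have "(\<lambda>j. ennreal ((cmod (f n x - f (k j) x))\<^sup>2)) \<longlonglongrightarrow> ennreal ((cmod (f n x - g x))\<^sup>2)"
        by (intro tendsto_intros elim)
      then show ?case
        using lim_imp_Liminf[OF trivial_limit_sequentially] by force
    qed
    also have "\<dots> \<le> liminf (\<lambda>j. \<integral>\<^sup>+x. ennreal ((cmod (f n x - f (k j) x))\<^sup>2) \<partial>lborel)"
      by (rule nn_integral_liminf) auto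
    also have "\<dots> \<le> ennreal (e\<^sup>2)"
    proof (rule Liminf_le)
      have "\<forall>\<^sub>F j in sequentially. j \<ge> M" by (rule eventually_ge_at_top)
      then show "\<forall>\<^sub>F j in sequentially. (\<integral>\<^sup>+x. ennreal ((cmod (f n x - f (k j) x))\<^sup>2) \<partial>lborel) \<le> ennreal (e\<^sup>2)"
      proof eventually_elim
        case (elim j)
        then have "k j \<ge> M" using k_ge(3)[of j] by simp
        then have "l2norm (\<lambda>x. f n x - f (k j) x) \<le> e" using M n by force
        then show ?case
          by (subst nn_l2norm) (auto intro!: f power_mono)
      qed
    qed simp
    finally show "(\<integral>\<^sup>+x. ennreal ((cmod (f n x - g x))\<^sup>2) \<partial>lborel) \<le> ennreal (e\<^sup>2)" .
  qed (use e in auto)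
  obtain M where M: "\<forall>m\<ge>M. \<forall>n\<ge>M. l2norm (\<lambda>x. f m x - f n x) < 1"
    using cauchy[of 1] by auto
  have "square_integrable (\<lambda>x. f M x - g x)"
    using close[OF _ M, of M] by simp
  from square_integrable_diff[OF f this, of M] have "square_integrable g" by simp
  moreover have "(\<lambda>n. l2norm (\<lambda>x. f n x - g x)) \<longlonglongrightarrow> 0"
  proof (rule LIMSEQ_I)
    fix r :: real assume r: "r > 0"
    obtain M where M: "\<forall>m\<ge>M. \<forall>n\<ge>M. l2norm (\<lambda>x. f m x - f n x) < r / 2"
      using cauchy[of "r/2"] r by auto
    show "\<exists>no. \<forall>n\<ge>no. norm (l2norm (\<lambda>x. f n x - g x) - 0) < r"
    proof (intro exI allI impI)
      fix n assume "n \<ge> M"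
      then have "l2norm (\<lambda>x. f n x - g x) \<le> r / 2"
        using close[OF _ M] r by simp
      then show "norm (l2norm (\<lambda>x. f n x - g x) - 0) < r"
        using r l2norm_nonneg[of "\<lambda>x. f n x - g x"] by simp
    qed
  qed
  ultimately show ?thesis by blast
qed

section \<open>The Fourier integral\<close>

definition ft :: "(real \<Rightarrow> complex) \<Rightarrow> real \<Rightarrow> complex"
  where "ft f \<xi> = (LINT x|lborel. f x * cis (- (x * \<xi>)))"

lemma borel_measurable_cis [measurable]: "cis \<in> borel_measurable borel"
  by (intro borel_measurable_continuous_onI continuous_intros)

lemma borel_measurable_cnj' [measurable]: "cnj \<in> borel_measurable borel"
  by (intro borel_measurable_continuous_onI continuous_intros)

lemma borel_measurable_ft [measurable]:
  assumes [measurable]: "f \<in> borel_measurable borel"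
  shows "ft f \<in> borel_measurable borel"
  unfolding ft_def[abs_def] by measurable

lemma integrable_mult_bounded:
  fixes f g :: "real \<Rightarrow> complex"
  assumes f: "integrable lborel f" and [measurable]: "g \<in> borel_measurable borel"
    and B: "\<And>x. cmod (g x) \<le> B"
  shows "integrable lborel (\<lambda>x. f x * g x)"
proof (rule Bochner_Integration.integrable_bound)
  note [measurable] = borel_measurable_integrable[OF f]
  show "integrable lborel (\<lambda>x. B * cmod (f x))" using f by auto
  have "0 \<le> B" using B[of 0] norm_ge_zero order_trans by blast
  then show "AE x in lborel. norm (f x * g x) \<le> norm (B * cmod (f x))"
    using B by (auto simp: norm_mult mult.commute[of B] intro!: mult_left_mono)
  show "(\<lambda>x. f x * g x) \<in> borel_measurable lborel" by measurable
qed

text \<open>The integral of a function that is not integrable is \<open>0\<close> by convention, which is consistent with the bound.\<close>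

lemma cmod_integral_le_nn:
  fixes f :: "'a \<Rightarrow> complex"
  shows "ennreal (cmod (integral\<^sup>L M f)) \<le> (\<integral>\<^sup>+x. ennreal (cmod (f x)) \<partial>M)"
proof (cases "integrable M f")
  case True
  then show ?thesis by (rule integral_norm_bound_ennreal)
qed (simp add: not_integrable_integral_eq)

lemma cmod_ft_le: "cmod (ft f \<xi>) \<le> (LINT x|lborel. cmod (f x))"
  unfolding ft_def using integral_norm_bound[of lborel "\<lambda>x. f x * cis (- (x * \<xi>))"]
  by (simp add: norm_mult)

text \<open>Kernels that occur below are exponentials \<open>exp(- i x y)\<close>, possibly multiplied by a bounded transform;
  boundedness lets the two integrable factors carry the absolute convergence.\<close>

lemma Fubini_bounded_kernel:
  fixes f g :: "real \<Rightarrow> complex" and h :: "real \<Rightarrow> real \<Rightarrow> complex"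
  assumes f: "integrable lborel f" and g: "integrable lborel g"
    and h [measurable]: "case_prod h \<in> borel_measurable (borel \<Otimes>\<^sub>M borel)"
    and B: "\<And>x y. cmod (h x y) \<le> B"
  shows "(LINT x|lborel. f x * (LINT y|lborel. g y * h x y))
       = (LINT y|lborel. g y * (LINT x|lborel. f x * h x y))"
proof -
  note [measurable] = borel_measurable_integrable[OF f] borel_measurable_integrable[OF g]
  have B0: "0 \<le> B" using B[of 0 0] norm_ge_zero order_trans by blast
  have "integrable (lborel \<Otimes>\<^sub>M lborel) (\<lambda>(x, y). f x * g y * h x y)"
  proof (rule integrableI_bounded)
    have "(\<integral>\<^sup>+z. ennreal (norm (case z of (x, y) \<Rightarrow> f x * g y * h x y)) \<partial>(lborel \<Otimes>\<^sub>M lborel))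
        = (\<integral>\<^sup>+x. \<integral>\<^sup>+y. ennreal (cmod (f x * g y * h x y)) \<partial>lborel \<partial>lborel)"
      by (subst lborel.nn_integral_fst[symmetric]) (auto simp: split_beta')
    also have "\<dots> \<le> (\<integral>\<^sup>+x. \<integral>\<^sup>+y. ennreal (B * cmod (f x)) * ennreal (cmod (g y)) \<partial>lborel \<partial>lborel)"
    proof (intro nn_integral_mono)
      fix x y
      have "cmod (f x * g y * h x y) \<le> B * cmod (f x) * cmod (g y)"
        using mult_left_mono[OF B[of x y], of "cmod (f x) * cmod (g y)"]
        by (simp add: norm_mult mult_ac)
      then show "ennreal (cmod (f x * g y * h x y)) \<le> ennreal (B * cmod (f x)) * ennreal (cmod (g y))"
        using B0 by (simp add: ennreal_leI flip: ennreal_mult)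
    qed
    also have "\<dots> = (\<integral>\<^sup>+x. ennreal (B * cmod (f x)) \<partial>lborel) * (\<integral>\<^sup>+y. ennreal (cmod (g y)) \<partial>lborel)"
      by (simp add: nn_integral_cmult nn_integral_multc)
    also have "\<dots> < \<infinity>"
      using f g B0 by (subst nn_integral_eq_integral | simp add: ennreal_mult_less_top)+
    finally show "(\<integral>\<^sup>+z. ennreal (norm (case z of (x, y) \<Rightarrow> f x * g y * h x y)) \<partial>(lborel \<Otimes>\<^sub>M lborel)) < \<infinity>" .
  qed measurable
  from lborel_pair.Fubini_integral[OF this]
  have "(LINT y|lborel. LINT x|lborel. f x * g y * h x y) = (LINT x|lborel. LINT y|lborel. f x * g y * h x y)" .
  moreover have "(LINT y|lborel. f x * g y * h x y) = f x * (LINT y|lborel. g y * h x y)" for x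
    by (simp add: mult.assoc)
  moreover have "(LINT x|lborel. f x * g y * h x y) = g y * (LINT x|lborel. f x * h x y)" for y
    by (subst integral_mult_right_zero[symmetric]) (simp add: mult_ac)
  ultimately show ?thesis by simp
qed

lemma integrable_std_gaussian: "integrable lborel (\<lambda>x. exp (- x\<^sup>2 / 2) :: real)"
proof -
  have "integrable lborel std_normal_density" by simp
  then have "integrable lborel (\<lambda>x. sqrt (2 * pi) * std_normal_density x)" by (rule integrable_mult_right)
  then show ?thesis by (simp add: std_normal_density_def)
qed

text \<open>The characteristic function of the standard normal distribution, up to the normalisation of its density.\<close>

lemma ft_std_gaussian:
  "ft (\<lambda>x. complex_of_real (exp (- x\<^sup>2 / 2))) \<xi> = complex_of_real (sqrt (2 * pi) * exp (- \<xi>\<^sup>2 / 2))"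
proof -
  have "complex_of_real (exp (- (- \<xi>)\<^sup>2 / 2)) = char std_normal_distribution (- \<xi>)"
    by (simp add: char_std_normal_distribution)
  also have "\<dots> = (LINT x|lborel. std_normal_density x *\<^sub>R iexp (- \<xi> * x))"
    unfolding char_def by (subst integral_density) auto
  also have "\<dots> = (LINT x|lborel. complex_of_real (1 / sqrt (2 * pi)) * (complex_of_real (exp (- x\<^sup>2 / 2)) * cis (- (x * \<xi>))))"
    by (intro Bochner_Integration.integral_cong) (auto simp: std_normal_density_def cis_conv_exp scaleR_conv_of_real mult_ac)
  also have "\<dots> = complex_of_real (1 / sqrt (2 * pi)) * ft (\<lambda>x. complex_of_real (exp (- x\<^sup>2 / 2))) \<xi>"
    unfolding ft_def by (rule integral_mult_right_zero)
  finally show ?thesis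
    by (simp add: field_simps)
qed

lemma integrable_gaussian:
  assumes "e > 0"
  shows "integrable lborel (\<lambda>x. exp (- (e * x)\<^sup>2 / 2) :: real)"
  using lborel_integrable_real_affine[OF integrable_std_gaussian, of e 0] assms by simp

lemma ft_gaussian:
  assumes e: "e > 0"
  shows "ft (\<lambda>x. complex_of_real (exp (- (e * x)\<^sup>2 / 2))) \<xi> = complex_of_real (sqrt (2 * pi) / e * exp (- (\<xi> / e)\<^sup>2 / 2))"
proof -
  have "complex_of_real (sqrt (2 * pi) * exp (- (\<xi> / e)\<^sup>2 / 2)) = ft (\<lambda>x. complex_of_real (exp (- x\<^sup>2 / 2))) (\<xi> / e)"
    by (simp only: ft_std_gaussian)
  also have "\<dots> = complex_of_real e * ft (\<lambda>x. complex_of_real (exp (- (e * x)\<^sup>2 / 2))) \<xi>"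
    unfolding ft_def using e
    by (subst lborel_integral_real_affine[of e _ 0]) (auto simp: scaleR_conv_of_real mult_ac)
  finally show ?thesis
    using e by (simp add: field_simps)
qed

text \<open>The total mass is the value at frequency \<open>0\<close> of the transform of the Gaussian of inverse width.\<close>

lemma nn_integral_gaussian:
  assumes e: "e > 0"
  shows "(\<integral>\<^sup>+x. ennreal (sqrt (2 * pi) / e * exp (- (x / e)\<^sup>2 / 2)) \<partial>lborel) = ennreal (2 * pi)"
proof -
  have i: "integrable lborel (\<lambda>x. exp (- (x / e)\<^sup>2 / 2) :: real)"
    using integrable_gaussian[of "1/e"] e by simp
  have "complex_of_real (LINT x|lborel. exp (- (x / e)\<^sup>2 / 2)) = complex_of_real (sqrt (2 * pi) * e)"
    using ft_gaussian[of "1/e" 0] e by (simp add: ft_def mult.commute)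
  then have "(LINT x|lborel. exp (- (x / e)\<^sup>2 / 2)) = sqrt (2 * pi) * e"
    by (simp only: of_real_eq_iff)
  with i e show ?thesis
    by (subst nn_integral_eq_integral) (auto simp: field_simps)
qed

text \<open>Each exchange of integrals takes place against the integrable Gaussian.  Integrating out the
  frequency first leaves the transform of the Gaussian, evaluated at \<open>x - y\<close>.\<close>

lemma ft_gaussian_weighted:
  fixes f :: "real \<Rightarrow> complex"
  assumes f: "integrable lborel f" and e: "e > 0"
  defines "K \<equiv> \<lambda>x. sqrt (2 * pi) / e * exp (- (x / e)\<^sup>2 / 2)"
  shows "(LINT \<xi>|lborel. complex_of_real (exp (- (e * \<xi>)\<^sup>2 / 2)) * (ft f \<xi> * cnj (ft f \<xi>)))
       = (LINT x|lborel. f x * (LINT y|lborel. cnj (f y) * complex_of_real (K (x - y))))"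
proof -
  note [measurable] = borel_measurable_integrable[OF f]
  define G where "G \<xi> = complex_of_real (exp (- (e * \<xi>)\<^sup>2 / 2))" for \<xi>
  have G: "integrable lborel G"
    unfolding G_def using integrable_gaussian[OF e] by (simp only: integrable_of_real)
  note [measurable] = borel_measurable_integrable[OF G]
  have cf: "integrable lborel (\<lambda>y. cnj (f y))"
    using f by simp
  define M where "M = (LINT x|lborel. cmod (f x))"
  have inner: "(LINT \<xi>|lborel. G \<xi> * (cis (- (x * \<xi>)) * cnj (ft f \<xi>)))
       = (LINT y|lborel. cnj (f y) * complex_of_real (K (x - y)))" for x
  proof -
    have "cnj (ft f \<xi>) = (LINT y|lborel. cnj (f y) * cis (y * \<xi>))" for \<xi>
      unfolding ft_def by (subst Bochner_Integration.integral_cnj[symmetric]) (simp add: cis_cnj)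
    then have "(LINT \<xi>|lborel. G \<xi> * (cis (- (x * \<xi>)) * cnj (ft f \<xi>)))
       = (LINT \<xi>|lborel. G \<xi> * (LINT y|lborel. cnj (f y) * cis (- ((x - y) * \<xi>))))"
      by (intro Bochner_Integration.integral_cong refl arg_cong2[where f="(*)"])
         (simp add: cis_mult algebra_simps flip: integral_mult_right_zero)
    also have "\<dots> = (LINT y|lborel. cnj (f y) * (LINT \<xi>|lborel. G \<xi> * cis (- ((x - y) * \<xi>))))"
      by (rule Fubini_bounded_kernel[OF G cf, where B = 1]) auto
    also have "\<dots> = (LINT y|lborel. cnj (f y) * complex_of_real (K (x - y)))"
    proof -
      have "(LINT \<xi>|lborel. G \<xi> * cis (- (z * \<xi>))) = complex_of_real (K z)" for z
        using ft_gaussian[OF e, of z] unfolding ft_def G_def K_def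
        by (simp only: mult.commute[of z])
      then show ?thesis by simp
    qed
    finally show ?thesis .
  qed
  have "(LINT \<xi>|lborel. G \<xi> * (ft f \<xi> * cnj (ft f \<xi>)))
      = (LINT \<xi>|lborel. G \<xi> * (LINT x|lborel. f x * (cis (- (x * \<xi>)) * cnj (ft f \<xi>))))"
    unfolding ft_def[of f]
    by (subst integral_mult_left_zero[symmetric]) (simp add: mult.assoc)
  also have "\<dots> = (LINT x|lborel. f x * (LINT \<xi>|lborel. G \<xi> * (cis (- (x * \<xi>)) * cnj (ft f \<xi>))))"
  proof (rule Fubini_bounded_kernel[OF G f, where B = M])
    show "(\<lambda>(\<xi>, x). cis (- (x * \<xi>)) * cnj (ft f \<xi>)) \<in> borel_measurable (borel \<Otimes>\<^sub>M borel)"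
      by measurable
  qed (auto simp: norm_mult M_def cmod_ft_le)
  also have "\<dots> = (LINT x|lborel. f x * (LINT y|lborel. cnj (f y) * complex_of_real (K (x - y))))"
    by (simp only: inner)
  finally show ?thesis by (simp add: G_def)
qed

text \<open>Weighting by a Gaussian turns \<open>\<integral>\<bar>ft f\<bar>\<^sup>2\<close> into a quadratic form in \<open>f\<close> whose kernel is nonnegative and has
  total mass \<open>2\<pi>\<close> in each variable, so it is at most \<open>2\<pi> \<integral>\<bar>f\<bar>\<^sup>2\<close> (Schur's test).  The weight is removed by
  Fatou's lemma.\<close>

lemma ft_bounded:
  fixes f :: "real \<Rightarrow> complex"
  assumes f: "integrable lborel f" and f2: "square_integrable f"
  shows "square_integrable (ft f) \<and> l2norm (ft f) \<le> sqrt (2 * pi) * l2norm f"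
proof (rule l2norm_le_nn)
  note [measurable] = borel_measurable_integrable[OF f]
  show "ft f \<in> borel_measurable borel" by measurable
  show "0 \<le> sqrt (2 * pi) * l2norm f" by simp
  define S where "S = ennreal ((l2norm f)\<^sup>2)"
  define W where "W = (\<integral>\<^sup>+x. ennreal ((cmod (f x))\<^sup>2) \<partial>lborel)"
  have WS: "W = S" by (simp add: W_def S_def nn_l2norm f2)
  have main: "(\<integral>\<^sup>+\<xi>. ennreal (exp (- (e * \<xi>)\<^sup>2 / 2) * (cmod (ft f \<xi>))\<^sup>2) \<partial>lborel) \<le> ennreal (2 * pi) * S"
    if e: "e > 0" for e :: real
  proof -
    define K where "K x = sqrt (2 * pi) / e * exp (- (x / e)\<^sup>2 / 2)" for x
    have K0: "0 \<le> K x" for x using e by (simp add: K_def)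
    have [measurable]: "K \<in> borel_measurable borel" unfolding K_def by measurable
    define c :: real where "c = 1 / 2"
    have c: "0 \<le> c" and c2: "c + c = 1" by (simp_all add: c_def)
    have nK: "(\<integral>\<^sup>+x. ennreal (K x) \<partial>lborel) = ennreal (2 * pi)"
      unfolding K_def by (rule nn_integral_gaussian[OF e])
    have nK1: "(\<integral>\<^sup>+y. ennreal (K (x - y)) \<partial>lborel) = ennreal (2 * pi)" for x
      using nn_integral_real_affine[of "\<lambda>x. ennreal (K x)" "-1" x] nK by simp
    have nK2: "(\<integral>\<^sup>+x. ennreal (K (x - y)) \<partial>lborel) = ennreal (2 * pi)" for y
      using nn_integral_real_affine[of "\<lambda>x. ennreal (K x)" "1" "-y"] nK by simp
    have i: "integrable lborel (\<lambda>\<xi>. exp (- (e * \<xi>)\<^sup>2 / 2) * (cmod (ft f \<xi>))\<^sup>2)"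
    proof (rule Bochner_Integration.integrable_bound)
      define M where "M = (LINT x|lborel. cmod (f x))"
      show "integrable lborel (\<lambda>\<xi>. M\<^sup>2 * exp (- (e * \<xi>)\<^sup>2 / 2))"
        by (intro integrable_mult_right integrable_gaussian e)
      show "AE \<xi> in lborel. norm (exp (- (e * \<xi>)\<^sup>2 / 2) * (cmod (ft f \<xi>))\<^sup>2) \<le> norm (M\<^sup>2 * exp (- (e * \<xi>)\<^sup>2 / 2))"
        using cmod_ft_le[of f] by (auto simp: M_def mult.commute intro!: mult_right_mono power_mono)
    qed measurable
    have "(\<integral>\<^sup>+\<xi>. ennreal (exp (- (e * \<xi>)\<^sup>2 / 2) * (cmod (ft f \<xi>))\<^sup>2) \<partial>lborel)
        = ennreal (LINT \<xi>|lborel. exp (- (e * \<xi>)\<^sup>2 / 2) * (cmod (ft f \<xi>))\<^sup>2)"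
      using i by (intro nn_integral_eq_integral) auto
    also have "(LINT \<xi>|lborel. exp (- (e * \<xi>)\<^sup>2 / 2) * (cmod (ft f \<xi>))\<^sup>2)
        = cmod (LINT \<xi>|lborel. complex_of_real (exp (- (e * \<xi>)\<^sup>2 / 2)) * (ft f \<xi> * cnj (ft f \<xi>)))"
    proof -
      have "(LINT \<xi>|lborel. complex_of_real (exp (- (e * \<xi>)\<^sup>2 / 2)) * (ft f \<xi> * cnj (ft f \<xi>)))
        = complex_of_real (LINT \<xi>|lborel. exp (- (e * \<xi>)\<^sup>2 / 2) * (cmod (ft f \<xi>))\<^sup>2)"
        by (subst integral_complex_of_real[symmetric]) (simp flip: complex_norm_square)
      then show ?thesis
        by (simp add: abs_of_nonneg)
    qed
    also have "\<dots> = cmod (LINT x|lborel. f x * (LINT y|lborel. cnj (f y) * complex_of_real (K (x - y))))"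
      unfolding K_def by (subst ft_gaussian_weighted[OF f e]) (rule refl)
    also have "ennreal \<dots> \<le> (\<integral>\<^sup>+x. \<integral>\<^sup>+y. ennreal (cmod (f x) * cmod (f y) * K (x - y)) \<partial>lborel \<partial>lborel)"
    proof (rule order_trans[OF cmod_integral_le_nn])
      show "(\<integral>\<^sup>+x. ennreal (cmod (f x * (LINT y|lborel. cnj (f y) * complex_of_real (K (x - y))))) \<partial>lborel)
        \<le> (\<integral>\<^sup>+x. \<integral>\<^sup>+y. ennreal (cmod (f x) * cmod (f y) * K (x - y)) \<partial>lborel \<partial>lborel)"
      proof (rule nn_integral_mono)
        fix x
        have "ennreal (cmod (f x * (LINT y|lborel. cnj (f y) * complex_of_real (K (x - y)))))
           = ennreal (cmod (LINT y|lborel. f x * (cnj (f y) * complex_of_real (K (x - y)))))"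
          by simp
        also have "\<dots> \<le> (\<integral>\<^sup>+y. ennreal (cmod (f x * (cnj (f y) * complex_of_real (K (x - y))))) \<partial>lborel)"
          by (rule cmod_integral_le_nn)
        also have "\<dots> = (\<integral>\<^sup>+y. ennreal (cmod (f x) * cmod (f y) * K (x - y)) \<partial>lborel)"
          using K0 by (simp add: norm_mult mult.assoc)
        finally show "ennreal (cmod (f x * (LINT y|lborel. cnj (f y) * complex_of_real (K (x - y)))))
          \<le> (\<integral>\<^sup>+y. ennreal (cmod (f x) * cmod (f y) * K (x - y)) \<partial>lborel)" .
      qed
    qed
    also have "\<dots> \<le> (\<integral>\<^sup>+x. \<integral>\<^sup>+y. ennreal c * (ennreal ((cmod (f x))\<^sup>2) * ennreal (K (x - y))) + ennreal c * (ennreal ((cmod (f y))\<^sup>2) * ennreal (K (x - y))) \<partial>lborel \<partial>lborel)"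
    proof (intro nn_integral_mono)
      fix x y
      have "cmod (f x) * cmod (f y) * K (x - y) \<le> (c * (cmod (f x))\<^sup>2 + c * (cmod (f y))\<^sup>2) * K (x - y)"
        using sum_squares_bound[of "cmod (f x)" "cmod (f y)"] by (intro mult_right_mono K0) (auto simp: c_def)
      then show "ennreal (cmod (f x) * cmod (f y) * K (x - y)) \<le> ennreal c * (ennreal ((cmod (f x))\<^sup>2) * ennreal (K (x - y))) + ennreal c * (ennreal ((cmod (f y))\<^sup>2) * ennreal (K (x - y)))"
        using K0 c by (simp add: algebra_simps flip: ennreal_mult ennreal_plus)
    qed
    also have "\<dots> = ennreal c * (\<integral>\<^sup>+x. \<integral>\<^sup>+y. ennreal ((cmod (f x))\<^sup>2) * ennreal (K (x - y)) \<partial>lborel \<partial>lborel)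
        + ennreal c * (\<integral>\<^sup>+x. \<integral>\<^sup>+y. ennreal ((cmod (f y))\<^sup>2) * ennreal (K (x - y)) \<partial>lborel \<partial>lborel)"
      by (simp add: nn_integral_add nn_integral_cmult)
    also have "(\<integral>\<^sup>+x. \<integral>\<^sup>+y. ennreal ((cmod (f x))\<^sup>2) * ennreal (K (x - y)) \<partial>lborel \<partial>lborel) = W * ennreal (2 * pi)"
      by (simp add: nn_integral_cmult nn_integral_multc nK1 W_def)
    also have "(\<integral>\<^sup>+x. \<integral>\<^sup>+y. ennreal ((cmod (f y))\<^sup>2) * ennreal (K (x - y)) \<partial>lborel \<partial>lborel) = W * ennreal (2 * pi)"
      by (subst lborel_pair.Fubini') (simp_all add: nn_integral_cmult nn_integral_multc nK2 W_def)
    also have "ennreal c * (W * ennreal (2 * pi)) + ennreal c * (W * ennreal (2 * pi)) = ennreal (2 * pi) * S"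
      unfolding WS S_def using c by (simp add: c2 flip: ennreal_mult ennreal_plus distrib_right)
    finally show ?thesis .
  qed
  have "(\<integral>\<^sup>+\<xi>. ennreal ((cmod (ft f \<xi>))\<^sup>2) \<partial>lborel)
     = (\<integral>\<^sup>+\<xi>. liminf (\<lambda>n. ennreal (exp (- (inverse (real (Suc n)) * \<xi>)\<^sup>2 / 2) * (cmod (ft f \<xi>))\<^sup>2)) \<partial>lborel)"
  proof (rule nn_integral_cong)
    fix \<xi>
    have "(\<lambda>n. ennreal (exp (- (inverse (real (Suc n)) * \<xi>)\<^sup>2 / 2) * (cmod (ft f \<xi>))\<^sup>2))
       \<longlonglongrightarrow> ennreal (exp (- (0 * \<xi>)\<^sup>2 / 2) * (cmod (ft f \<xi>))\<^sup>2)"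
      by (intro tendsto_intros LIMSEQ_inverse_real_of_nat) auto
    then show "ennreal ((cmod (ft f \<xi>))\<^sup>2) = liminf (\<lambda>n. ennreal (exp (- (inverse (real (Suc n)) * \<xi>)\<^sup>2 / 2) * (cmod (ft f \<xi>))\<^sup>2))"
      using lim_imp_Liminf[OF trivial_limit_sequentially] by force
  qed
  also have "\<dots> \<le> liminf (\<lambda>n. \<integral>\<^sup>+\<xi>. ennreal (exp (- (inverse (real (Suc n)) * \<xi>)\<^sup>2 / 2) * (cmod (ft f \<xi>))\<^sup>2) \<partial>lborel)"
    by (rule nn_integral_liminf) measurable
  also have "\<dots> \<le> ennreal (2 * pi) * S"
    by (intro Liminf_le always_eventually allI main) auto
  also have "\<dots> = ennreal ((sqrt (2 * pi) * l2norm f)\<^sup>2)"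
    by (simp add: S_def power_mult_distrib ennreal_mult)
  finally show "(\<integral>\<^sup>+\<xi>. ennreal ((cmod (ft f \<xi>))\<^sup>2) \<partial>lborel) \<le> ennreal ((sqrt (2 * pi) * l2norm f)\<^sup>2)" .
qed

section \<open>The Fourier transform of square-integrable functions\<close>

definition trunc :: "real \<Rightarrow> (real \<Rightarrow> complex) \<Rightarrow> real \<Rightarrow> complex"
  where "trunc r f x = indicator {-r..r} x *\<^sub>R f x"

lemma measurable_trunc [measurable]:
  assumes [measurable]: "f \<in> borel_measurable borel"
  shows "trunc r f \<in> borel_measurable borel"
  unfolding trunc_def[abs_def] by measurable

lemma square_integrable_trunc:
  assumes f: "square_integrable f"
  shows "square_integrable (trunc r f)"
proof -
  note [measurable] = sqint_measurable[OF f]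
  show ?thesis
    by (rule square_integrableI_bound[OF _ f, of _ 1]) (auto simp: trunc_def indicator_def)
qed

lemma square_integrable_indicator:
  assumes [measurable]: "A \<in> sets borel" and "emeasure lborel A < \<infinity>"
  shows "square_integrable (indicator A :: real \<Rightarrow> complex)"
proof -
  have "(\<lambda>x. (norm (indicator A x :: complex))\<^sup>2) = (indicator A :: real \<Rightarrow> real)"
    by (auto simp: indicator_def)
  then show ?thesis
    using assms(2) by (simp add: square_integrable_def)
qed

lemma integrable_trunc:
  assumes f: "square_integrable f"
  shows "integrable lborel (trunc r f)"
proof -
  have "integrable lborel (\<lambda>x. indicator {-r..r} x * f x)"
    by (intro integrable_mult_sqint square_integrable_indicator f) (auto simp: emeasure_lborel_Icc_eq)
  also have "(\<lambda>x. indicator {-r..r} x * f x) = trunc r f"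
    by (auto simp: trunc_def indicator_def)
  finally show ?thesis .
qed

lemma trunc_tendsto:
  assumes f: "square_integrable f"
  shows "((\<lambda>r. l2norm (\<lambda>x. trunc r f x - f x)) \<longlongrightarrow> 0) at_top"
proof -
  note [measurable] = sqint_measurable[OF f]
  have "((\<lambda>r. LINT x|lborel. (cmod (trunc r f x - f x))\<^sup>2) \<longlongrightarrow> (LINT x|(lborel :: real measure). 0)) at_top"
  proof (rule integral_dominated_convergence_at_top)
    show "integrable lborel (\<lambda>x. (cmod (f x))\<^sup>2)" using f by (simp add: square_integrable_def)
    show "\<forall>\<^sub>F r in at_top. AE x in lborel. norm ((cmod (trunc r f x - f x))\<^sup>2) \<le> (cmod (f x))\<^sup>2"
      by (auto simp: trunc_def indicator_def)
    show "AE x in lborel. ((\<lambda>r. (cmod (trunc r f x - f x))\<^sup>2) \<longlongrightarrow> 0) at_top"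
    proof (rule AE_I2)
      fix x :: real
      have "\<forall>\<^sub>F r in at_top. \<bar>x\<bar> \<le> r" by (rule eventually_ge_at_top)
      then have "\<forall>\<^sub>F r in at_top. (cmod (trunc r f x - f x))\<^sup>2 = 0"
        by eventually_elim (auto simp: trunc_def indicator_def abs_le_iff)
      then show "((\<lambda>r. (cmod (trunc r f x - f x))\<^sup>2) \<longlongrightarrow> 0) at_top"
        by (rule tendsto_eventually)
    qed
  qed measurable
  from tendsto_real_sqrt[OF this] show ?thesis
    by (simp add: l2norm_def)
qed

lemma set_integral_eq_ft_trunc: "(LINT x:{-r..r}|lborel. f x * cis (- (x * \<xi>))) = ft (trunc r f) \<xi>"
  by (simp add: set_lebesgue_integral_def ft_def trunc_def)

lemma ft_trunc_sqint:
  assumes "square_integrable f"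
  shows "square_integrable (ft (trunc r f))"
  using ft_bounded[OF integrable_trunc[OF assms] square_integrable_trunc[OF assms]] by simp

text \<open>The truncated integrals in the definition are Fourier integrals of truncations of \<open>f\<close>, which lie in
  \<open>L\<^sup>1 \<inter> L\<^sup>2\<close>, so that the bound for \<^const>\<open>ft\<close> applies to them.\<close>

lemma has_fourier_transform_iff:
  "has_fourier_transform f g \<longleftrightarrow> square_integrable f \<and> square_integrable g \<and>
     ((\<lambda>r. l2norm (\<lambda>\<xi>. ft (trunc r f) \<xi> - g \<xi>)) \<longlongrightarrow> 0) at_top" (is "?L \<longleftrightarrow> ?R")
proof -
  have "((\<lambda>r. \<integral>\<^sup>+ \<xi>. ennreal ((cmod (ft (trunc r f) \<xi> - g \<xi>))\<^sup>2) \<partial>lborel) \<longlongrightarrow> 0) at_top \<longleftrightarrow>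
     ((\<lambda>r. l2norm (\<lambda>\<xi>. ft (trunc r f) \<xi> - g \<xi>)) \<longlongrightarrow> 0) at_top" (is "?l \<longleftrightarrow> ?r")
    if f: "square_integrable f" and g: "square_integrable g"
  proof -
    have "?l \<longleftrightarrow> ((\<lambda>r. ennreal ((l2norm (\<lambda>\<xi>. ft (trunc r f) \<xi> - g \<xi>))\<^sup>2)) \<longlongrightarrow> ennreal 0) at_top"
      by (simp add: nn_l2norm[OF square_integrable_diff[OF ft_trunc_sqint[OF f] g]])
    also have "\<dots> \<longleftrightarrow> ((\<lambda>r. (l2norm (\<lambda>\<xi>. ft (trunc r f) \<xi> - g \<xi>))\<^sup>2) \<longlongrightarrow> 0) at_top"
      by (subst tendsto_ennreal_iff) auto
    also have "\<dots> \<longleftrightarrow> ?r"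
      by (simp add: power_tendsto_0_iff)
    finally show ?thesis .
  qed
  then show ?thesis
    unfolding has_fourier_transform_def set_integral_eq_ft_trunc by blast
qed

lemma ft_diff:
  assumes f: "integrable lborel f" and g: "integrable lborel g"
  shows "ft (\<lambda>x. f x - g x) \<xi> = ft f \<xi> - ft g \<xi>"
  unfolding ft_def left_diff_distrib
  by (rule Bochner_Integration.integral_diff; rule integrable_mult_bounded[OF _ _ order_refl]
      integrable_mult_bounded[where B=1]) (use f g in auto)

lemma ft_add:
  assumes f: "integrable lborel f" and g: "integrable lborel g"
  shows "ft (\<lambda>x. f x + g x) \<xi> = ft f \<xi> + ft g \<xi>"
  unfolding ft_def distrib_right
  by (rule Bochner_Integration.integral_add; rule integrable_mult_bounded[where B=1]) (use f g in auto)

lemma l2norm_ft_diff_le: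
  assumes f: "integrable lborel f" "square_integrable f" and g: "integrable lborel g" "square_integrable g"
  shows "l2norm (\<lambda>\<xi>. ft f \<xi> - ft g \<xi>) \<le> sqrt (2 * pi) * l2norm (\<lambda>x. f x - g x)"
proof -
  have "(\<lambda>\<xi>. ft f \<xi> - ft g \<xi>) = ft (\<lambda>x. f x - g x)"
    using f g by (simp add: fun_eq_iff ft_diff)
  then show ?thesis
    using ft_bounded[of "\<lambda>x. f x - g x"] f g by (simp add: square_integrable_diff)
qed

lemma l2norm_trunc_diff_le:
  assumes "square_integrable f"
  shows "l2norm (\<lambda>x. trunc r f x - trunc q f x)
     \<le> l2norm (\<lambda>x. trunc r f x - f x) + l2norm (\<lambda>x. trunc q f x - f x)"
  using l2norm_triangle_diff[OF square_integrable_trunc[OF assms] assms square_integrable_trunc[OF assms], of r q]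
  by (simp add: l2norm_minus_commute[of f])

text \<open>By the \<open>L\<^sup>2\<close> bound, truncation at \<open>r\<close> and at \<open>n\<close> have transforms that differ by at most a multiple of
  the two truncation errors.  Completeness gives a limit along integers; letting \<open>n\<close> tend to infinity in
  this estimate yields the limit along real \<open>r\<close>.\<close>

lemma has_fourier_transform_exists:
  assumes f: "square_integrable f"
  shows "\<exists>g. has_fourier_transform f g"
proof -
  define D where "D r = l2norm (\<lambda>x. trunc r f x - f x)" for r
  have D: "(D \<longlongrightarrow> 0) at_top" unfolding D_def by (rule trunc_tendsto[OF f])
  define c where "c = sqrt (2 * pi)"
  have c: "c > 0" by (simp add: c_def)
  have step: "l2norm (\<lambda>\<xi>. ft (trunc r f) \<xi> - ft (trunc q f) \<xi>) \<le> c * (D r + D q)" for r q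
  proof -
    have "l2norm (\<lambda>\<xi>. ft (trunc r f) \<xi> - ft (trunc q f) \<xi>) \<le> c * l2norm (\<lambda>x. trunc r f x - trunc q f x)"
      unfolding c_def by (intro l2norm_ft_diff_le integrable_trunc square_integrable_trunc f)
    also have "\<dots> \<le> c * (D r + D q)"
      unfolding D_def using c by (intro mult_left_mono l2norm_trunc_diff_le f) auto
    finally show ?thesis .
  qed
  have Dn: "(\<lambda>n. D (real n)) \<longlonglongrightarrow> 0"
    using filterlim_compose[OF D filterlim_real_sequentially] .
  have "\<exists>g. square_integrable g \<and> (\<lambda>n. l2norm (\<lambda>x. ft (trunc (real n) f) x - g x)) \<longlonglongrightarrow> 0"
  proof (rule l2_complete)
    fix e :: real assume e: "e > 0"
    have "\<forall>\<^sub>F n in sequentially. D (real n) < e / (2 * c)"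
      using e c by (intro order_tendstoD(2)[OF Dn]) auto
    then obtain N where N: "\<And>n. n \<ge> N \<Longrightarrow> D (real n) < e / (2 * c)"
      by (auto simp: eventually_sequentially)
    show "\<exists>N. \<forall>m\<ge>N. \<forall>n\<ge>N. l2norm (\<lambda>x. ft (trunc (real m) f) x - ft (trunc (real n) f) x) < e"
    proof (intro exI[of _ N] allI impI)
      fix m n assume mn: "m \<ge> N" "n \<ge> N"
      have "c * (D (real m) + D (real n)) < c * (e / (2 * c) + e / (2 * c))"
        using N[OF mn(1)] N[OF mn(2)] c by (intro mult_strict_left_mono add_strict_mono) auto
      also have "\<dots> = e" using c by simp
      finally show "l2norm (\<lambda>x. ft (trunc (real m) f) x - ft (trunc (real n) f) x) < e"
        using step[of m n] by linarith
    qed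
  qed (rule ft_trunc_sqint[OF f])
  then obtain g where g: "square_integrable g"
    and lim: "(\<lambda>n. l2norm (\<lambda>x. ft (trunc (real n) f) x - g x)) \<longlonglongrightarrow> 0" by blast
  have le: "l2norm (\<lambda>\<xi>. ft (trunc r f) \<xi> - g \<xi>) \<le> c * D r" for r
  proof (rule LIMSEQ_le_const[of "\<lambda>n. c * (D r + D (real n)) + l2norm (\<lambda>x. ft (trunc (real n) f) x - g x)"])
    have "(\<lambda>n. c * (D r + D (real n)) + l2norm (\<lambda>x. ft (trunc (real n) f) x - g x)) \<longlonglongrightarrow> c * (D r + 0) + 0"
      by (intro tendsto_intros Dn lim)
    then show "(\<lambda>n. c * (D r + D (real n)) + l2norm (\<lambda>x. ft (trunc (real n) f) x - g x)) \<longlonglongrightarrow> c * D r"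
      by simp
    have "l2norm (\<lambda>\<xi>. ft (trunc r f) \<xi> - g \<xi>) \<le> c * (D r + D (real n)) + l2norm (\<lambda>x. ft (trunc (real n) f) x - g x)" for n
      using step[of r n] l2norm_triangle_diff[OF ft_trunc_sqint[OF f] ft_trunc_sqint[OF f] g, of r "real n"] by linarith
    then show "\<exists>N. \<forall>n\<ge>N. l2norm (\<lambda>\<xi>. ft (trunc r f) \<xi> - g \<xi>) \<le> c * (D r + D (real n)) + l2norm (\<lambda>x. ft (trunc (real n) f) x - g x)"
      by blast
  qed
  have "((\<lambda>r. l2norm (\<lambda>\<xi>. ft (trunc r f) \<xi> - g \<xi>)) \<longlongrightarrow> 0) at_top"
  proof (rule tendsto_sandwich[OF _ _ tendsto_const])
    show "((\<lambda>r. c * D r) \<longlongrightarrow> 0) at_top" using tendsto_mult_right_zero[OF D] .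
  qed (use le in auto)
  then show ?thesis using f g by (auto simp: has_fourier_transform_iff)
qed

lemma has_fourier_transform_unique:
  assumes "has_fourier_transform f g" "has_fourier_transform f h"
  shows "AE \<xi> in lborel. g \<xi> = h \<xi>"
proof -
  from assms have f: "square_integrable f" and g: "square_integrable g" and h: "square_integrable h"
    and l: "((\<lambda>r. l2norm (\<lambda>\<xi>. ft (trunc r f) \<xi> - g \<xi>)) \<longlongrightarrow> 0) at_top"
      "((\<lambda>r. l2norm (\<lambda>\<xi>. ft (trunc r f) \<xi> - h \<xi>)) \<longlongrightarrow> 0) at_top"
    by (auto simp: has_fourier_transform_iff)
  have "l2norm (\<lambda>\<xi>. g \<xi> - h \<xi>) \<le> 0"
  proof (rule tendsto_lowerbound)
    show "((\<lambda>r. l2norm (\<lambda>\<xi>. ft (trunc r f) \<xi> - g \<xi>) + l2norm (\<lambda>\<xi>. ft (trunc r f) \<xi> - h \<xi>)) \<longlongrightarrow> 0) at_top"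
      using tendsto_add[OF l] by simp
    show "\<forall>\<^sub>F r in at_top. l2norm (\<lambda>\<xi>. g \<xi> - h \<xi>) \<le> l2norm (\<lambda>\<xi>. ft (trunc r f) \<xi> - g \<xi>) + l2norm (\<lambda>\<xi>. ft (trunc r f) \<xi> - h \<xi>)"
      using l2norm_triangle_diff[OF g ft_trunc_sqint[OF f] h] by (auto simp: l2norm_minus_commute[of g])
  qed simp
  then have "AE \<xi> in lborel. g \<xi> - h \<xi> = 0"
    using g h by (intro l2norm_eq_0 square_integrable_diff) (auto simp: antisym)
  then show ?thesis by simp
qed

lemma has_fourier_transform_AE_right:
  assumes "has_fourier_transform f g" "square_integrable h" "AE \<xi> in lborel. h \<xi> = g \<xi>"
  shows "has_fourier_transform f h"
proof -
  from assms(1) have f: "square_integrable f" and g: "square_integrable g"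
    by (auto simp: has_fourier_transform_iff)
  have "l2norm (\<lambda>\<xi>. ft (trunc r f) \<xi> - h \<xi>) = l2norm (\<lambda>\<xi>. ft (trunc r f) \<xi> - g \<xi>)" for r
    using assms(3) by (intro l2norm_cong_AE square_integrable_diff ft_trunc_sqint f g assms(2)) auto
  then show ?thesis using assms by (simp add: has_fourier_transform_iff)
qed

lemma has_fourier_transform_AE_left:
  assumes "has_fourier_transform f g" and [measurable]: "h \<in> borel_measurable borel" and "AE x in lborel. h x = f x"
  shows "has_fourier_transform h g"
proof -
  from assms(1) have f: "square_integrable f" and g: "square_integrable g"
    by (auto simp: has_fourier_transform_iff)
  note [measurable] = sqint_measurable[OF f]
  have h: "square_integrable h" using square_integrable_AE_cong[OF assms(2) f assms(3)] .
  have "ft (trunc r h) = ft (trunc r f)" for r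
    unfolding ft_def[abs_def] using assms(3)
    by (intro ext integral_cong_AE) (auto simp: trunc_def)
  then show ?thesis using h assms(1) by (simp add: has_fourier_transform_iff)
qed

lemma has_fourier_transform_L1:
  assumes f: "integrable lborel f" "square_integrable f"
  shows "has_fourier_transform f (ft f)"
proof -
  have "((\<lambda>r. l2norm (\<lambda>\<xi>. ft (trunc r f) \<xi> - ft f \<xi>)) \<longlongrightarrow> 0) at_top"
  proof (rule tendsto_sandwich[OF _ _ tendsto_const])
    show "((\<lambda>r. sqrt (2 * pi) * l2norm (\<lambda>x. trunc r f x - f x)) \<longlongrightarrow> 0) at_top"
      by (rule tendsto_mult_right_zero[OF trunc_tendsto[OF f(2)]])
  qed (auto intro!: always_eventually l2norm_ft_diff_le integrable_trunc square_integrable_trunc f)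
  then show ?thesis using f ft_bounded[OF f] by (simp add: has_fourier_transform_iff)
qed

lemma has_fourier_transform_add:
  assumes "has_fourier_transform f F" "has_fourier_transform g G"
  shows "has_fourier_transform (\<lambda>x. f x + g x) (\<lambda>x. F x + G x)"
proof -
  from assms have f: "square_integrable f" and g: "square_integrable g"
    and F: "square_integrable F" and G: "square_integrable G"
    and l: "((\<lambda>r. l2norm (\<lambda>\<xi>. ft (trunc r f) \<xi> - F \<xi>)) \<longlongrightarrow> 0) at_top"
      "((\<lambda>r. l2norm (\<lambda>\<xi>. ft (trunc r g) \<xi> - G \<xi>)) \<longlongrightarrow> 0) at_top"
    by (auto simp: has_fourier_transform_iff)
  have "((\<lambda>r. l2norm (\<lambda>\<xi>. ft (trunc r (\<lambda>x. f x + g x)) \<xi> - (F \<xi> + G \<xi>))) \<longlongrightarrow> 0) at_top"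
  proof (rule tendsto_sandwich[OF _ _ tendsto_const])
    show "((\<lambda>r. l2norm (\<lambda>\<xi>. ft (trunc r f) \<xi> - F \<xi>) + l2norm (\<lambda>\<xi>. ft (trunc r g) \<xi> - G \<xi>)) \<longlongrightarrow> 0) at_top"
      using tendsto_add[OF l] by simp
    show "\<forall>\<^sub>F r in at_top. l2norm (\<lambda>\<xi>. ft (trunc r (\<lambda>x. f x + g x)) \<xi> - (F \<xi> + G \<xi>))
        \<le> l2norm (\<lambda>\<xi>. ft (trunc r f) \<xi> - F \<xi>) + l2norm (\<lambda>\<xi>. ft (trunc r g) \<xi> - G \<xi>)"
    proof (intro always_eventually allI)
      fix r
      have "trunc r (\<lambda>x. f x + g x) = (\<lambda>x. trunc r f x + trunc r g x)"
        by (auto simp: trunc_def scaleR_add_right)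
      then have "(\<lambda>\<xi>. ft (trunc r (\<lambda>x. f x + g x)) \<xi> - (F \<xi> + G \<xi>))
         = (\<lambda>\<xi>. (ft (trunc r f) \<xi> - F \<xi>) + (ft (trunc r g) \<xi> - G \<xi>))"
        using ft_add[OF integrable_trunc[OF f, of r] integrable_trunc[OF g, of r]]
        by (simp add: algebra_simps)
      then show "l2norm (\<lambda>\<xi>. ft (trunc r (\<lambda>x. f x + g x)) \<xi> - (F \<xi> + G \<xi>))
        \<le> l2norm (\<lambda>\<xi>. ft (trunc r f) \<xi> - F \<xi>) + l2norm (\<lambda>\<xi>. ft (trunc r g) \<xi> - G \<xi>)"
        by (simp only:) (intro l2norm_triangle square_integrable_diff ft_trunc_sqint f g F G)
    qed
  qed auto
  then show ?thesis using f g F G by (auto simp: has_fourier_transform_iff)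
qed

lemma has_fourier_transform_cmult:
  assumes "has_fourier_transform f F"
  shows "has_fourier_transform (\<lambda>x. c * f x) (\<lambda>x. c * F x)"
proof -
  from assms have f: "square_integrable f" and F: "square_integrable F"
    and l: "((\<lambda>r. l2norm (\<lambda>\<xi>. ft (trunc r f) \<xi> - F \<xi>)) \<longlongrightarrow> 0) at_top"
    by (auto simp: has_fourier_transform_iff)
  have "ft (trunc r (\<lambda>x. c * f x)) \<xi> = c * ft (trunc r f) \<xi>" for r \<xi>
    unfolding ft_def trunc_def by (subst integral_mult_right_zero[symmetric]) (simp add: mult_ac)
  then have "l2norm (\<lambda>\<xi>. ft (trunc r (\<lambda>x. c * f x)) \<xi> - c * F \<xi>) = cmod c * l2norm (\<lambda>\<xi>. ft (trunc r f) \<xi> - F \<xi>)" for r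
    by (simp add: l2norm_cmult flip: right_diff_distrib)
  then show ?thesis
    using f F tendsto_mult_right_zero[OF l, of "cmod c"]
    by (auto simp: has_fourier_transform_iff)
qed

lemma l2norm_reflect: "l2norm (\<lambda>x. f (- x)) = l2norm f"
  unfolding l2norm_def using lborel_integral_real_affine[of "-1" "\<lambda>x. (cmod (f x))\<^sup>2" 0] by simp

lemma l2norm_shift: "l2norm (\<lambda>x. f (x + a)) = l2norm f"
  unfolding l2norm_def using lborel_integral_real_affine[of "1" "\<lambda>x. (cmod (f x))\<^sup>2" a] by (simp add: add.commute)

lemma l2norm_cnj: "l2norm (\<lambda>x. cnj (f x)) = l2norm f"
  unfolding l2norm_def by simp

lemma square_integrable_affine:
  fixes f :: "real \<Rightarrow> complex"
  assumes f: "square_integrable f" and "c \<noteq> 0"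
  shows "square_integrable (\<lambda>x. f (a + c * x))"
proof -
  note [measurable] = sqint_measurable[OF f]
  show ?thesis
    using f lborel_integrable_real_affine[of "\<lambda>x. (cmod (f x))\<^sup>2" c a] assms(2)
    by (simp add: square_integrable_def)
qed

lemma square_integrable_reflect [intro]:
  fixes f :: "real \<Rightarrow> complex"
  shows "square_integrable f \<Longrightarrow> square_integrable (\<lambda>x. f (- x))"
  using square_integrable_affine[of f "-1" 0] by simp

lemma square_integrable_shift [intro]:
  fixes f :: "real \<Rightarrow> complex"
  shows "square_integrable f \<Longrightarrow> square_integrable (\<lambda>x. f (x + a))"
  using square_integrable_affine[of f 1 a] by (simp add: add.commute)

lemma square_integrable_cnj [intro]:
  fixes f :: "real \<Rightarrow> complex"
  assumes f: "square_integrable f"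
  shows "square_integrable (\<lambda>x. cnj (f x))"
proof -
  note [measurable] = sqint_measurable[OF f]
  show ?thesis using f by (simp add: square_integrable_def)
qed

lemma has_fourier_transform_cnj:
  assumes "has_fourier_transform f F"
  shows "has_fourier_transform (\<lambda>x. cnj (f x)) (\<lambda>\<xi>. cnj (F (- \<xi>)))"
proof -
  from assms have f: "square_integrable f" and F: "square_integrable F"
    by (auto simp: has_fourier_transform_iff)
  have "ft (trunc r (\<lambda>x. cnj (f x))) \<xi> = cnj (ft (trunc r f) (- \<xi>))" for r \<xi>
    unfolding ft_def trunc_def by (subst Bochner_Integration.integral_cnj[symmetric]) (simp add: cis_cnj)
  then have "l2norm (\<lambda>\<xi>. ft (trunc r (\<lambda>x. cnj (f x))) \<xi> - cnj (F (- \<xi>)))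
     = l2norm (\<lambda>\<xi>. ft (trunc r f) \<xi> - F \<xi>)" for r
    using l2norm_reflect[of "\<lambda>\<xi>. ft (trunc r f) \<xi> - F \<xi>"] l2norm_cnj[of "\<lambda>\<xi>. ft (trunc r f) (-\<xi>) - F (-\<xi>)"]
    by simp
  then show ?thesis
    using assms f F by (auto simp: has_fourier_transform_iff)
qed

lemma has_fourier_transform_reflect:
  assumes "has_fourier_transform f F"
  shows "has_fourier_transform (\<lambda>x. f (- x)) (\<lambda>\<xi>. F (- \<xi>))"
proof -
  from assms have f: "square_integrable f" and F: "square_integrable F"
    by (auto simp: has_fourier_transform_iff)
  have "ft (trunc r (\<lambda>x. f (- x))) \<xi> = ft (trunc r f) (- \<xi>)" for r \<xi>
    unfolding ft_def trunc_def
    by (subst lborel_integral_real_affine[of "-1" _ 0]) (auto simp: indicator_def intro!: Bochner_Integration.integral_cong)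
  then have "l2norm (\<lambda>\<xi>. ft (trunc r (\<lambda>x. f (- x))) \<xi> - F (- \<xi>))
     = l2norm (\<lambda>\<xi>. ft (trunc r f) \<xi> - F \<xi>)" for r
    using l2norm_reflect[of "\<lambda>\<xi>. ft (trunc r f) \<xi> - F \<xi>"] by simp
  then show ?thesis
    using assms f F by (auto simp: has_fourier_transform_iff)
qed

lemma has_fourier_transform_modulate:
  assumes "has_fourier_transform f F"
  shows "has_fourier_transform (\<lambda>x. f x * cis (- (x * a))) (\<lambda>\<xi>. F (\<xi> + a))"
proof -
  from assms have f: "square_integrable f" and F: "square_integrable F"
    by (auto simp: has_fourier_transform_iff)
  note [measurable] = sqint_measurable[OF f]
  have fm: "square_integrable (\<lambda>x. f x * cis (- (x * a)))"
    by (rule square_integrableI_bound[OF _ f, of _ 1]) (auto simp: norm_mult)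
  have "ft (trunc r (\<lambda>x. f x * cis (- (x * a)))) \<xi> = ft (trunc r f) (\<xi> + a)" for r \<xi>
    unfolding ft_def trunc_def by (simp add: mult.assoc cis_mult algebra_simps)
  then have "l2norm (\<lambda>\<xi>. ft (trunc r (\<lambda>x. f x * cis (- (x * a)))) \<xi> - F (\<xi> + a))
     = l2norm (\<lambda>\<xi>. ft (trunc r f) \<xi> - F \<xi>)" for r
    using l2norm_shift[of "\<lambda>\<xi>. ft (trunc r f) \<xi> - F \<xi>" a] by simp
  then show ?thesis
    using assms fm F by (auto simp: has_fourier_transform_iff)
qed

lemma tendsto_integral_mult:
  fixes a b :: "'i \<Rightarrow> real \<Rightarrow> complex"
  assumes a: "\<And>r. square_integrable (a r)" and b: "\<And>r. square_integrable (b r)"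
    and A: "square_integrable A" and B: "square_integrable B"
    and la: "((\<lambda>r. l2norm (\<lambda>x. a r x - A x)) \<longlongrightarrow> 0) F"
    and lb: "((\<lambda>r. l2norm (\<lambda>x. b r x - B x)) \<longlongrightarrow> 0) F"
  shows "((\<lambda>r. LINT x|lborel. a r x * b r x) \<longlongrightarrow> (LINT x|lborel. A x * B x)) F"
proof -
  define \<alpha> where "\<alpha> r = l2norm (\<lambda>x. a r x - A x)" for r
  define \<beta> where "\<beta> r = l2norm (\<lambda>x. b r x - B x)" for r
  have *: "\<forall>\<^sub>F r in F. norm ((LINT x|lborel. a r x * b r x) - (LINT x|lborel. A x * B x))
      \<le> \<alpha> r * (\<beta> r + l2norm B) + l2norm A * \<beta> r"
  proof (intro always_eventually allI)
    fix r
    have "b r = (\<lambda>x. (b r x - B x) + B x)" by simp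
    then have "l2norm (b r) \<le> \<beta> r + l2norm B"
      using l2norm_triangle[OF square_integrable_diff[OF b B] B, of r] by (simp add: \<beta>_def)
    then have 1: "\<alpha> r * l2norm (b r) \<le> \<alpha> r * (\<beta> r + l2norm B)"
      by (intro mult_left_mono) (auto simp: \<alpha>_def)
    have "(LINT x|lborel. a r x * b r x) - (LINT x|lborel. A x * B x)
        = (LINT x|lborel. (a r x - A x) * b r x) + (LINT x|lborel. A x * (b r x - B x))"
      using integrable_mult_sqint[OF a b, of r r] integrable_mult_sqint[OF A B]
        integrable_mult_sqint[OF A b, of r]
      by (simp add: left_diff_distrib right_diff_distrib)
    also have "cmod \<dots> \<le> cmod (LINT x|lborel. (a r x - A x) * b r x) + cmod (LINT x|lborel. A x * (b r x - B x))"
      by (rule norm_triangle_ineq)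
    also have "\<dots> \<le> \<alpha> r * l2norm (b r) + l2norm A * \<beta> r"
      unfolding \<alpha>_def \<beta>_def by (intro add_mono norm_integral_mult_le square_integrable_diff a A B b)
    also have "\<dots> \<le> \<alpha> r * (\<beta> r + l2norm B) + l2norm A * \<beta> r"
      using 1 by simp
    finally show "norm ((LINT x|lborel. a r x * b r x) - (LINT x|lborel. A x * B x))
      \<le> \<alpha> r * (\<beta> r + l2norm B) + l2norm A * \<beta> r" .
  qed
  have "((\<lambda>r. \<alpha> r * (\<beta> r + l2norm B) + l2norm A * \<beta> r) \<longlongrightarrow> 0 * (0 + l2norm B) + l2norm A * 0) F"
    unfolding \<alpha>_def \<beta>_def by (intro tendsto_intros la lb)
  then have "((\<lambda>r. \<alpha> r * (\<beta> r + l2norm B) + l2norm A * \<beta> r) \<longlongrightarrow> 0) F" by simp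
  from Lim_null_comparison[OF * this] show ?thesis
    using Lim_null by blast
qed

text \<open>The exponential kernel is symmetric, so for truncations this is Fubini's theorem.\<close>

lemma fourier_multiplication_formula:
  assumes "has_fourier_transform f F" "has_fourier_transform k K"
  shows "(LINT x|lborel. F x * k x) = (LINT x|lborel. f x * K x)"
proof -
  from assms have f: "square_integrable f" and k: "square_integrable k"
    and F: "square_integrable F" and K: "square_integrable K"
    and l: "((\<lambda>r. l2norm (\<lambda>\<xi>. ft (trunc r f) \<xi> - F \<xi>)) \<longlongrightarrow> 0) at_top"
      "((\<lambda>r. l2norm (\<lambda>\<xi>. ft (trunc r k) \<xi> - K \<xi>)) \<longlongrightarrow> 0) at_top"
    by (auto simp: has_fourier_transform_iff)
  have "(LINT x|lborel. ft (trunc r f) x * trunc r k x) = (LINT x|lborel. trunc r f x * ft (trunc r k) x)" for r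
    unfolding ft_def using Fubini_bounded_kernel[OF integrable_trunc[OF k, of r] integrable_trunc[OF f, of r],
        of "\<lambda>x y. cis (- (x * y))" 1]
    by (simp add: mult.commute)
  moreover have "((\<lambda>r. LINT x|lborel. ft (trunc r f) x * trunc r k x) \<longlongrightarrow> (LINT x|lborel. F x * k x)) at_top"
    by (intro tendsto_integral_mult l trunc_tendsto f k F ft_trunc_sqint square_integrable_trunc)
  moreover have "((\<lambda>r. LINT x|lborel. trunc r f x * ft (trunc r k) x) \<longlongrightarrow> (LINT x|lborel. f x * K x)) at_top"
    by (intro tendsto_integral_mult l trunc_tendsto f k K ft_trunc_sqint square_integrable_trunc)
  ultimately show ?thesis
    using tendsto_unique[OF trivial_limit_at_top_linorder] by auto
qed

section \<open>Inversion\<close>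

text \<open>The positive and negative parts of \<open>q\<close> have equal mass.  Normalised, they are densities of two
  distributions with the same characteristic function, which Levy's uniqueness theorem identifies.\<close>

lemma ft_zero_imp_AE_zero_real:
  fixes q :: "real \<Rightarrow> real"
  assumes q: "integrable lborel q" and 0: "\<And>\<xi>. ft (\<lambda>x. complex_of_real (q x)) \<xi> = 0"
  shows "AE x in lborel. q x = 0"
proof -
  note [measurable] = borel_measurable_integrable[OF q]
  define p where "p x = max (q x) 0" for x
  define n where "n x = max (- q x) 0" for x
  have [measurable]: "p \<in> borel_measurable borel" "n \<in> borel_measurable borel"
    unfolding p_def[abs_def] n_def[abs_def] by measurable
  have pn: "q x = p x - n x" "0 \<le> p x" "0 \<le> n x" for x
    by (auto simp: p_def n_def)
  have ip: "integrable lborel p" and i_n: "integrable lborel n"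
    using q by (auto simp: p_def[abs_def] n_def[abs_def])
  define c where "c = (LINT x|lborel. p x)"
  have ft_eq: "ft (\<lambda>x. complex_of_real (p x)) \<xi> = ft (\<lambda>x. complex_of_real (n x)) \<xi>" for \<xi>
    using 0[of \<xi>] ft_diff[of "\<lambda>x. complex_of_real (p x)" "\<lambda>x. complex_of_real (n x)" \<xi>] ip i_n
    by (simp add: pn(1))
  from ft_eq[of 0] have cn: "c = (LINT x|lborel. n x)"
    by (simp add: ft_def c_def)
  have "0 \<le> c" by (simp add: c_def pn)
  show ?thesis
  proof (cases "c = 0")
    case True
    have "AE x in lborel. p x = 0"
      using integral_nonneg_eq_0_iff_AE[OF ip] True pn by (simp add: c_def)
    moreover have "AE x in lborel. n x = 0"
      using integral_nonneg_eq_0_iff_AE[OF i_n] True pn cn by simp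
    ultimately show ?thesis by eventually_elim (simp add: pn)
  next
    case False
    with \<open>0 \<le> c\<close> have c: "c > 0" by simp
    define D where "D f = density lborel (\<lambda>x. ennreal (f x / c))" for f :: "real \<Rightarrow> real"
    have dist: "real_distribution (D f)"
      if [measurable]: "f \<in> borel_measurable borel" and i: "integrable lborel f" "\<And>x. 0 \<le> f x" "(LINT x|lborel. f x) = c" for f
    proof (intro real_distribution.intro real_distribution_axioms.intro prob_spaceI)
      show "emeasure (D f) (space (D f)) = 1"
        using i c by (simp add: D_def emeasure_density nn_integral_eq_integral)
    qed (simp_all add: D_def)
    have chr: "char (D f) t = ft (\<lambda>x. complex_of_real (f x)) (- t) / complex_of_real c"
      if [measurable]: "f \<in> borel_measurable borel" and "\<And>x. 0 \<le> f x" for f t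
    proof -
      have "char (D f) t = (LINT x|lborel. (f x / c) *\<^sub>R iexp (t * x))"
        unfolding char_def D_def using that c by (subst integral_density) auto
      also have "\<dots> = (LINT x|lborel. complex_of_real (f x) * cis (- (x * - t)) / complex_of_real c)"
        by (intro Bochner_Integration.integral_cong) (auto simp: cis_conv_exp scaleR_conv_of_real mult_ac)
      finally show ?thesis by (simp add: ft_def)
    qed
    have "D p = D n"
      using chr pn ft_eq by (intro Levy_uniqueness dist ip i_n) (auto simp: c_def[symmetric] cn[symmetric] fun_eq_iff)
    then have "AE x in lborel. ennreal (p x / c) = ennreal (n x / c)"
      unfolding D_def by (intro sigma_finite_measure.density_unique[OF sigma_finite_lborel]) auto
    then show ?thesis
      by eventually_elim (use c pn in \<open>auto simp: divide_right_mono\<close>)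
  qed
qed

text \<open>Conjugation reflects the transform, hence the real and the imaginary part have vanishing transforms too.\<close>

lemma ft_zero_imp_AE_zero:
  fixes p :: "real \<Rightarrow> complex"
  assumes p: "integrable lborel p" and 0: "\<And>\<xi>. ft p \<xi> = 0"
  shows "AE x in lborel. p x = 0"
proof -
  have cn: "ft (\<lambda>x. cnj (p x)) \<xi> = 0" for \<xi>
  proof -
    have "ft (\<lambda>x. cnj (p x)) \<xi> = cnj (ft p (- \<xi>))"
      unfolding ft_def by (subst Bochner_Integration.integral_cnj[symmetric]) (simp add: cis_cnj)
    then show ?thesis by (simp add: 0)
  qed
  have ip: "integrable lborel (\<lambda>x. cnj (p x))" using p by simp
  have lin: "ft (\<lambda>x. c * (p x + d * cnj (p x))) \<xi> = 0" for c d \<xi>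
  proof -
    have "ft (\<lambda>x. c * (p x + d * cnj (p x))) \<xi> = c * (ft p \<xi> + d * ft (\<lambda>x. cnj (p x)) \<xi>)"
      unfolding ft_def using integrable_mult_bounded[OF p, of "\<lambda>x. cis (- (x * \<xi>))" 1]
        integrable_mult_bounded[OF ip, of "\<lambda>x. cis (- (x * \<xi>))" 1]
      by (simp add: distrib_left distrib_right mult.assoc)
    then show ?thesis by (simp add: 0 cn)
  qed
  have "AE x in lborel. Re (p x) = 0"
  proof (rule ft_zero_imp_AE_zero_real)
    have "(\<lambda>x. complex_of_real (Re (p x))) = (\<lambda>x. (1/2) * (p x + 1 * cnj (p x)))"
      by (auto simp: complex_eq_iff)
    then show "ft (\<lambda>x. complex_of_real (Re (p x))) \<xi> = 0" for \<xi> by (simp only: lin)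
  qed (use p in auto)
  moreover have "AE x in lborel. Im (p x) = 0"
  proof (rule ft_zero_imp_AE_zero_real)
    have "(\<lambda>x. complex_of_real (Im (p x))) = (\<lambda>x. (-\<i>/2) * (p x + (-1) * cnj (p x)))"
      by (auto simp: complex_eq_iff)
    then show "ft (\<lambda>x. complex_of_real (Im (p x))) \<xi> = 0" for \<xi> by (simp only: lin)
  qed (use p in auto)
  ultimately show ?thesis
    by eventually_elim (simp add: complex_eq_iff)
qed

definition gauss :: "real \<Rightarrow> complex"
  where "gauss x = complex_of_real (exp (- x\<^sup>2 / 2))"

lemma borel_measurable_gauss [measurable]: "gauss \<in> borel_measurable borel"
  unfolding gauss_def[abs_def] by measurable

lemma integrable_gauss: "integrable lborel gauss"
  unfolding gauss_def[abs_def] using integrable_std_gaussian by (simp only: integrable_of_real)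

lemma square_integrable_gauss: "square_integrable gauss"
  unfolding square_integrable_def
proof
  show "integrable lborel (\<lambda>x. (cmod (gauss x))\<^sup>2)"
  proof (rule Bochner_Integration.integrable_bound[OF integrable_gauss])
    show "AE x in lborel. norm ((cmod (gauss x))\<^sup>2) \<le> norm (gauss x)"
    proof (rule AE_I2)
      fix x
      have "cmod (gauss x) \<le> 1" by (simp add: gauss_def)
      then have "(cmod (gauss x))\<^sup>2 \<le> cmod (gauss x)"
        by (simp add: power2_eq_square mult_left_le_one_le)
      then show "norm ((cmod (gauss x))\<^sup>2) \<le> norm (gauss x)" by simp
    qed
  qed measurable
qed simp

lemma ft_gauss: "ft gauss = (\<lambda>\<xi>. complex_of_real (sqrt (2 * pi)) * gauss \<xi>)"
  unfolding gauss_def[abs_def] by (rule ext) (simp only: ft_std_gaussian of_real_mult)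

lemma has_fourier_transform_gauss_modulated:
  "has_fourier_transform (\<lambda>x. gauss x * cis (x * b)) (\<lambda>\<xi>. complex_of_real (sqrt (2 * pi)) * gauss (\<xi> - b))"
  using has_fourier_transform_modulate[OF has_fourier_transform_L1[OF integrable_gauss square_integrable_gauss], of "-b"]
  by (simp add: ft_gauss)

lemma has_fourier_transform_gauss_shifted:
  "has_fourier_transform (\<lambda>x. gauss (x - b)) (\<lambda>\<xi>. complex_of_real (sqrt (2 * pi)) * gauss \<xi> * cis (- (\<xi> * b)))"
proof -
  have "ft (\<lambda>x. gauss (x - b)) \<xi> = complex_of_real (sqrt (2 * pi)) * gauss \<xi> * cis (- (\<xi> * b))" for \<xi>
  proof -
    have "ft (\<lambda>x. gauss (x - b)) \<xi> = (LINT x|lborel. (gauss x * cis (- (x * \<xi>))) * cis (- (\<xi> * b)))"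
      unfolding ft_def by (subst lborel_integral_real_affine[of 1 _ b]) (auto simp: mult.assoc cis_mult algebra_simps)
    also have "\<dots> = ft gauss \<xi> * cis (- (\<xi> * b))"
      unfolding ft_def by simp
    finally show ?thesis by (simp add: ft_gauss)
  qed
  moreover have "integrable lborel (\<lambda>x. gauss (x - b))"
    using lborel_integrable_real_affine[OF integrable_gauss, of 1 "-b"] by simp
  moreover have "square_integrable (\<lambda>x. gauss (x - b))"
    using square_integrable_shift[OF square_integrable_gauss, of "-b"] by simp
  ultimately show ?thesis
    using has_fourier_transform_L1[of "\<lambda>x. gauss (x - b)"] by presburger
qed

text \<open>Modulated Gaussians satisfy the inversion formula by inspection, and the multiplication formula
  transports it to every square-integrable function, tested against them.  The tests
  \<open>\<integral> k(x) exp(- x\<^sup>2/2) exp(i b x)\<close>, as functions of \<open>b\<close>, are the Fourier integral of \<open>k\<close> times a Gaussian,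
  so their vanishing forces \<open>k = 0\<close>.\<close>

theorem fourier_inversion:
  assumes "has_fourier_transform f F" "has_fourier_transform F G"
  shows "AE x in lborel. G x = complex_of_real (2 * pi) * f (- x)"
proof -
  define c where "c = complex_of_real (sqrt (2 * pi))"
  have cc: "c * c = complex_of_real (2 * pi)"
    by (simp add: c_def flip: of_real_mult)
  from assms have f: "square_integrable f" and F: "square_integrable F" and G: "square_integrable G"
    by (auto simp: has_fourier_transform_iff)
  define k where "k x = G x - complex_of_real (2 * pi) * f (- x)" for x
  have k: "square_integrable k"
    unfolding k_def by (intro square_integrable_diff square_integrable_cmult square_integrable_reflect f G)
  have ft0: "ft (\<lambda>x. k x * gauss x) \<xi> = 0" for \<xi>
  proof -
    define b where "b = - \<xi>"
    define \<gamma> where "\<gamma> x = gauss x * cis (x * b)" for x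
    have \<gamma>: "has_fourier_transform \<gamma> (\<lambda>\<xi>. c * gauss (\<xi> - b))"
      unfolding \<gamma>_def c_def by (rule has_fourier_transform_gauss_modulated)
    have \<gamma>2: "has_fourier_transform (\<lambda>\<xi>. c * gauss (\<xi> - b)) (\<lambda>x. c * (c * gauss x * cis (- (x * b))))"
      using has_fourier_transform_cmult[OF has_fourier_transform_gauss_shifted, of c b] by (simp add: c_def)
    have \<gamma>i: "square_integrable \<gamma>" using \<gamma> by (simp add: has_fourier_transform_iff)
    have "(LINT x|lborel. G x * \<gamma> x) = (LINT x|lborel. F x * (c * gauss (x - b)))"
      by (rule fourier_multiplication_formula[OF assms(2) \<gamma>])
    also have "\<dots> = (LINT x|lborel. f x * (c * (c * gauss x * cis (- (x * b)))))"
      by (rule fourier_multiplication_formula[OF assms(1) \<gamma>2])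
    also have "\<dots> = (LINT x|lborel. (complex_of_real (2 * pi) * f (- x)) * \<gamma> x)"
      unfolding \<gamma>_def cc[symmetric]
      by (subst lborel_integral_real_affine[of "-1" _ 0]) (auto simp: gauss_def mult_ac)
    finally have "(LINT x|lborel. k x * \<gamma> x) = 0"
      unfolding k_def left_diff_distrib
      by (subst Bochner_Integration.integral_diff)
         (auto intro!: integrable_mult_sqint square_integrable_cmult square_integrable_reflect f G \<gamma>i)
    then show ?thesis by (simp add: ft_def \<gamma>_def b_def mult.assoc)
  qed
  have "AE x in lborel. k x * gauss x = 0"
    by (rule ft_zero_imp_AE_zero[OF integrable_mult_sqint[OF k square_integrable_gauss] ft0])
  then show ?thesis
    by eventually_elim (simp add: k_def gauss_def)
qed

text \<open>By inversion, the transform of \<open>F (- x)\<close> is \<open>2\<pi> f\<close>; the multiplication formula does the rest.  This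
  bilinear form of Parseval's identity is the one that gives the convolution formula for products.\<close>

theorem fourier_parseval:
  assumes f: "has_fourier_transform f F" and k: "has_fourier_transform k K"
  shows "(LINT x|lborel. F (- x) * K x) = complex_of_real (2 * pi) * (LINT x|lborel. f x * k x)"
proof -
  from assms have sq: "square_integrable f" "square_integrable F" "square_integrable k" "square_integrable K"
    by (auto simp: has_fourier_transform_iff)
  obtain G where G: "has_fourier_transform F G"
    using has_fourier_transform_exists[OF sq(2)] by blast
  then have G': "has_fourier_transform (\<lambda>x. F (- x)) (\<lambda>x. G (- x))"
    by (rule has_fourier_transform_reflect)
  have GF: "square_integrable G" using G by (simp add: has_fourier_transform_iff)
  note [measurable] = sqint_measurable[OF GF] sqint_measurable[OF sq(1)] sqint_measurable[OF sq(3)]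
  have "AE x in lborel. G (- x) = complex_of_real (2 * pi) * f x"
    using fourier_inversion[OF has_fourier_transform_reflect[OF f] G'] by simp
  then have "(LINT x|lborel. G (- x) * k x) = (LINT x|lborel. complex_of_real (2 * pi) * (f x * k x))"
    by (intro integral_cong_AE) auto
  then show ?thesis
    using fourier_multiplication_formula[OF G' k] by simp
qed

text \<open>By inversion, \<open>G\<close> is the transform of its own reflected transform, up to the factor \<open>2\<pi>\<close>.\<close>

theorem has_fourier_transform_onto:
  assumes G: "square_integrable G"
  shows "\<exists>g. has_fourier_transform g G"
proof -
  obtain H where H: "has_fourier_transform G H"
    using has_fourier_transform_exists[OF G] by blast
  then have "square_integrable H" by (simp add: has_fourier_transform_iff)
  then obtain K where K: "has_fourier_transform H K"
    using has_fourier_transform_exists by blast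
  define c where "c = complex_of_real (1 / (2 * pi))"
  have "has_fourier_transform (\<lambda>x. c * H (- x)) (\<lambda>x. c * K (- x))"
    by (intro has_fourier_transform_cmult has_fourier_transform_reflect K)
  moreover have "AE x in lborel. G x = c * K (- x)"
    using fourier_inversion[OF has_fourier_transform_reflect[OF H] has_fourier_transform_reflect[OF K]]
    by eventually_elim (simp add: c_def)
  ultimately show ?thesis
    using has_fourier_transform_AE_right G by blast
qed

lemma AE_lborel_reflect:
  assumes "AE x in lborel. P (x :: real)"
  shows "AE x in lborel. P (- x)"
proof -
  have "AE x in distr lborel borel uminus. P (x :: real)"
    using assms by (simp only: lborel_distr_uminus)
  then show ?thesis by (rule AE_distrD[rotated]) simp
qed

text \<open>The real part of a preimage has the Hermitian part of \<open>G\<close> as its transform.\<close>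

lemma has_fourier_transform_onto_real:
  assumes G: "square_integrable G" and herm: "AE \<xi> in lborel. G (- \<xi>) = cnj (G \<xi>)"
  shows "\<exists>g. has_fourier_transform (\<lambda>x. complex_of_real (g x)) G"
proof -
  obtain g where g: "has_fourier_transform g G"
    using has_fourier_transform_onto[OF G] by blast
  have gi: "square_integrable g" using g by (simp add: has_fourier_transform_iff)
  note [measurable] = sqint_measurable[OF gi]
  have "has_fourier_transform (\<lambda>x. (1/2) * (g x + cnj (g x))) (\<lambda>\<xi>. (1/2) * (G \<xi> + cnj (G (- \<xi>))))"
    by (intro has_fourier_transform_cmult has_fourier_transform_add has_fourier_transform_cnj g)
  then have "has_fourier_transform (\<lambda>x. (1/2) * (g x + cnj (g x))) G"
    by (rule has_fourier_transform_AE_right[OF _ G]) (use herm in \<open>eventually_elim, simp\<close>)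
  moreover have "(\<lambda>x. (1/2) * (g x + cnj (g x))) = (\<lambda>x. complex_of_real (Re (g x)))"
    by (auto simp: complex_eq_iff)
  ultimately show ?thesis by auto
qed

section \<open>Transforms of real functions\<close>

lemma has_fourier_transform_fourier:
  "square_integrable f \<Longrightarrow> has_fourier_transform (\<lambda>x. complex_of_real (f x)) (fourier f)"
proof -
  assume "square_integrable f"
  then obtain g where "has_fourier_transform (\<lambda>x. complex_of_real (f x)) g"
    using has_fourier_transform_exists[of "\<lambda>x. complex_of_real (f x)"] by auto
  then show ?thesis
    unfolding fourier_def by (rule someI[of "has_fourier_transform (\<lambda>x. complex_of_real (f x))"])
qed

lemma square_integrable_fourier:
  "square_integrable f \<Longrightarrow> square_integrable (fourier f)"
  using has_fourier_transform_fourier by (auto simp: has_fourier_transform_iff)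

lemma measurable_fourier:
  "square_integrable f \<Longrightarrow> fourier f \<in> borel_measurable borel"
  by (rule sqint_measurable[OF square_integrable_fourier])

lemma fourier_AE_eqI:
  assumes "has_fourier_transform (\<lambda>x. complex_of_real (f x)) G"
  shows "AE \<xi> in lborel. fourier f \<xi> = G \<xi>"
proof -
  have "square_integrable f" using assms by (simp add: has_fourier_transform_iff)
  from has_fourier_transform_unique[OF has_fourier_transform_fourier[OF this] assms] show ?thesis .
qed

lemma real_square_integrable_add:
  fixes f g :: "real \<Rightarrow> real"
  assumes "square_integrable f" "square_integrable g"
  shows "square_integrable (\<lambda>x. f x + g x)"
  using square_integrable_add[of "\<lambda>x. complex_of_real (f x)" "\<lambda>x. complex_of_real (g x)"] assms
  by (simp flip: of_real_add)

lemma real_square_integrable_cmult: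
  fixes f :: "real \<Rightarrow> real"
  assumes "square_integrable f"
  shows "square_integrable (\<lambda>x. c * f x)"
  using square_integrable_cmult[of "\<lambda>x. complex_of_real (f x)" "complex_of_real c"] assms
  by (simp flip: of_real_mult)

lemma fourier_add:
  assumes "square_integrable f" "square_integrable g"
  shows "AE \<xi> in lborel. fourier (\<lambda>x. f x + g x) \<xi> = fourier f \<xi> + fourier g \<xi>"
  using has_fourier_transform_add[OF assms[THEN has_fourier_transform_fourier]]
  by (intro fourier_AE_eqI) simp

lemma fourier_cmult:
  assumes "square_integrable f"
  shows "AE \<xi> in lborel. fourier (\<lambda>x. c * f x) \<xi> = complex_of_real c * fourier f \<xi>"
  using has_fourier_transform_cmult[OF assms[THEN has_fourier_transform_fourier]]
  by (intro fourier_AE_eqI) simp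

lemma fourier_diff:
  assumes "square_integrable f" "square_integrable g"
  shows "AE \<xi> in lborel. fourier (\<lambda>x. f x - g x) \<xi> = fourier f \<xi> - fourier g \<xi>"
  using has_fourier_transform_add[OF has_fourier_transform_fourier[OF assms(1)]
      has_fourier_transform_cmult[OF has_fourier_transform_fourier[OF assms(2)], of "-1"]]
  by (intro fourier_AE_eqI) simp

lemma fourier_cong_AE:
  assumes "square_integrable f" "g \<in> borel_measurable borel" "AE x in lborel. g x = f x"
  shows "square_integrable g \<and> (AE \<xi> in lborel. fourier g \<xi> = fourier f \<xi>)"
proof -
  have "has_fourier_transform (\<lambda>x. complex_of_real (g x)) (fourier f)"
    by (rule has_fourier_transform_AE_left[OF has_fourier_transform_fourier[OF assms(1)]])
       (use assms in auto)
  then show ?thesis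
    using fourier_AE_eqI by (auto simp: has_fourier_transform_iff)
qed

lemma fourier_hermitian:
  assumes "square_integrable f"
  shows "AE \<xi> in lborel. fourier f (- \<xi>) = cnj (fourier f \<xi>)"
proof -
  have "AE \<xi> in lborel. fourier f \<xi> = cnj (fourier f (- \<xi>))"
    using has_fourier_transform_cnj[OF has_fourier_transform_fourier[OF assms]]
    by (intro fourier_AE_eqI) simp
  then show ?thesis by eventually_elim (metis complex_cnj_cnj)
qed

text \<open>Surjectivity of the transform onto Hermitian functions provides a witness for the choice in the
  definition of the multiplier.\<close>

lemma fourier_multiplier:
  assumes f: "square_integrable f" and m: "\<And>\<xi>. m (- \<xi>) = cnj (m \<xi>)"
    and mf: "square_integrable (\<lambda>\<xi>. m \<xi> * fourier f \<xi>)"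
  shows "square_integrable (fourier_multiplier m f) \<and>
     (AE \<xi> in lborel. fourier (fourier_multiplier m f) \<xi> = m \<xi> * fourier f \<xi>)"
proof -
  have "AE \<xi> in lborel. m (- \<xi>) * fourier f (- \<xi>) = cnj (m \<xi> * fourier f \<xi>)"
    using fourier_hermitian[OF f] by eventually_elim (simp add: m)
  then obtain g where g: "has_fourier_transform (\<lambda>x. complex_of_real (g x)) (\<lambda>\<xi>. m \<xi> * fourier f \<xi>)"
    using has_fourier_transform_onto_real[OF mf] by auto
  then have "square_integrable g" by (simp add: has_fourier_transform_iff)
  then have "\<exists>g. square_integrable g \<and> (AE \<xi> in lborel. fourier g \<xi> = m \<xi> * fourier f \<xi>)"
    using fourier_AE_eqI[OF g] by blast
  from someI_ex[OF this] show ?thesis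
    unfolding fourier_multiplier_def .
qed

lemma integrable_mult_real:
  fixes f g :: "real \<Rightarrow> real"
  assumes "square_integrable f" "square_integrable g"
  shows "integrable lborel (\<lambda>x. f x * g x)"
  using integrable_Re[OF integrable_mult_sqint[of "\<lambda>x. complex_of_real (f x)" "\<lambda>x. complex_of_real (g x)"]] assms
  by simp

text \<open>At each frequency, Parseval's identity for \<open>f\<close> and the modulated \<open>g\<close>.\<close>

theorem fourier_product:
  assumes f: "square_integrable f" and g: "square_integrable g" and fg: "square_integrable (\<lambda>x. f x * g x)"
  shows "AE \<xi> in lborel. complex_of_real (2 * pi) * fourier (\<lambda>x. f x * g x) \<xi>
     = (LINT \<eta>|lborel. fourier f \<eta> * fourier g (\<xi> - \<eta>))"
proof -
  have "integrable lborel (\<lambda>x. complex_of_real (f x * g x))"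
    using integrable_mult_real[OF f g] by (simp only: integrable_of_real)
  then have "has_fourier_transform (\<lambda>x. complex_of_real (f x * g x)) (ft (\<lambda>x. complex_of_real (f x * g x)))"
    by (rule has_fourier_transform_L1) (simp only: square_integrable_of_real fg)
  then have "AE \<xi> in lborel. fourier (\<lambda>x. f x * g x) \<xi> = ft (\<lambda>x. complex_of_real (f x * g x)) \<xi>"
    by (rule fourier_AE_eqI)
  then show ?thesis
  proof eventually_elim
    case (elim \<xi>)
    have "(LINT \<eta>|lborel. fourier f \<eta> * fourier g (\<xi> - \<eta>)) = (LINT \<eta>|lborel. fourier f (- \<eta>) * fourier g (\<eta> + \<xi>))"
      by (subst lborel_integral_real_affine[of "-1" _ 0]) (auto simp: add.commute)
    also have "\<dots> = complex_of_real (2 * pi) * (LINT x|lborel. complex_of_real (f x) * (complex_of_real (g x) * cis (- (x * \<xi>))))"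
      by (rule fourier_parseval[OF has_fourier_transform_fourier[OF f]
          has_fourier_transform_modulate[OF has_fourier_transform_fourier[OF g]]])
    finally show ?case
      unfolding elim by (simp add: ft_def mult.assoc)
  qed
qed

text \<open>By inversion, \<open>f\<close> is itself the Fourier integral of an integrable function.\<close>

lemma AE_bounded_of_integrable_fourier:
  assumes f: "square_integrable f" and i: "integrable lborel (fourier f)"
  shows "AE x in lborel. \<bar>f x\<bar> \<le> (LINT \<xi>|lborel. cmod (fourier f \<xi>))"
proof -
  define B where "B = (LINT \<xi>|lborel. cmod (fourier f \<xi>))"
  have "has_fourier_transform (fourier f) (ft (fourier f))"
    by (rule has_fourier_transform_L1[OF i square_integrable_fourier[OF f]])
  from AE_lborel_reflect[OF fourier_inversion[OF has_fourier_transform_fourier[OF f] this]]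
  have "AE x in lborel. complex_of_real (2 * pi) * complex_of_real (f x) = ft (fourier f) (- x)"
    by eventually_elim simp
  then show ?thesis unfolding B_def[symmetric]
  proof eventually_elim
    case (elim x)
    have "cmod (complex_of_real (2 * pi) * complex_of_real (f x)) \<le> B"
      unfolding elim B_def by (rule cmod_ft_le)
    then have "2 * pi * \<bar>f x\<bar> \<le> B" by (simp add: norm_mult)
    moreover have "1 * \<bar>f x\<bar> \<le> 2 * pi * \<bar>f x\<bar>"
      using pi_ge_two by (intro mult_right_mono) auto
    ultimately show ?case by simp
  qed
qed

lemma square_integrable_mult_of_integrable_fourier:
  assumes f: "square_integrable f" and i: "integrable lborel (fourier f)" and g: "square_integrable g"
  shows "square_integrable (\<lambda>x. f x * g x)"
proof -
  note [measurable] = sqint_measurable[OF f] sqint_measurable[OF g]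
  have "square_integrable (\<lambda>x. complex_of_real (f x * g x))"
  proof (rule square_integrableI_bound)
    show "square_integrable (\<lambda>x. complex_of_real (g x))" using g by simp
    show "AE x in lborel. cmod (complex_of_real (f x * g x)) \<le> (LINT \<xi>|lborel. cmod (fourier f \<xi>)) * cmod (complex_of_real (g x))"
      using AE_bounded_of_integrable_fourier[OF f i]
      by eventually_elim (auto simp: norm_mult abs_mult intro!: mult_right_mono)
  qed measurable
  then show ?thesis by (simp only: square_integrable_of_real)
qed

section \<open>Sobolev spaces\<close>

text \<open>The Japanese bracket, with the exponent halved so that its square is the weight of the Sobolev norm.\<close>

definition bracket :: "real \<Rightarrow> real \<Rightarrow> real"
  where "bracket s \<xi> = (1 + \<xi>\<^sup>2) powr (s / 2)"

lemma one_plus_square_pos [simp]: "0 < 1 + (x :: real)\<^sup>2" "1 + x\<^sup>2 \<noteq> 0"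
proof -
  show "0 < 1 + x\<^sup>2" by (rule add_pos_nonneg) auto
  then show "1 + x\<^sup>2 \<noteq> 0" by linarith
qed

lemma bracket_zero [simp]: "bracket 0 \<xi> = 1"
  by (simp add: bracket_def)

lemma bracket_pos [simp]: "0 < bracket s \<xi>" "0 \<le> bracket s \<xi>" "bracket s \<xi> \<noteq> 0"
proof -
  show "0 < bracket s \<xi>" by (simp add: bracket_def)
  then show "0 \<le> bracket s \<xi>" "bracket s \<xi> \<noteq> 0" by auto
qed

lemma measurable_bracket [measurable]: "bracket s \<in> borel_measurable borel"
  unfolding bracket_def[abs_def] by measurable

lemma bracket_sq: "(bracket s \<xi>)\<^sup>2 = (1 + \<xi>\<^sup>2) powr s"
  by (simp add: bracket_def power2_eq_square flip: powr_add)

lemma bracket_add: "bracket (s + t) \<xi> = bracket s \<xi> * bracket t \<xi>"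
  by (simp add: bracket_def add_divide_distrib powr_add)

lemma bracket_mono: "s \<le> t \<Longrightarrow> bracket s \<xi> \<le> bracket t \<xi>"
  unfolding bracket_def by (intro powr_mono) auto

lemma bracket_ge_1: "0 \<le> s \<Longrightarrow> 1 \<le> bracket s \<xi>"
  unfolding bracket_def by (intro ge_one_powr_ge_zero) auto

lemma bracket_one: "\<bar>\<xi>\<bar> \<le> bracket 1 \<xi>"
proof -
  have "\<bar>\<xi>\<bar> \<le> sqrt (1 + \<xi>\<^sup>2)" by (rule real_le_rsqrt) simp
  then show ?thesis
    by (simp add: bracket_def powr_half_sqrt less_imp_le)
qed

text \<open>The larger of \<open>\<bar>\<eta>\<bar>\<close> and \<open>\<bar>\<xi> - \<eta>\<bar>\<close> is at least \<open>\<bar>\<xi>\<bar> / 2\<close>.\<close>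

lemma bracket_peetre:
  assumes s: "0 \<le> s"
  shows "bracket s \<xi> \<le> 2 powr s * (bracket s \<eta> + bracket s (\<xi> - \<eta>))"
proof -
  define M where "M = max \<bar>\<eta>\<bar> \<bar>\<xi> - \<eta>\<bar>"
  have "\<bar>\<eta>\<bar> \<le> M" "\<bar>\<xi> - \<eta>\<bar> \<le> M" by (auto simp: M_def)
  then have "\<bar>\<xi>\<bar> \<le> 2 * M" by linarith
  then have "\<xi>\<^sup>2 \<le> (2 * M)\<^sup>2" by (rule power2_le_iff_abs_le[THEN iffD2, rotated]) (simp add: M_def)
  then have "1 + \<xi>\<^sup>2 \<le> 4 * (1 + M\<^sup>2)" by (simp add: power_mult_distrib)
  then have "bracket s \<xi> \<le> (4 * (1 + M\<^sup>2)) powr (s / 2)"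
    unfolding bracket_def using s by (intro powr_mono2) auto
  also have "\<dots> = 4 powr (s / 2) * bracket s M"
    unfolding bracket_def by (subst powr_mult) auto
  also have "(4::real) powr (s / 2) = 2 powr s"
    using powr_powr[of 2 2 "s/2"] by simp
  also have "bracket s M \<le> bracket s \<eta> + bracket s (\<xi> - \<eta>)"
    unfolding M_def max_def by (simp add: bracket_def)
  finally show ?thesis by simp
qed

lemma sobolev_norm_eq: "sobolev_norm s f = l2norm (\<lambda>\<xi>. complex_of_real (bracket s \<xi>) * fourier f \<xi>)"
  by (simp add: sobolev_norm_def l2norm_def norm_mult power_mult_distrib bracket_sq)

lemma sobolev_iff:
  "f \<in> sobolev s \<longleftrightarrow> square_integrable f \<and> square_integrable (\<lambda>\<xi>. complex_of_real (bracket s \<xi>) * fourier f \<xi>)"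
  using measurable_fourier[of f]
  by (auto simp: sobolev_def square_integrable_def norm_mult power_mult_distrib bracket_sq)

lemma sobolev_norm_nonneg [simp]: "0 \<le> sobolev_norm s f"
  by (simp add: sobolev_norm_eq)

lemma sobolevD:
  assumes "f \<in> sobolev s"
  shows "square_integrable f" "square_integrable (\<lambda>\<xi>. complex_of_real (bracket s \<xi>) * fourier f \<xi>)"
    "fourier f \<in> borel_measurable borel" "f \<in> borel_measurable borel"
  using assms by (auto simp: sobolev_iff measurable_fourier sqint_measurable)

text \<open>The comparison function \<open>g\<close> may be any expression that equals a transform almost everywhere, which is
  how Fourier identities are converted into Sobolev bounds.\<close>

lemma sobolev_dominated:
  assumes f: "square_integrable f" and [measurable]: "g \<in> borel_measurable borel"
    and g: "square_integrable (\<lambda>\<xi>. complex_of_real (bracket t \<xi>) * g \<xi>)" and B: "0 \<le> B"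
    and le: "AE \<xi> in lborel. bracket s \<xi> * cmod (fourier f \<xi>) \<le> B * (bracket t \<xi> * cmod (g \<xi>))"
  shows "f \<in> sobolev s" "sobolev_norm s f \<le> B * l2norm (\<lambda>\<xi>. complex_of_real (bracket t \<xi>) * g \<xi>)"
proof -
  note [measurable] = measurable_fourier[OF f]
  have le': "AE \<xi> in lborel. cmod (complex_of_real (bracket s \<xi>) * fourier f \<xi>) \<le> B * cmod (complex_of_real (bracket t \<xi>) * g \<xi>)"
    using le by eventually_elim (simp add: norm_mult)
  show "f \<in> sobolev s"
    unfolding sobolev_iff using square_integrableI_bound[OF _ g le'] f by simp
  show "sobolev_norm s f \<le> B * l2norm (\<lambda>\<xi>. complex_of_real (bracket t \<xi>) * g \<xi>)"
    unfolding sobolev_norm_eq by (rule l2norm_mono[OF _ g le' B]) measurable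
qed

lemma sobolev_mono:
  assumes f: "f \<in> sobolev t" and st: "s \<le> t"
  shows "f \<in> sobolev s" "sobolev_norm s f \<le> sobolev_norm t f"
proof -
  have "AE \<xi> in lborel. bracket s \<xi> * cmod (fourier f \<xi>) \<le> 1 * (bracket t \<xi> * cmod (fourier f \<xi>))"
    using bracket_mono[OF st] by (auto intro!: mult_right_mono)
  from sobolev_dominated[OF sobolevD(1,3,2)[OF f] _ this]
  show "f \<in> sobolev s" "sobolev_norm s f \<le> sobolev_norm t f"
    by (auto simp: sobolev_norm_eq)
qed

lemma
  assumes f: "f \<in> sobolev s" and g: "g \<in> sobolev s"
  shows sobolev_diff: "(\<lambda>x. f x - g x) \<in> sobolev s"
    and sobolev_norm_diff_le: "sobolev_norm s (\<lambda>x. f x - g x) \<le> sobolev_norm s f + sobolev_norm s g"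
    and sobolev_add: "(\<lambda>x. f x + g x) \<in> sobolev s"
    and sobolev_norm_add_le: "sobolev_norm s (\<lambda>x. f x + g x) \<le> sobolev_norm s f + sobolev_norm s g"
proof -
  note F = sobolevD[OF f] and G = sobolevD[OF g]
  note [measurable] = F(3,4) G(3,4)
  let ?j = "\<lambda>\<xi>. complex_of_real (bracket s \<xi>)"
  have sqm: "square_integrable (\<lambda>x. f x - g x)"
    using real_square_integrable_add[OF F(1) real_square_integrable_cmult[OF G(1), of "-1"]] by simp
  have sqp: "square_integrable (\<lambda>x. f x + g x)"
    by (rule real_square_integrable_add[OF F(1) G(1)])
  have m: "square_integrable (\<lambda>\<xi>. ?j \<xi> * (fourier f \<xi> - fourier g \<xi>))"
    using square_integrable_diff[OF F(2) G(2)] by (simp add: right_diff_distrib)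
  have p: "square_integrable (\<lambda>\<xi>. ?j \<xi> * (fourier f \<xi> + fourier g \<xi>))"
    using square_integrable_add[OF F(2) G(2)] by (simp add: distrib_left)
  have mn: "l2norm (\<lambda>\<xi>. ?j \<xi> * (fourier f \<xi> - fourier g \<xi>)) \<le> sobolev_norm s f + sobolev_norm s g"
    using l2norm_triangle[OF F(2) square_integrable_cmult[OF G(2), of "-1"]]
      l2norm_cmult[of "-1" "\<lambda>\<xi>. ?j \<xi> * fourier g \<xi>"]
    by (simp add: right_diff_distrib sobolev_norm_eq)
  have pn: "l2norm (\<lambda>\<xi>. ?j \<xi> * (fourier f \<xi> + fourier g \<xi>)) \<le> sobolev_norm s f + sobolev_norm s g"
    using l2norm_triangle[OF F(2) G(2)] by (simp add: distrib_left sobolev_norm_eq)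
  have "AE \<xi> in lborel. bracket s \<xi> * cmod (fourier (\<lambda>x. f x - g x) \<xi>) \<le> 1 * (bracket s \<xi> * cmod (fourier f \<xi> - fourier g \<xi>))"
    using fourier_diff[OF F(1) G(1)] by eventually_elim simp
  from sobolev_dominated[OF sqm _ m _ this] mn
  show "(\<lambda>x. f x - g x) \<in> sobolev s" "sobolev_norm s (\<lambda>x. f x - g x) \<le> sobolev_norm s f + sobolev_norm s g"
    by auto
  have "AE \<xi> in lborel. bracket s \<xi> * cmod (fourier (\<lambda>x. f x + g x) \<xi>) \<le> 1 * (bracket s \<xi> * cmod (fourier f \<xi> + fourier g \<xi>))"
    using fourier_add[OF F(1) G(1)] by eventually_elim simp
  from sobolev_dominated[OF sqp _ p _ this] pn
  show "(\<lambda>x. f x + g x) \<in> sobolev s" "sobolev_norm s (\<lambda>x. f x + g x) \<le> sobolev_norm s f + sobolev_norm s g"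
    by auto
qed

lemma
  assumes f: "f \<in> sobolev s"
  shows sobolev_cmult: "(\<lambda>x. c * f x) \<in> sobolev s"
    and sobolev_norm_cmult: "sobolev_norm s (\<lambda>x. c * f x) \<le> \<bar>c\<bar> * sobolev_norm s f"
proof -
  note F = sobolevD[OF f]
  have "AE \<xi> in lborel. bracket s \<xi> * cmod (fourier (\<lambda>x. c * f x) \<xi>) \<le> \<bar>c\<bar> * (bracket s \<xi> * cmod (fourier f \<xi>))"
    using fourier_cmult[OF F(1), of c] by eventually_elim (simp add: norm_mult)
  from sobolev_dominated[OF real_square_integrable_cmult[OF F(1)] F(3,2) _ this]
  show "(\<lambda>x. c * f x) \<in> sobolev s" "sobolev_norm s (\<lambda>x. c * f x) \<le> \<bar>c\<bar> * sobolev_norm s f"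
    by (auto simp: sobolev_norm_eq)
qed

lemma sobolev_cong_AE:
  assumes f: "f \<in> sobolev s" and "g \<in> borel_measurable borel" "AE x in lborel. g x = f x"
  shows "g \<in> sobolev s" "sobolev_norm s g = sobolev_norm s f"
proof -
  note F = sobolevD[OF f]
  from fourier_cong_AE[OF F(1) assms(2,3)]
  have G: "square_integrable g" and ae: "AE \<xi> in lborel. fourier g \<xi> = fourier f \<xi>" by auto
  note [measurable] = F(3) measurable_fourier[OF G]
  have ae': "AE \<xi> in lborel. complex_of_real (bracket s \<xi>) * fourier g \<xi> = complex_of_real (bracket s \<xi>) * fourier f \<xi>"
    using ae by eventually_elim simp
  have sq: "square_integrable (\<lambda>\<xi>. complex_of_real (bracket s \<xi>) * fourier g \<xi>)"
    by (rule square_integrable_AE_cong[OF _ F(2) ae']) measurable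
  then show "g \<in> sobolev s" using G by (simp add: sobolev_iff)
  show "sobolev_norm s g = sobolev_norm s f"
    unfolding sobolev_norm_eq by (rule l2norm_cong_AE[OF sq F(2) ae'])
qed

text \<open>On each half-line the squared weight is at most \<open>2 powr s\<close> times \<open>(1 + \<bar>x\<bar>) powr (- 2 s)\<close>, whose primitive is explicit.\<close>

lemma square_integrable_bracket:
  assumes s: "s > 1 / 2"
  shows "square_integrable (\<lambda>\<xi>. complex_of_real (bracket (- s) \<xi>))"
  unfolding square_integrable_iff_nn[OF measurable_compose[OF measurable_bracket borel_measurable_of_real]]
proof -
  define h where "h x = (1 + x) powr (- (2 * s))" for x :: real
  have [measurable]: "h \<in> borel_measurable borel" unfolding h_def[abs_def] by measurable
  have *: "(\<integral>\<^sup>+x. ennreal (h x) * indicator {0..} x \<partial>lborel) = ennreal (0 - (1 + 0) powr (1 - 2 * s) / (1 - 2 * s))"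
  proof (rule nn_integral_FTC_atLeast)
    show "((\<lambda>x. (1 + x) powr (1 - 2 * s) / (1 - 2 * s)) has_real_derivative h x) (at x)" if "0 \<le> x" for x
    proof -
      have "((\<lambda>x. (1 + x) powr (1 - 2 * s)) has_real_derivative (1 - 2 * s) * (1 + x) powr (1 - 2 * s - 1)) (at x)"
        using that by (auto intro!: derivative_eq_intros)
      from DERIV_cdivide[OF this, of "1 - 2 * s"] show ?thesis
        using s by (simp add: h_def)
    qed
    have "((\<lambda>x. (1 + x) powr (1 - 2 * s)) \<longlongrightarrow> 0) at_top"
      using s by (intro tendsto_neg_powr filterlim_tendsto_add_at_top[OF tendsto_const] filterlim_ident) auto
    from tendsto_divide[OF this tendsto_const, of "1 - 2 * s"]
    show "((\<lambda>x. (1 + x) powr (1 - 2 * s) / (1 - 2 * s)) \<longlongrightarrow> 0) at_top" using s by simp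
  qed (auto simp: h_def)
  define I where "I = (\<integral>\<^sup>+x. ennreal (h x) * indicator {0..} x \<partial>lborel)"
  have I: "I < \<infinity>" unfolding I_def * by simp
  have I': "(\<integral>\<^sup>+x. ennreal (h (- x)) * indicator {0..} (- x) \<partial>lborel) = I"
    unfolding I_def using nn_integral_real_affine[of "\<lambda>x. ennreal (h x) * indicator {0..} x" "-1" 0] by simp
  have bound: "(bracket (- s) x)\<^sup>2 \<le> 2 powr s * h \<bar>x\<bar>" for x
  proof -
    have "(1 + \<bar>x\<bar>)\<^sup>2 \<le> 2 * (1 + x\<^sup>2)"
      using sum_squares_bound[of 1 "\<bar>x\<bar>"] by (simp add: power2_sum)
    then have "((1 + \<bar>x\<bar>)\<^sup>2 / 2) \<le> 1 + x\<^sup>2" by simp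
    then have "(1 + x\<^sup>2) powr (- s) \<le> ((1 + \<bar>x\<bar>)\<^sup>2 / 2) powr (- s)"
      using s by (intro powr_mono2') auto
    also have "\<dots> = (1 + \<bar>x\<bar>) powr (- (2 * s)) / 2 powr (- s)"
      using powr_powr[of "1 + \<bar>x\<bar>" 2 "- s"] by (simp add: powr_divide)
    finally show ?thesis by (simp add: bracket_sq h_def powr_minus field_simps)
  qed
  have "(\<integral>\<^sup>+x. ennreal ((cmod (complex_of_real (bracket (- s) x)))\<^sup>2) \<partial>lborel)
     \<le> (\<integral>\<^sup>+x. ennreal (2 powr s) * (ennreal (h x) * indicator {0..} x + ennreal (h (- x)) * indicator {0..} (- x)) \<partial>lborel)"
  proof (rule nn_integral_mono)
    fix x
    have "ennreal ((cmod (complex_of_real (bracket (- s) x)))\<^sup>2) \<le> ennreal (2 powr s) * ennreal (h \<bar>x\<bar>)"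
      using bound[of x] by (simp add: ennreal_leI flip: ennreal_mult')
    also have "\<dots> \<le> ennreal (2 powr s) * (ennreal (h x) * indicator {0..} x + ennreal (h (- x)) * indicator {0..} (- x))"
      by (intro mult_left_mono) (auto simp: indicator_def abs_if)
    finally show "ennreal ((cmod (complex_of_real (bracket (- s) x)))\<^sup>2)
      \<le> ennreal (2 powr s) * (ennreal (h x) * indicator {0..} x + ennreal (h (- x)) * indicator {0..} (- x))" .
  qed
  also have "\<dots> = ennreal (2 powr s) * (I + I)"
    by (subst nn_integral_cmult, measurable, subst nn_integral_add) (auto simp: I' I_def[symmetric])
  also have "\<dots> < \<infinity>"
    using I by (simp add: ennreal_mult_less_top)
  finally show "(\<integral>\<^sup>+x. ennreal ((cmod (complex_of_real (bracket (- s) x)))\<^sup>2) \<partial>lborel) < \<infinity>" .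
qed

text \<open>Cauchy--Schwarz against the square-integrable weight: the Sobolev embedding on the Fourier side.\<close>

lemma
  assumes f: "f \<in> sobolev s" and s: "s > 1 / 2"
  shows integrable_fourier_sobolev: "integrable lborel (fourier f)"
    and nn_fourier_le: "(\<integral>\<^sup>+\<xi>. ennreal (cmod (fourier f \<xi>)) \<partial>lborel) \<le> ennreal (l2norm (\<lambda>\<xi>. complex_of_real (bracket (- s) \<xi>)) * sobolev_norm s f)"
proof -
  have eq: "(\<lambda>\<xi>. complex_of_real (bracket (- s) \<xi>) * (complex_of_real (bracket s \<xi>) * fourier f \<xi>)) = fourier f"
  proof
    fix \<xi>
    have "bracket (- s) \<xi> * bracket s \<xi> = 1"
      by (subst bracket_add[symmetric]) simp
    then have "complex_of_real (bracket (- s) \<xi>) * complex_of_real (bracket s \<xi>) = 1"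
      by (simp flip: of_real_mult)
    then show "complex_of_real (bracket (- s) \<xi>) * (complex_of_real (bracket s \<xi>) * fourier f \<xi>) = fourier f \<xi>"
      by (simp flip: mult.assoc)
  qed
  from integrable_mult_sqint[OF square_integrable_bracket[OF s] sobolevD(2)[OF f]]
  show "integrable lborel (fourier f)" unfolding eq .
  have "(\<integral>\<^sup>+\<xi>. ennreal (cmod (fourier f \<xi>)) \<partial>lborel)
    = (\<integral>\<^sup>+\<xi>. ennreal (cmod (complex_of_real (bracket (- s) \<xi>) * (complex_of_real (bracket s \<xi>) * fourier f \<xi>))) \<partial>lborel)"
    using eq by metis
  also have "\<dots> \<le> ennreal (l2norm (\<lambda>\<xi>. complex_of_real (bracket (- s) \<xi>)) * sobolev_norm s f)"
    unfolding sobolev_norm_eq by (rule nn_Cauchy_Schwarz[OF square_integrable_bracket[OF s] sobolevD(2)[OF f]])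
  finally show "(\<integral>\<^sup>+\<xi>. ennreal (cmod (fourier f \<xi>)) \<partial>lborel) \<le> ennreal (l2norm (\<lambda>\<xi>. complex_of_real (bracket (- s) \<xi>)) * sobolev_norm s f)" .
qed

section \<open>Products in Sobolev spaces\<close>

lemma nn_integral_convolution_commute:
  fixes p q :: "real \<Rightarrow> real"
  assumes [measurable]: "p \<in> borel_measurable borel" "q \<in> borel_measurable borel"
  shows "(\<integral>\<^sup>+\<eta>. ennreal (p \<eta> * q (\<xi> - \<eta>)) \<partial>lborel) = (\<integral>\<^sup>+\<eta>. ennreal (q \<eta> * p (\<xi> - \<eta>)) \<partial>lborel)"
  using nn_integral_real_affine[of "\<lambda>\<eta>. ennreal (p \<eta> * q (\<xi> - \<eta>))" "-1" \<xi>]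
  by (simp add: mult.commute)

text \<open>Young's inequality for \<open>L\<^sup>2 * L\<^sup>1\<close>: Cauchy--Schwarz with respect to the measure with density
  \<open>q (\<xi> - \<eta>)\<close>.\<close>

lemma nn_young:
  fixes p q :: "real \<Rightarrow> real"
  assumes [measurable]: "p \<in> borel_measurable borel" "q \<in> borel_measurable borel"
    and p: "\<And>x. 0 \<le> p x" and q: "\<And>x. 0 \<le> q x"
  shows "(\<integral>\<^sup>+\<xi>. (\<integral>\<^sup>+\<eta>. ennreal (p \<eta> * q (\<xi> - \<eta>)) \<partial>lborel)\<^sup>2 \<partial>lborel)
     \<le> (\<integral>\<^sup>+x. ennreal ((p x)\<^sup>2) \<partial>lborel) * (\<integral>\<^sup>+x. ennreal (q x) \<partial>lborel)\<^sup>2"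
proof -
  define Q where "Q = (\<integral>\<^sup>+x. ennreal (q x) \<partial>lborel)"
  have Q1: "(\<integral>\<^sup>+\<eta>. ennreal (q (\<xi> - \<eta>)) \<partial>lborel) = Q" for \<xi>
    unfolding Q_def using nn_integral_real_affine[of "\<lambda>x. ennreal (q x)" "-1" \<xi>] by simp
  have Q2: "(\<integral>\<^sup>+\<xi>. ennreal (q (\<xi> - \<eta>)) \<partial>lborel) = Q" for \<eta>
    unfolding Q_def using nn_integral_real_affine[of "\<lambda>x. ennreal (q x)" 1 "-\<eta>"] by simp
  have "(\<integral>\<^sup>+\<eta>. ennreal (p \<eta> * q (\<xi> - \<eta>)) \<partial>lborel)\<^sup>2 \<le> (\<integral>\<^sup>+\<eta>. ennreal ((p \<eta>)\<^sup>2) * ennreal (q (\<xi> - \<eta>)) \<partial>lborel) * Q" for \<xi>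
  proof -
    have "(\<integral>\<^sup>+\<eta>. ennreal (p \<eta> * q (\<xi> - \<eta>)) \<partial>lborel)
       = (\<integral>\<^sup>+\<eta>. ennreal (p \<eta> * sqrt (q (\<xi> - \<eta>))) * ennreal (sqrt (q (\<xi> - \<eta>))) \<partial>lborel)"
      using p q by (simp add: mult.assoc flip: ennreal_mult)
    also have "\<dots>\<^sup>2 \<le> (\<integral>\<^sup>+\<eta>. (ennreal (p \<eta> * sqrt (q (\<xi> - \<eta>))))\<^sup>2 \<partial>lborel) * (\<integral>\<^sup>+\<eta>. (ennreal (sqrt (q (\<xi> - \<eta>))))\<^sup>2 \<partial>lborel)"
      by (rule Cauchy_Schwarz_nn_integral) measurable
    also have "\<dots> = (\<integral>\<^sup>+\<eta>. ennreal ((p \<eta>)\<^sup>2) * ennreal (q (\<xi> - \<eta>)) \<partial>lborel) * Q"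
      using p q by (simp add: ennreal_power power_mult_distrib Q1 flip: ennreal_mult)
    finally show ?thesis .
  qed
  then have "(\<integral>\<^sup>+\<xi>. (\<integral>\<^sup>+\<eta>. ennreal (p \<eta> * q (\<xi> - \<eta>)) \<partial>lborel)\<^sup>2 \<partial>lborel)
     \<le> (\<integral>\<^sup>+\<xi>. (\<integral>\<^sup>+\<eta>. ennreal ((p \<eta>)\<^sup>2) * ennreal (q (\<xi> - \<eta>)) \<partial>lborel) * Q \<partial>lborel)"
    by (intro nn_integral_mono)
  also have "\<dots> = (\<integral>\<^sup>+\<xi>. (\<integral>\<^sup>+\<eta>. ennreal ((p \<eta>)\<^sup>2) * ennreal (q (\<xi> - \<eta>)) \<partial>lborel) \<partial>lborel) * Q"
    by (rule nn_integral_multc) measurable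
  also have "(\<integral>\<^sup>+\<xi>. (\<integral>\<^sup>+\<eta>. ennreal ((p \<eta>)\<^sup>2) * ennreal (q (\<xi> - \<eta>)) \<partial>lborel) \<partial>lborel)
     = (\<integral>\<^sup>+\<eta>. ennreal ((p \<eta>)\<^sup>2) * Q \<partial>lborel)"
    by (subst lborel_pair.Fubini') (simp_all add: nn_integral_cmult Q2)
  finally show ?thesis
    by (simp add: nn_integral_multc Q_def power2_eq_square mult.assoc)
qed

lemma ennreal_power2_sum_le: "(x + y)\<^sup>2 \<le> 2 * x\<^sup>2 + 2 * y\<^sup>2" for x y :: ennreal
proof (cases x; cases y)
  fix a b assume ab: "x = ennreal a" "0 \<le> a" "y = ennreal b" "0 \<le> b"
  have "(a + b)\<^sup>2 \<le> 2 * a\<^sup>2 + 2 * b\<^sup>2"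
    using sum_squares_bound[of a b] by (simp add: power2_sum)
  then have "ennreal ((a + b)\<^sup>2) \<le> ennreal (2 * a\<^sup>2 + 2 * b\<^sup>2)" by (rule ennreal_leI)
  also have "\<dots> = 2 * ennreal (a\<^sup>2) + 2 * ennreal (b\<^sup>2)"
    by (simp add: ennreal_mult)
  finally show ?thesis
    using ab by (simp add: ennreal_power flip: ennreal_plus)
qed (auto simp: power2_eq_square ennreal_mult_eq_top_iff top_add ennreal_top_mult)

text \<open>The weight of order \<open>\<sigma>\<close> at \<open>\<xi>\<close> is distributed over \<open>\<eta>\<close> and \<open>\<xi> - \<eta>\<close>.  In each of the two resulting
  convolutions the weighted factor is square-integrable, and the other one is integrable with a norm
  controlled at the lower order \<open>\<tau>\<close>.  Hence the estimate is linear in the high norm.\<close>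

lemma sobolev_product:
  assumes \<tau>: "1 / 2 < \<tau>" and \<sigma>: "\<tau> \<le> \<sigma>"
  shows "\<exists>C\<ge>0. \<forall>f g. f \<in> sobolev \<sigma> \<longrightarrow> g \<in> sobolev \<sigma> \<longrightarrow> (\<lambda>x. f x * g x) \<in> sobolev \<sigma> \<and>
     sobolev_norm \<sigma> (\<lambda>x. f x * g x) \<le> C * (sobolev_norm \<sigma> f * sobolev_norm \<tau> g + sobolev_norm \<tau> f * sobolev_norm \<sigma> g)"
proof -
  define E where "E = l2norm (\<lambda>\<xi>. complex_of_real (bracket (- \<tau>) \<xi>))"
  have E: "0 \<le> E" by (simp add: E_def)
  define c where "c = (2::real) powr \<sigma>"
  have c: "0 \<le> c" by (simp add: c_def)
  have "(\<lambda>x. f x * g x) \<in> sobolev \<sigma> \<and> sobolev_norm \<sigma> (\<lambda>x. f x * g x)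
      \<le> 2 * c * E * (sobolev_norm \<sigma> f * sobolev_norm \<tau> g + sobolev_norm \<tau> f * sobolev_norm \<sigma> g)"
    if f: "f \<in> sobolev \<sigma>" and g: "g \<in> sobolev \<sigma>" for f g
  proof -
    have f\<tau>: "f \<in> sobolev \<tau>" and g\<tau>: "g \<in> sobolev \<tau>"
      using sobolev_mono(1)[OF f \<sigma>] sobolev_mono(1)[OF g \<sigma>] by auto
    note F = sobolevD[OF f] and G = sobolevD[OF g]
    note [measurable] = F(3,4) G(3,4)
    have fg: "square_integrable (\<lambda>x. f x * g x)"
      by (rule square_integrable_mult_of_integrable_fourier[OF F(1) integrable_fourier_sobolev[OF f\<tau> \<tau>] G(1)])
    note [measurable] = measurable_fourier[OF fg]
    define P where "P \<xi> = cmod (fourier f \<xi>)" for \<xi>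
    define Q where "Q \<xi> = cmod (fourier g \<xi>)" for \<xi>
    define P' where "P' \<xi> = bracket \<sigma> \<xi> * P \<xi>" for \<xi>
    define Q' where "Q' \<xi> = bracket \<sigma> \<xi> * Q \<xi>" for \<xi>
    have [measurable]: "P \<in> borel_measurable borel" "Q \<in> borel_measurable borel"
       "P' \<in> borel_measurable borel" "Q' \<in> borel_measurable borel"
      unfolding P_def[abs_def] Q_def[abs_def] P'_def[abs_def] Q'_def[abs_def] by measurable
    have nn: "0 \<le> P x" "0 \<le> Q x" "0 \<le> P' x" "0 \<le> Q' x" for x
      by (auto simp: P_def Q_def P'_def Q'_def)
    have P2: "(\<integral>\<^sup>+x. ennreal ((P' x)\<^sup>2) \<partial>lborel) = ennreal ((sobolev_norm \<sigma> f)\<^sup>2)"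
      using nn_l2norm[OF F(2)] by (simp add: P'_def P_def sobolev_norm_eq norm_mult)
    have Q2: "(\<integral>\<^sup>+x. ennreal ((Q' x)\<^sup>2) \<partial>lborel) = ennreal ((sobolev_norm \<sigma> g)\<^sup>2)"
      using nn_l2norm[OF G(2)] by (simp add: Q'_def Q_def sobolev_norm_eq norm_mult)
    have P1: "(\<integral>\<^sup>+x. ennreal (P x) \<partial>lborel)\<^sup>2 \<le> ennreal ((E * sobolev_norm \<tau> f)\<^sup>2)"
      using power_mono[OF nn_fourier_le[OF f\<tau> \<tau>], of 2] E by (simp add: E_def P_def ennreal_power)
    have Q1: "(\<integral>\<^sup>+x. ennreal (Q x) \<partial>lborel)\<^sup>2 \<le> ennreal ((E * sobolev_norm \<tau> g)\<^sup>2)"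
      using power_mono[OF nn_fourier_le[OF g\<tau> \<tau>], of 2] E by (simp add: E_def Q_def ennreal_power)
    define A where "A \<xi> = (\<integral>\<^sup>+\<eta>. ennreal (P' \<eta> * Q (\<xi> - \<eta>)) \<partial>lborel)" for \<xi>
    define B where "B \<xi> = (\<integral>\<^sup>+\<eta>. ennreal (P \<eta> * Q' (\<xi> - \<eta>)) \<partial>lborel)" for \<xi>
    have [measurable]: "A \<in> borel_measurable borel" "B \<in> borel_measurable borel"
      unfolding A_def[abs_def] B_def[abs_def] by measurable
    have pt: "AE \<xi> in lborel. ennreal (bracket \<sigma> \<xi> * cmod (fourier (\<lambda>x. f x * g x) \<xi>)) \<le> ennreal c * (A \<xi> + B \<xi>)"
      using fourier_product[OF F(1) G(1) fg]
    proof eventually_elim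
      case (elim \<xi>)
      have "cmod (fourier (\<lambda>x. f x * g x) \<xi>) \<le> (2 * pi) * cmod (fourier (\<lambda>x. f x * g x) \<xi>)"
        using pi_ge_two mult_right_mono[of 1 "2 * pi" "cmod (fourier (\<lambda>x. f x * g x) \<xi>)"] by simp
      also have "\<dots> = cmod (LINT \<eta>|lborel. fourier f \<eta> * fourier g (\<xi> - \<eta>))"
        unfolding elim[symmetric] by (simp add: norm_mult)
      finally have "ennreal (bracket \<sigma> \<xi> * cmod (fourier (\<lambda>x. f x * g x) \<xi>))
          \<le> ennreal (bracket \<sigma> \<xi>) * ennreal (cmod (LINT \<eta>|lborel. fourier f \<eta> * fourier g (\<xi> - \<eta>)))"
        by (simp add: ennreal_leI mult_left_mono flip: ennreal_mult)
      also have "\<dots> \<le> ennreal (bracket \<sigma> \<xi>) * (\<integral>\<^sup>+\<eta>. ennreal (P \<eta> * Q (\<xi> - \<eta>)) \<partial>lborel)"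
        using cmod_integral_le_nn[of lborel "\<lambda>\<eta>. fourier f \<eta> * fourier g (\<xi> - \<eta>)"]
        by (intro mult_left_mono) (auto simp: P_def Q_def norm_mult)
      also have "\<dots> = (\<integral>\<^sup>+\<eta>. ennreal (bracket \<sigma> \<xi> * (P \<eta> * Q (\<xi> - \<eta>))) \<partial>lborel)"
        using nn by (simp add: nn_integral_cmult ennreal_mult)
      also have "\<dots> \<le> (\<integral>\<^sup>+\<eta>. ennreal c * (ennreal (P' \<eta> * Q (\<xi> - \<eta>)) + ennreal (P \<eta> * Q' (\<xi> - \<eta>))) \<partial>lborel)"
      proof (rule nn_integral_mono)
        fix \<eta>
        have "bracket \<sigma> \<xi> * (P \<eta> * Q (\<xi> - \<eta>)) \<le> (c * (bracket \<sigma> \<eta> + bracket \<sigma> (\<xi> - \<eta>))) * (P \<eta> * Q (\<xi> - \<eta>))"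
          unfolding c_def using \<tau> \<sigma> nn by (intro mult_right_mono bracket_peetre) auto
        also have "\<dots> = c * (P' \<eta> * Q (\<xi> - \<eta>) + P \<eta> * Q' (\<xi> - \<eta>))"
          by (simp add: P'_def Q'_def algebra_simps)
        finally show "ennreal (bracket \<sigma> \<xi> * (P \<eta> * Q (\<xi> - \<eta>))) \<le> ennreal c * (ennreal (P' \<eta> * Q (\<xi> - \<eta>)) + ennreal (P \<eta> * Q' (\<xi> - \<eta>)))"
          using c nn by (simp add: ennreal_leI flip: ennreal_mult ennreal_plus)
      qed
      also have "\<dots> = ennreal c * (A \<xi> + B \<xi>)"
        unfolding A_def B_def by (simp add: nn_integral_cmult nn_integral_add)
      finally show ?case .
    qed
    define S where "S = sobolev_norm \<sigma> f * sobolev_norm \<tau> g + sobolev_norm \<tau> f * sobolev_norm \<sigma> g"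
    have S: "0 \<le> S" by (simp add: S_def)
    have "(\<integral>\<^sup>+\<xi>. ennreal ((cmod (complex_of_real (bracket \<sigma> \<xi>) * fourier (\<lambda>x. f x * g x) \<xi>))\<^sup>2) \<partial>lborel)
       \<le> (\<integral>\<^sup>+\<xi>. ennreal (c\<^sup>2) * (2 * (A \<xi>)\<^sup>2 + 2 * (B \<xi>)\<^sup>2) \<partial>lborel)"
    proof (rule nn_integral_mono_AE, use pt in eventually_elim)
      case (elim \<xi>)
      have "ennreal ((cmod (complex_of_real (bracket \<sigma> \<xi>) * fourier (\<lambda>x. f x * g x) \<xi>))\<^sup>2)
         = (ennreal (bracket \<sigma> \<xi> * cmod (fourier (\<lambda>x. f x * g x) \<xi>)))\<^sup>2"
        by (simp add: ennreal_power norm_mult)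
      also have "\<dots> \<le> (ennreal c * (A \<xi> + B \<xi>))\<^sup>2"
        by (rule power_mono[OF elim]) simp
      also have "\<dots> = ennreal (c\<^sup>2) * (A \<xi> + B \<xi>)\<^sup>2"
        using c by (simp add: power_mult_distrib ennreal_power)
      also have "\<dots> \<le> ennreal (c\<^sup>2) * (2 * (A \<xi>)\<^sup>2 + 2 * (B \<xi>)\<^sup>2)"
        by (intro mult_left_mono ennreal_power2_sum_le) simp
      finally show ?case .
    qed
    also have "\<dots> = ennreal (c\<^sup>2) * (2 * (\<integral>\<^sup>+\<xi>. (A \<xi>)\<^sup>2 \<partial>lborel) + 2 * (\<integral>\<^sup>+\<xi>. (B \<xi>)\<^sup>2 \<partial>lborel))"
      by (simp add: nn_integral_cmult nn_integral_add)
    also have "\<dots> \<le> ennreal (c\<^sup>2) * (2 * ennreal ((E * (sobolev_norm \<sigma> f * sobolev_norm \<tau> g))\<^sup>2) + 2 * ennreal ((E * (sobolev_norm \<tau> f * sobolev_norm \<sigma> g))\<^sup>2))"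
    proof (intro mult_left_mono add_mono)
      have "(\<integral>\<^sup>+\<xi>. (A \<xi>)\<^sup>2 \<partial>lborel) \<le> ennreal ((sobolev_norm \<sigma> f)\<^sup>2) * (\<integral>\<^sup>+x. ennreal (Q x) \<partial>lborel)\<^sup>2"
        unfolding A_def P2[symmetric] by (rule nn_young) (auto simp: nn)
      also have "\<dots> \<le> ennreal ((sobolev_norm \<sigma> f)\<^sup>2) * ennreal ((E * sobolev_norm \<tau> g)\<^sup>2)"
        by (intro mult_left_mono Q1) simp
      finally show "(\<integral>\<^sup>+\<xi>. (A \<xi>)\<^sup>2 \<partial>lborel) \<le> ennreal ((E * (sobolev_norm \<sigma> f * sobolev_norm \<tau> g))\<^sup>2)"
        by (simp add: power_mult_distrib mult_ac flip: ennreal_mult)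
      have "(\<integral>\<^sup>+\<xi>. (B \<xi>)\<^sup>2 \<partial>lborel) = (\<integral>\<^sup>+\<xi>. (\<integral>\<^sup>+\<eta>. ennreal (Q' \<eta> * P (\<xi> - \<eta>)) \<partial>lborel)\<^sup>2 \<partial>lborel)"
        unfolding B_def by (subst nn_integral_convolution_commute) auto
      also have "\<dots> \<le> ennreal ((sobolev_norm \<sigma> g)\<^sup>2) * (\<integral>\<^sup>+x. ennreal (P x) \<partial>lborel)\<^sup>2"
        unfolding Q2[symmetric] by (rule nn_young) (auto simp: nn)
      also have "\<dots> \<le> ennreal ((sobolev_norm \<sigma> g)\<^sup>2) * ennreal ((E * sobolev_norm \<tau> f)\<^sup>2)"
        by (intro mult_left_mono P1) simp
      finally show "(\<integral>\<^sup>+\<xi>. (B \<xi>)\<^sup>2 \<partial>lborel) \<le> ennreal ((E * (sobolev_norm \<tau> f * sobolev_norm \<sigma> g))\<^sup>2)"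
        by (simp add: power_mult_distrib mult_ac flip: ennreal_mult)
    qed auto
    also have "\<dots> = ennreal (c\<^sup>2 * (2 * (E * (sobolev_norm \<sigma> f * sobolev_norm \<tau> g))\<^sup>2 + 2 * (E * (sobolev_norm \<tau> f * sobolev_norm \<sigma> g))\<^sup>2))"
      by (simp add: ennreal_mult)
    also have "\<dots> \<le> ennreal ((2 * c * E * S)\<^sup>2)"
    proof (rule ennreal_leI)
      define a where "a = sobolev_norm \<sigma> f * sobolev_norm \<tau> g"
      define b where "b = sobolev_norm \<tau> f * sobolev_norm \<sigma> g"
      have "0 \<le> a" "0 \<le> b" by (auto simp: a_def b_def)
      then have "2 * a\<^sup>2 + 2 * b\<^sup>2 \<le> 4 * (a + b)\<^sup>2" by (simp add: power2_sum)
      then have "(c\<^sup>2 * E\<^sup>2) * (2 * a\<^sup>2 + 2 * b\<^sup>2) \<le> (c\<^sup>2 * E\<^sup>2) * (4 * (a + b)\<^sup>2)"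
        by (intro mult_left_mono) auto
      moreover have "c\<^sup>2 * (2 * (E * a)\<^sup>2 + 2 * (E * b)\<^sup>2) = (c\<^sup>2 * E\<^sup>2) * (2 * a\<^sup>2 + 2 * b\<^sup>2)"
        by (simp add: power_mult_distrib algebra_simps)
      moreover have "(2 * c * E * (a + b))\<^sup>2 = (c\<^sup>2 * E\<^sup>2) * (4 * (a + b)\<^sup>2)"
        by (simp add: power_mult_distrib)
      ultimately show "c\<^sup>2 * (2 * (E * (sobolev_norm \<sigma> f * sobolev_norm \<tau> g))\<^sup>2 + 2 * (E * (sobolev_norm \<tau> f * sobolev_norm \<sigma> g))\<^sup>2) \<le> (2 * c * E * S)\<^sup>2"
        unfolding S_def a_def[symmetric] b_def[symmetric] by (simp only:)
    qed
    finally have "square_integrable (\<lambda>\<xi>. complex_of_real (bracket \<sigma> \<xi>) * fourier (\<lambda>x. f x * g x) \<xi>) \<and>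
        l2norm (\<lambda>\<xi>. complex_of_real (bracket \<sigma> \<xi>) * fourier (\<lambda>x. f x * g x) \<xi>) \<le> 2 * c * E * S"
      using c E S by (intro l2norm_le_nn) auto
    with fg show ?thesis
      by (simp add: sobolev_iff sobolev_norm_eq S_def)
  qed
  then show ?thesis
    using c E by (intro exI[of _ "2 * c * E"]) auto
qed

section \<open>The equations on the Fourier side\<close>

lemma square_integrable_derivative_symbol:
  assumes f: "f \<in> sobolev s" and s: "1 \<le> s"
  shows "square_integrable (\<lambda>\<xi>. (\<i> * complex_of_real \<xi>) * fourier f \<xi>)"
proof -
  note [measurable] = sobolevD(3)[OF f]
  show ?thesis
  proof (rule square_integrableI_bound[OF _ sobolevD(2)[OF f], of _ 1])
    have "\<bar>\<xi>\<bar> \<le> bracket s \<xi>" for \<xi>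
      using bracket_one[of \<xi>] bracket_mono[OF s, of \<xi>] by linarith
    then show "AE \<xi> in lborel. cmod (\<i> * complex_of_real \<xi> * fourier f \<xi>) \<le> 1 * cmod (complex_of_real (bracket s \<xi>) * fourier f \<xi>)"
      by (auto simp: norm_mult intro!: mult_right_mono)
  qed measurable
qed

lemma Dx_fourier:
  assumes f: "square_integrable f" and k: "AE \<xi> in lborel. fourier f \<xi> = k \<xi>"
    and sq: "square_integrable (\<lambda>\<xi>. (\<i> * complex_of_real \<xi>) * k \<xi>)"
  shows "square_integrable (Dx f) \<and> (AE \<xi> in lborel. fourier (Dx f) \<xi> = (\<i> * complex_of_real \<xi>) * k \<xi>)"
proof -
  note [measurable] = measurable_fourier[OF f]
  have "square_integrable (\<lambda>\<xi>. (\<i> * complex_of_real \<xi>) * fourier f \<xi>)"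
    by (rule square_integrable_AE_cong[OF _ sq]) (measurable, use k in \<open>eventually_elim, simp\<close>)
  from fourier_multiplier[OF f _ this]
  have D: "square_integrable (Dx f)" and ae: "AE \<xi> in lborel. fourier (Dx f) \<xi> = (\<i> * complex_of_real \<xi>) * fourier f \<xi>"
    by (auto simp: Dx_def)
  from ae k have "AE \<xi> in lborel. fourier (Dx f) \<xi> = (\<i> * complex_of_real \<xi>) * k \<xi>"
    by eventually_elim simp
  with D show ?thesis by simp
qed

lemma
  assumes f: "f \<in> sobolev s" and s: "1 \<le> s"
  shows square_integrable_Dx: "square_integrable (Dx f)"
    and fourier_Dx: "AE \<xi> in lborel. fourier (Dx f) \<xi> = (\<i> * complex_of_real \<xi>) * fourier f \<xi>"
    and sobolev_Dx: "Dx f \<in> sobolev (s - 1)"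
    and sobolev_norm_Dx: "sobolev_norm (s - 1) (Dx f) \<le> sobolev_norm s f"
proof -
  from Dx_fourier[OF sobolevD(1)[OF f] _ square_integrable_derivative_symbol[OF f s]]
  show D: "square_integrable (Dx f)" and F: "AE \<xi> in lborel. fourier (Dx f) \<xi> = (\<i> * complex_of_real \<xi>) * fourier f \<xi>"
    by auto
  have "AE \<xi> in lborel. bracket (s - 1) \<xi> * cmod (fourier (Dx f) \<xi>) \<le> 1 * (bracket s \<xi> * cmod (fourier f \<xi>))"
    using F
  proof eventually_elim
    case (elim \<xi>)
    have "bracket (s - 1) \<xi> * \<bar>\<xi>\<bar> \<le> bracket (s - 1) \<xi> * bracket 1 \<xi>"
      by (intro mult_left_mono bracket_one) simp
    also have "\<dots> = bracket s \<xi>" by (simp flip: bracket_add)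
    finally have "bracket (s - 1) \<xi> * \<bar>\<xi>\<bar> * cmod (fourier f \<xi>) \<le> bracket s \<xi> * cmod (fourier f \<xi>)"
      by (intro mult_right_mono) auto
    then show ?case by (simp add: elim norm_mult mult.assoc)
  qed
  from sobolev_dominated[OF D sobolevD(3,2)[OF f] _ this]
  show "Dx f \<in> sobolev (s - 1)" "sobolev_norm (s - 1) (Dx f) \<le> sobolev_norm s f"
    by (auto simp: sobolev_norm_eq)
qed

lemma square_integrable_mult_bounded:
  fixes f :: "real \<Rightarrow> complex"
  assumes f: "square_integrable f" and [measurable]: "m \<in> borel_measurable borel" and m: "\<And>\<xi>. cmod (m \<xi>) \<le> B"
  shows "square_integrable (\<lambda>\<xi>. m \<xi> * f \<xi>)"
proof -
  note [measurable] = sqint_measurable[OF f]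
  show ?thesis
    by (rule square_integrableI_bound[OF _ f, of _ B]) (auto simp: norm_mult intro!: mult_right_mono m)
qed

lemma fourier_inv_helmholtz:
  assumes f: "square_integrable f"
  shows "square_integrable (inv_helmholtz \<alpha> f) \<and>
    (AE \<xi> in lborel. fourier (inv_helmholtz \<alpha> f) \<xi> = complex_of_real (1 / (1 + \<alpha>\<^sup>2 * \<xi>\<^sup>2)) * fourier f \<xi>)"
proof -
  have "0 < 1 + \<alpha>\<^sup>2 * \<xi>\<^sup>2" for \<xi> :: real
    by (intro add_pos_nonneg) auto
  then have "cmod (complex_of_real (1 / (1 + \<alpha>\<^sup>2 * \<xi>\<^sup>2))) \<le> 1" for \<xi> :: real
    by (simp add: norm_divide del: of_real_add of_real_divide)
  then have "square_integrable (\<lambda>\<xi>. complex_of_real (1 / (1 + \<alpha>\<^sup>2 * \<xi>\<^sup>2)) * fourier f \<xi>)"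
    by (intro square_integrable_mult_bounded[where B = 1] square_integrable_fourier f) measurable
  from fourier_multiplier[OF f, of "\<lambda>\<xi>. complex_of_real (1 / (1 + \<alpha>\<^sup>2 * \<xi>\<^sup>2))"] this
  show ?thesis by (simp add: inv_helmholtz_def)
qed

text \<open>The transform of \<open>u u\<^sub>x\<close> is the convolution of \<open>i \<eta>\<close>-weighted and unweighted copies of the same function;
  exchanging \<open>\<eta>\<close> with \<open>\<xi> - \<eta>\<close> symmetrises the weight to \<open>i \<xi> / 2\<close>.  This is the product rule for
  \<open>u\<^sup>2\<close> in terms of the multiplier \<^const>\<open>Dx\<close>.\<close>

lemma fourier_mult_Dx:
  assumes u: "u \<in> sobolev s" and s: "3 / 2 < s"
  shows "square_integrable (\<lambda>x. u x * Dx u x)" "square_integrable (\<lambda>x. (u x)\<^sup>2)"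
    "AE \<xi> in lborel. fourier (\<lambda>x. u x * Dx u x) \<xi> = (\<i> * complex_of_real \<xi>) / 2 * fourier (\<lambda>x. (u x)\<^sup>2) \<xi>"
proof -
  note U = sobolevD[OF u]
  have s1: "1 \<le> s" "1 / 2 < s" using s by auto
  note D = square_integrable_Dx[OF u s1(1)] fourier_Dx[OF u s1(1)]
  note [measurable] = U(3,4) measurable_fourier[OF D(1)]
  have i: "integrable lborel (fourier u)" by (rule integrable_fourier_sobolev[OF u s1(2)])
  show uD: "square_integrable (\<lambda>x. u x * Dx u x)"
    by (rule square_integrable_mult_of_integrable_fourier[OF U(1) i D(1)])
  have uu: "square_integrable (\<lambda>x. u x * u x)"
    by (rule square_integrable_mult_of_integrable_fourier[OF U(1) i U(1)])
  then show "square_integrable (\<lambda>x. (u x)\<^sup>2)" by (simp add: power2_eq_square)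
  have Du: "square_integrable (\<lambda>x. Dx u x * u x)" using uD by (simp add: mult.commute)
  have "AE \<xi> in lborel. complex_of_real (2 * pi) * fourier (\<lambda>x. u x * Dx u x) \<xi>
      = (LINT \<eta>|lborel. fourier (Dx u) \<eta> * fourier u (\<xi> - \<eta>))"
    using fourier_product[OF D(1) U(1) Du] by (simp add: mult.commute)
  then show "AE \<xi> in lborel. fourier (\<lambda>x. u x * Dx u x) \<xi> = (\<i> * complex_of_real \<xi>) / 2 * fourier (\<lambda>x. (u x)\<^sup>2) \<xi>"
    using fourier_product[OF U(1) U(1) uu]
  proof eventually_elim
    case (elim \<xi>)
    define J where "J \<eta> = (\<i> * complex_of_real \<eta>) * fourier u \<eta> * fourier u (\<xi> - \<eta>)" for \<eta>
    have uxi: "square_integrable (\<lambda>\<eta>. fourier u (\<xi> - \<eta>))"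
      using square_integrable_affine[OF square_integrable_fourier[OF U(1)], of "-1" \<xi>] by simp
    have Ji: "integrable lborel J"
      unfolding J_def[abs_def]
      by (rule integrable_mult_sqint[OF square_integrable_derivative_symbol[OF u s1(1)] uxi])
    have [measurable]: "J \<in> borel_measurable borel" using Ji by auto
    have 1: "complex_of_real (2 * pi) * fourier (\<lambda>x. u x * Dx u x) \<xi> = (LINT \<eta>|lborel. J \<eta>)"
    proof -
      have "AE \<eta> in lborel. fourier (Dx u) \<eta> * fourier u (\<xi> - \<eta>) = J \<eta>"
        using D(2) by eventually_elim (simp add: J_def)
      then show ?thesis
        unfolding elim(1) by (intro integral_cong_AE) auto
    qed
    have 2: "(LINT \<eta>|lborel. J \<eta>) = (LINT \<eta>|lborel. J (\<xi> - \<eta>))"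
      by (subst lborel_integral_real_affine[of "-1" J \<xi>]) auto
    have Ji': "integrable lborel (\<lambda>\<eta>. J (\<xi> - \<eta>))"
      using lborel_integrable_real_affine[OF Ji, of "-1" \<xi>] by simp
    have "complex_of_real (2 * pi) * ((\<i> * complex_of_real \<xi>) * fourier (\<lambda>x. u x * u x) \<xi>)
       = (\<i> * complex_of_real \<xi>) * (LINT \<eta>|lborel. fourier u \<eta> * fourier u (\<xi> - \<eta>))"
      unfolding elim(2)[symmetric] by simp
    also have "\<dots> = (LINT \<eta>|lborel. (\<i> * complex_of_real \<xi>) * (fourier u \<eta> * fourier u (\<xi> - \<eta>)))"
      by (simp only: integral_mult_right_zero)
    also have "\<dots> = (LINT \<eta>|lborel. J \<eta> + J (\<xi> - \<eta>))"
      by (intro Bochner_Integration.integral_cong refl) (simp add: J_def algebra_simps)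
    also have "\<dots> = 2 * (LINT \<eta>|lborel. J \<eta>)"
      using Ji Ji' 2 by simp
    finally have "complex_of_real (2 * pi) * ((\<i> * complex_of_real \<xi>) * fourier (\<lambda>x. u x * u x) \<xi>)
       = complex_of_real (2 * pi) * (2 * fourier (\<lambda>x. u x * Dx u x) \<xi>)"
      unfolding 1[symmetric] by simp
    then have "(\<i> * complex_of_real \<xi>) * fourier (\<lambda>x. u x * u x) \<xi> = 2 * fourier (\<lambda>x. u x * Dx u x) \<xi>"
      by (simp add: mult.assoc)
    then show ?case by (simp add: power2_eq_square)
  qed
qed

text \<open>Solved for the time derivative and transformed, the equations read
  \<open>u\<^sub>t^ = - i \<xi> (A (u\<^sup>2)^ + B ((u\<^sub>x)\<^sup>2)^)\<close>.  The coefficient \<open>A\<close> collects \<open>3/2\<close> from the transport term and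
  \<open>- \<alpha>\<^sup>2\<xi>\<^sup>2 / (1 + \<alpha>\<^sup>2\<xi>\<^sup>2)\<close> from the third-order term; \<open>B\<close> belongs to the gradient term.\<close>

definition flux_symbol :: "real \<Rightarrow> real \<Rightarrow> real"
  where "flux_symbol \<alpha> \<xi> = 3 / 2 - \<alpha>\<^sup>2 * \<xi>\<^sup>2 / (1 + \<alpha>\<^sup>2 * \<xi>\<^sup>2)"

definition gradient_symbol :: "real \<Rightarrow> real \<Rightarrow> real"
  where "gradient_symbol \<alpha> \<xi> = \<alpha>\<^sup>2 / 2 / (1 + \<alpha>\<^sup>2 * \<xi>\<^sup>2)"

text \<open>The inverse Helmholtz operator absorbs two of the three derivatives, at the price of a factor \<open>1 / \<alpha>\<^sup>2\<close>;
  the remaining one is available for \<open>q \<in> H\<^sup>1\<close>.\<close>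

lemma fourier_third_derivative:
  assumes q: "q \<in> sobolev 1" and \<alpha>: "0 < \<alpha>"
  shows "square_integrable (Dx (Dx (Dx (inv_helmholtz \<alpha> q)))) \<and>
    (AE \<xi> in lborel. fourier (Dx (Dx (Dx (inv_helmholtz \<alpha> q)))) \<xi>
       = - \<i> * complex_of_real \<xi> * complex_of_real (\<xi>\<^sup>2 / (1 + \<alpha>\<^sup>2 * \<xi>\<^sup>2)) * fourier q \<xi>)"
proof -
  note Q = sobolevD[OF q]
  note [measurable] = Q(3)
  have p: "0 < 1 + \<alpha>\<^sup>2 * \<xi>\<^sup>2" for \<xi> :: real
    by (intro add_pos_nonneg) auto
  have ii: "\<i> * (\<i> * z) = - z" for z by (simp flip: mult.assoc)
  define w where "w \<xi> = 1 / (1 + \<alpha>\<^sup>2 * \<xi>\<^sup>2)" for \<xi> :: real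
  have [measurable]: "w \<in> borel_measurable borel" unfolding w_def[abs_def] by measurable
  have w: "0 \<le> w \<xi>" "w \<xi> \<le> 1" for \<xi>
    using p[of \<xi>] by (auto simp: w_def)
  have w2: "\<xi>\<^sup>2 * w \<xi> \<le> 1 / \<alpha>\<^sup>2" for \<xi>
    using p[of \<xi>] \<alpha> by (simp add: w_def field_simps)
  have d1: "square_integrable (\<lambda>\<xi>. (\<i> * complex_of_real \<xi>) * fourier q \<xi>)"
    by (rule square_integrable_derivative_symbol[OF q]) simp
  define k0 where "k0 \<xi> = complex_of_real (w \<xi>) * fourier q \<xi>" for \<xi>
  define k1 where "k1 \<xi> = (\<i> * complex_of_real \<xi>) * k0 \<xi>" for \<xi>
  define k2 where "k2 \<xi> = (\<i> * complex_of_real \<xi>) * k1 \<xi>" for \<xi>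
  define k3 where "k3 \<xi> = (\<i> * complex_of_real \<xi>) * k2 \<xi>" for \<xi>
  have k0: "square_integrable (inv_helmholtz \<alpha> q)" "AE \<xi> in lborel. fourier (inv_helmholtz \<alpha> q) \<xi> = k0 \<xi>"
    using fourier_inv_helmholtz[OF Q(1), of \<alpha>] by (auto simp: k0_def w_def)
  have "square_integrable (\<lambda>\<xi>. complex_of_real (w \<xi>) * ((\<i> * complex_of_real \<xi>) * fourier q \<xi>))"
    by (rule square_integrable_mult_bounded[OF d1, where B = 1]) (use w in auto)
  then have s1: "square_integrable (\<lambda>\<xi>. (\<i> * complex_of_real \<xi>) * k0 \<xi>)"
    by (simp add: k0_def mult_ac)
  have bd: "cmod (- complex_of_real (\<xi>\<^sup>2 * w \<xi>)) \<le> 1 / \<alpha>\<^sup>2" for \<xi>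
    using w w2 by (simp del: of_real_mult of_real_power)
  have "square_integrable (\<lambda>\<xi>. - complex_of_real (\<xi>\<^sup>2 * w \<xi>) * fourier q \<xi>)"
    by (rule square_integrable_mult_bounded[OF square_integrable_fourier[OF Q(1)] _ bd]) measurable
  also have "(\<lambda>\<xi>. - complex_of_real (\<xi>\<^sup>2 * w \<xi>) * fourier q \<xi>) = (\<lambda>\<xi>. (\<i> * complex_of_real \<xi>) * k1 \<xi>)"
    by (simp add: fun_eq_iff k1_def k0_def power2_eq_square mult_ac ii)
  finally have s2: "square_integrable (\<lambda>\<xi>. (\<i> * complex_of_real \<xi>) * k1 \<xi>)" .
  have "square_integrable (\<lambda>\<xi>. - complex_of_real (\<xi>\<^sup>2 * w \<xi>) * ((\<i> * complex_of_real \<xi>) * fourier q \<xi>))"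
    by (rule square_integrable_mult_bounded[OF d1 _ bd]) measurable
  also have "(\<lambda>\<xi>. - complex_of_real (\<xi>\<^sup>2 * w \<xi>) * ((\<i> * complex_of_real \<xi>) * fourier q \<xi>)) = (\<lambda>\<xi>. (\<i> * complex_of_real \<xi>) * k2 \<xi>)"
    by (simp add: fun_eq_iff k2_def k1_def k0_def power2_eq_square mult_ac ii)
  finally have s3: "square_integrable (\<lambda>\<xi>. (\<i> * complex_of_real \<xi>) * k2 \<xi>)" .
  note D1 = Dx_fourier[OF k0 s1, folded k1_def]
  note D2 = Dx_fourier[OF conjunct1[OF D1] conjunct2[OF D1] s2, folded k2_def]
  note D3 = Dx_fourier[OF conjunct1[OF D2] conjunct2[OF D2] s3]
  have "(\<i> * complex_of_real \<xi>) * k2 \<xi> = - \<i> * complex_of_real \<xi> * complex_of_real (\<xi>\<^sup>2 / (1 + \<alpha>\<^sup>2 * \<xi>\<^sup>2)) * fourier q \<xi>" for \<xi>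
    by (simp add: k2_def k1_def k0_def w_def power2_eq_square mult_ac ii)
  with D3 show ?thesis by simp
qed

text \<open>At \<open>\<alpha> = 0\<close> the symbols are \<open>3/2\<close> and \<open>0\<close>, which is Burgers' equation, so both equations can be treated as one
  family from here on.\<close>

lemma filtered_solution_fourier:
  assumes s: "3 / 2 < s" and \<alpha>: "0 \<le> \<alpha>" and sol: "filtered_solution s T \<alpha> u0 u" and t: "t \<in> {0..T}"
  shows "\<exists>v. has_sobolev_derivative (s - 1) T u v t \<and>
    (AE \<xi> in lborel. fourier v \<xi> = - \<i> * complex_of_real \<xi> *
       (complex_of_real (flux_symbol \<alpha> \<xi>) * fourier (\<lambda>x. (u t x)\<^sup>2) \<xi>
        + complex_of_real (gradient_symbol \<alpha> \<xi>) * fourier (\<lambda>x. (Dx (u t) x)\<^sup>2) \<xi>))"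
proof -
  have u: "u t \<in> sobolev s"
    using sol t by (auto simp: filtered_solution_def burgers_solution_def camassa_holm_solution_def continuous_sobolev_def split: if_splits)
  have s1: "1 \<le> s" "1 / 2 < s - 1" "0 \<le> s - 1" "1 / 2 < s" using s by auto
  note U = sobolevD[OF u]
  note uD = fourier_mult_Dx[OF u s]
  note D = sobolev_Dx[OF u s1(1)]
  have DD: "square_integrable (\<lambda>x. (Dx (u t) x)\<^sup>2)"
    using square_integrable_mult_of_integrable_fourier[OF sobolevD(1)[OF D] integrable_fourier_sobolev[OF D s1(2)] sobolevD(1)[OF D]]
    by (simp add: power2_eq_square)
  show ?thesis
  proof (cases "\<alpha> = 0")
    case True
    with sol have "burgers_solution s T u0 u" by (simp add: filtered_solution_def)
    with t obtain v where v: "has_sobolev_derivative (s - 1) T u v t" "AE x in lborel. v x + 3 * u t x * Dx (u t) x = 0"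
      unfolding burgers_solution_def by blast
    have vm: "v \<in> borel_measurable borel" using v(1) sobolevD(4) by (auto simp: has_sobolev_derivative_def)
    define z where "z x = -3 * (u t x * Dx (u t) x)" for x
    have z: "square_integrable z" unfolding z_def by (rule real_square_integrable_cmult[OF uD(1)])
    have "AE x in lborel. v x = z x" using v(2) by eventually_elim (simp add: z_def)
    from fourier_cong_AE[OF z vm this]
    have "AE \<xi> in lborel. fourier v \<xi> = fourier z \<xi>" by simp
    moreover have "AE \<xi> in lborel. fourier z \<xi> = complex_of_real (-3) * fourier (\<lambda>x. u t x * Dx (u t) x) \<xi>"
      unfolding z_def by (rule fourier_cmult[OF uD(1)])
    ultimately have "AE \<xi> in lborel. fourier v \<xi> = - \<i> * complex_of_real \<xi> *
       (complex_of_real (flux_symbol \<alpha> \<xi>) * fourier (\<lambda>x. (u t x)\<^sup>2) \<xi>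
        + complex_of_real (gradient_symbol \<alpha> \<xi>) * fourier (\<lambda>x. (Dx (u t) x)\<^sup>2) \<xi>)"
      using uD(3) by eventually_elim (simp add: True flux_symbol_def gradient_symbol_def)
    with v(1) show ?thesis by blast
  next
    case False
    with \<alpha> have a: "0 < \<alpha>" by simp
    from False sol have "camassa_holm_solution s T \<alpha> u0 u" by (simp add: filtered_solution_def)
    define X where "X = Dx (Dx (Dx (inv_helmholtz \<alpha> (\<lambda>y. (u t y)\<^sup>2))))"
    define Y where "Y = Dx (inv_helmholtz \<alpha> (\<lambda>y. (Dx (u t) y)\<^sup>2))"
    from \<open>camassa_holm_solution s T \<alpha> u0 u\<close> t obtain v where v: "has_sobolev_derivative (s - 1) T u v t"
      "AE x in lborel. v x + 3 * u t x * Dx (u t) x = - \<alpha>\<^sup>2 * X x - \<alpha>\<^sup>2 / 2 * Y x"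
      unfolding camassa_holm_solution_def X_def Y_def by blast
    have vm: "v \<in> borel_measurable borel" using v(1) sobolevD(4) by (auto simp: has_sobolev_derivative_def)
    have "(\<lambda>y. (u t y)\<^sup>2) \<in> sobolev s"
      using sobolev_product[of s s] s1(4) u by (auto simp: power2_eq_square)
    then have q1: "(\<lambda>y. (u t y)\<^sup>2) \<in> sobolev 1" by (rule sobolev_mono(1)) (rule s1)
    note X = fourier_third_derivative[OF q1 a, folded X_def]
    have p: "0 < 1 + \<alpha>\<^sup>2 * \<xi>\<^sup>2" for \<xi> :: real
      by (intro add_pos_nonneg) auto
    note H = fourier_inv_helmholtz[OF DD, of \<alpha>]
    have "\<bar>\<xi>\<bar> / (1 + \<alpha>\<^sup>2 * \<xi>\<^sup>2) \<le> 1 / \<alpha>" for \<xi>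
    proof -
      have "\<alpha> * \<bar>\<xi>\<bar> \<le> 1 + \<alpha>\<^sup>2 * \<xi>\<^sup>2"
      proof -
        have "0 \<le> \<alpha> * \<bar>\<xi>\<bar>" using a by simp
        moreover have "2 * (\<alpha> * \<bar>\<xi>\<bar>) \<le> 1 + \<alpha>\<^sup>2 * \<xi>\<^sup>2"
          using sum_squares_bound[of 1 "\<alpha> * \<bar>\<xi>\<bar>"] by (simp add: power_mult_distrib)
        ultimately show ?thesis by linarith
      qed
      then show ?thesis using p[of \<xi>] a by (simp add: field_simps)
    qed
    then have bd: "cmod (\<i> * complex_of_real (\<xi> / (1 + \<alpha>\<^sup>2 * \<xi>\<^sup>2))) \<le> 1 / \<alpha>" for \<xi>
      using p[of \<xi>] by (simp add: norm_mult abs_divide del: of_real_divide of_real_add of_real_mult)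
    have "square_integrable (\<lambda>\<xi>. \<i> * complex_of_real (\<xi> / (1 + \<alpha>\<^sup>2 * \<xi>\<^sup>2)) * fourier (\<lambda>x. (Dx (u t) x)\<^sup>2) \<xi>)"
      by (rule square_integrable_mult_bounded[OF square_integrable_fourier[OF DD] _ bd]) measurable
    then have "square_integrable (\<lambda>\<xi>. (\<i> * complex_of_real \<xi>) * (complex_of_real (1 / (1 + \<alpha>\<^sup>2 * \<xi>\<^sup>2)) * fourier (\<lambda>x. (Dx (u t) x)\<^sup>2) \<xi>))"
      by (simp add: mult_ac)
    note Y = Dx_fourier[OF conjunct1[OF H] conjunct2[OF H] this, folded Y_def]
    define z where "z x = (-3 * (u t x * Dx (u t) x) + (- \<alpha>\<^sup>2) * X x) + (- (\<alpha>\<^sup>2 / 2)) * Y x" for x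
    note i1 = real_square_integrable_cmult[OF uD(1), of "-3"]
    note i2 = real_square_integrable_cmult[OF conjunct1[OF X], of "- \<alpha>\<^sup>2"]
    note i3 = real_square_integrable_cmult[OF conjunct1[OF Y], of "- (\<alpha>\<^sup>2 / 2)"]
    note i12 = real_square_integrable_add[OF i1 i2]
    have z: "square_integrable z" unfolding z_def by (rule real_square_integrable_add[OF i12 i3])
    have "AE x in lborel. v x = z x" using v(2) by eventually_elim (simp add: z_def)
    from fourier_cong_AE[OF z vm this]
    have "AE \<xi> in lborel. fourier v \<xi> = fourier z \<xi>" by simp
    then have "AE \<xi> in lborel. fourier v \<xi> = - \<i> * complex_of_real \<xi> *
       (complex_of_real (flux_symbol \<alpha> \<xi>) * fourier (\<lambda>x. (u t x)\<^sup>2) \<xi>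
        + complex_of_real (gradient_symbol \<alpha> \<xi>) * fourier (\<lambda>x. (Dx (u t) x)\<^sup>2) \<xi>)"
      using fourier_add[OF i12 i3, folded z_def] fourier_add[OF i1 i2] fourier_cmult[OF uD(1), of "-3"]
        fourier_cmult[OF conjunct1[OF X], of "- \<alpha>\<^sup>2"] fourier_cmult[OF conjunct1[OF Y], of "- (\<alpha>\<^sup>2 / 2)"]
        conjunct2[OF X] conjunct2[OF Y] uD(3)
    proof eventually_elim
      case (elim \<xi>)
      show ?case
        unfolding elim(1-9) flux_symbol_def gradient_symbol_def
        by (simp add: algebra_simps)
    qed
    with v(1) show ?thesis by blast
  qed
qed

section \<open>Linear functionals along curves in Sobolev spaces\<close>

text \<open>For square-integrable \<open>k\<close> these are bounded functionals on \<open>H\<^sup>\<sigma>\<close>.  Testing with them replaces curves in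
  a function space by real functions of time.\<close>

definition pairing :: "real \<Rightarrow> (real \<Rightarrow> complex) \<Rightarrow> (real \<Rightarrow> real) \<Rightarrow> real"
  where "pairing \<sigma> k U = Re (LINT \<xi>|lborel. k \<xi> * (complex_of_real (bracket \<sigma> \<xi>) * fourier U \<xi>))"

lemma abs_pairing_le:
  assumes "square_integrable k" "U \<in> sobolev \<sigma>"
  shows "\<bar>pairing \<sigma> k U\<bar> \<le> l2norm k * sobolev_norm \<sigma> U"
  unfolding pairing_def sobolev_norm_eq
  using norm_integral_mult_le[OF assms(1) sobolevD(2)[OF assms(2)]] abs_Re_le_cmod order_trans by blast

lemma pairing_cong:
  assumes "square_integrable k" "U \<in> sobolev \<sigma>" "V \<in> sobolev \<sigma>"
    "AE \<xi> in lborel. fourier U \<xi> = fourier V \<xi>"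
  shows "pairing \<sigma> k U = pairing \<sigma> k V"
proof -
  note [measurable] = sqint_measurable[OF assms(1)] sobolevD(3)[OF assms(2)] sobolevD(3)[OF assms(3)]
  show ?thesis
    unfolding pairing_def using assms(4)
    by (intro arg_cong[where f=Re] integral_cong_AE) auto
qed

lemma pairing_diff:
  assumes k: "square_integrable k" and U: "U \<in> sobolev \<sigma>" and V: "V \<in> sobolev \<sigma>"
  shows "pairing \<sigma> k (\<lambda>x. U x - V x) = pairing \<sigma> k U - pairing \<sigma> k V"
proof -
  note [measurable] = sqint_measurable[OF k] sobolevD(3)[OF U] sobolevD(3)[OF V] sobolevD(3)[OF sobolev_diff[OF U V]]
  have "(LINT \<xi>|lborel. k \<xi> * (complex_of_real (bracket \<sigma> \<xi>) * fourier (\<lambda>x. U x - V x) \<xi>))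
    = (LINT \<xi>|lborel. k \<xi> * (complex_of_real (bracket \<sigma> \<xi>) * fourier U \<xi>) - k \<xi> * (complex_of_real (bracket \<sigma> \<xi>) * fourier V \<xi>))"
  proof (rule integral_cong_AE)
    show "AE \<xi> in lborel. k \<xi> * (complex_of_real (bracket \<sigma> \<xi>) * fourier (\<lambda>x. U x - V x) \<xi>)
      = k \<xi> * (complex_of_real (bracket \<sigma> \<xi>) * fourier U \<xi>) - k \<xi> * (complex_of_real (bracket \<sigma> \<xi>) * fourier V \<xi>)"
      using fourier_diff[OF sobolevD(1)[OF U] sobolevD(1)[OF V]]
      by eventually_elim (simp add: right_diff_distrib)
  qed measurable
  also have "\<dots> = (LINT \<xi>|lborel. k \<xi> * (complex_of_real (bracket \<sigma> \<xi>) * fourier U \<xi>)) - (LINT \<xi>|lborel. k \<xi> * (complex_of_real (bracket \<sigma> \<xi>) * fourier V \<xi>))"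
    by (intro Bochner_Integration.integral_diff integrable_mult_sqint k sobolevD(2) U V)
  finally show ?thesis by (simp add: pairing_def)
qed

lemma pairing_cmult:
  assumes k: "square_integrable k" and U: "U \<in> sobolev \<sigma>"
  shows "pairing \<sigma> k (\<lambda>x. c * U x) = c * pairing \<sigma> k U"
proof -
  note [measurable] = sqint_measurable[OF k] sobolevD(3)[OF U] sobolevD(3)[OF sobolev_cmult[OF U, of c]]
  have "(LINT \<xi>|lborel. k \<xi> * (complex_of_real (bracket \<sigma> \<xi>) * fourier (\<lambda>x. c * U x) \<xi>))
    = (LINT \<xi>|lborel. complex_of_real c * (k \<xi> * (complex_of_real (bracket \<sigma> \<xi>) * fourier U \<xi>)))"
  proof (rule integral_cong_AE)
    show "AE \<xi> in lborel. k \<xi> * (complex_of_real (bracket \<sigma> \<xi>) * fourier (\<lambda>x. c * U x) \<xi>)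
      = complex_of_real c * (k \<xi> * (complex_of_real (bracket \<sigma> \<xi>) * fourier U \<xi>))"
      using fourier_cmult[OF sobolevD(1)[OF U], of c]
      by eventually_elim (simp add: mult_ac)
  qed measurable
  also have "\<dots> = complex_of_real c * (LINT \<xi>|lborel. k \<xi> * (complex_of_real (bracket \<sigma> \<xi>) * fourier U \<xi>))"
    by (rule integral_mult_right_zero)
  finally show ?thesis by (simp add: pairing_def)
qed

lemma pairing_has_derivative:
  assumes k: "square_integrable k" and u: "\<And>\<tau>. \<tau> \<in> {0..T} \<Longrightarrow> u \<tau> \<in> sobolev \<sigma>"
    and v: "has_sobolev_derivative \<sigma> T u v t" and t: "t \<in> {0..T}"
  shows "((\<lambda>\<tau>. pairing \<sigma> k (u \<tau>)) has_real_derivative pairing \<sigma> k v) (at t within {0..T})"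
proof -
  have vs: "v \<in> sobolev \<sigma>" and lim: "((\<lambda>\<tau>. sobolev_norm \<sigma> (\<lambda>x. (u \<tau> x - u t x) / (\<tau> - t) - v x)) \<longlongrightarrow> 0) (at t within {0..T})"
    using v by (auto simp: has_sobolev_derivative_def)
  have "((\<lambda>\<tau>. (pairing \<sigma> k (u \<tau>) - pairing \<sigma> k (u t)) / (\<tau> - t) - pairing \<sigma> k v) \<longlongrightarrow> 0) (at t within {0..T})"
  proof (rule Lim_null_comparison)
    show "((\<lambda>\<tau>. l2norm k * sobolev_norm \<sigma> (\<lambda>x. (u \<tau> x - u t x) / (\<tau> - t) - v x)) \<longlongrightarrow> 0) (at t within {0..T})"
      by (rule tendsto_mult_right_zero[OF lim])
    have "\<forall>\<^sub>F \<tau> in at t within {0..T}. \<tau> \<in> {0..T}"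
      by (simp add: eventually_at_filter)
    then show "\<forall>\<^sub>F \<tau> in at t within {0..T}. norm ((pairing \<sigma> k (u \<tau>) - pairing \<sigma> k (u t)) / (\<tau> - t) - pairing \<sigma> k v)
        \<le> l2norm k * sobolev_norm \<sigma> (\<lambda>x. (u \<tau> x - u t x) / (\<tau> - t) - v x)"
    proof eventually_elim
      case (elim \<tau>)
      have d: "(\<lambda>x. u \<tau> x - u t x) \<in> sobolev \<sigma>" by (intro sobolev_diff u elim t)
      have dq: "(\<lambda>x. (1 / (\<tau> - t)) * (u \<tau> x - u t x)) \<in> sobolev \<sigma>" by (rule sobolev_cmult[OF d])
      have "pairing \<sigma> k (\<lambda>x. (1 / (\<tau> - t)) * (u \<tau> x - u t x) - v x)
          = (1 / (\<tau> - t)) * (pairing \<sigma> k (u \<tau>) - pairing \<sigma> k (u t)) - pairing \<sigma> k v"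
        using pairing_diff[OF k dq vs] pairing_cmult[OF k d, of "1 / (\<tau> - t)"] pairing_diff[OF k u[OF elim] u[OF t]] by simp
      then show ?case
        using abs_pairing_le[OF k sobolev_diff[OF dq vs]] by simp
    qed
  qed
  then show ?thesis
    unfolding has_field_derivative_iff using Lim_null by blast
qed

lemma real_MVT_within:
  fixes \<phi> :: "real \<Rightarrow> real"
  assumes d: "\<And>t. t \<in> {0..T} \<Longrightarrow> (\<phi> has_real_derivative \<phi>' t) (at t within {0..T})" and t: "0 < t" "t \<le> T"
  shows "\<exists>x\<in>{0<..<t}. \<phi> t - \<phi> 0 = \<phi>' x * t"
proof -
  have "\<exists>x\<in>{0<..<t}. \<phi> t - \<phi> 0 = (*) (\<phi>' x) (t - 0)"
  proof (rule mvt_simple[OF t(1)])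
    fix x assume x: "0 \<le> x" "x \<le> t"
    have "(\<phi> has_real_derivative \<phi>' x) (at x within {0..t})"
      by (rule DERIV_subset[OF d]) (use x t in auto)
    then show "(\<phi> has_derivative (*) (\<phi>' x)) (at x within {0..t})"
      by (simp add: has_field_derivative_def)
  qed
  then show ?thesis by simp
qed

text \<open>Testing the increment against itself reduces the mean value inequality in \<open>H\<^sup>\<sigma>\<close> to the scalar mean value
  theorem.\<close>

lemma sobolev_increment_le:
  assumes u: "\<And>\<tau>. \<tau> \<in> {0..T} \<Longrightarrow> u \<tau> \<in> sobolev \<sigma>"
    and v: "\<And>t. t \<in> {0..T} \<Longrightarrow> has_sobolev_derivative \<sigma> T u (v t) t"
    and M: "\<And>t. t \<in> {0..T} \<Longrightarrow> sobolev_norm \<sigma> (v t) \<le> M" and t: "t \<in> {0..T}"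
  shows "sobolev_norm \<sigma> (\<lambda>x. u t x - u 0 x) \<le> M * t"
proof (cases "t = 0 \<or> sobolev_norm \<sigma> (\<lambda>x. u t x - u 0 x) = 0")
  case True
  moreover have "0 \<le> M" using M[OF t] sobolev_norm_nonneg order_trans by blast
  moreover have "sobolev_norm \<sigma> (\<lambda>x. 0) \<le> \<bar>0\<bar> * sobolev_norm \<sigma> (u t)"
    using sobolev_norm_cmult[OF u[OF t], of 0] by simp
  ultimately show ?thesis using t by auto
next
  case False
  have t0: "0 < t" "t \<le> T" "0 \<in> {0..T}" using False t by auto
  define W where "W x = u t x - u 0 x" for x
  have W: "W \<in> sobolev \<sigma>" unfolding W_def by (rule sobolev_diff[OF u[OF t] u[OF t0(3)]])
  define w where "w = sobolev_norm \<sigma> W"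
  have w: "0 < w" using False sobolev_norm_nonneg[of \<sigma> W] by (simp add: w_def W_def[abs_def] less_le)
  define k where "k \<xi> = cnj (complex_of_real (bracket \<sigma> \<xi>) * fourier W \<xi>)" for \<xi>
  have k: "square_integrable k" unfolding k_def by (rule square_integrable_cnj[OF sobolevD(2)[OF W]])
  have lk: "l2norm k = w" unfolding k_def w_def sobolev_norm_eq by (rule l2norm_cnj)
  obtain x where x: "x \<in> {0<..<t}" "pairing \<sigma> k (u t) - pairing \<sigma> k (u 0) = pairing \<sigma> k (v x) * t"
    using real_MVT_within[OF pairing_has_derivative[OF k u v] t0(1,2)] by auto
  have xT: "x \<in> {0..T}" using x(1) t0 by auto
  have vx: "v x \<in> sobolev \<sigma>" using v[OF xT] by (simp add: has_sobolev_derivative_def)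
  have "k \<xi> * (complex_of_real (bracket \<sigma> \<xi>) * fourier W \<xi>)
      = complex_of_real ((cmod (complex_of_real (bracket \<sigma> \<xi>) * fourier W \<xi>))\<^sup>2)" for \<xi>
    unfolding k_def complex_norm_square by (rule mult.commute)
  then have "pairing \<sigma> k W = w\<^sup>2"
    unfolding pairing_def w_def sobolev_norm_eq l2norm_sq
    by (simp only: integral_complex_of_real Re_complex_of_real)
  then have "w\<^sup>2 = pairing \<sigma> k (v x) * t"
    using x(2) pairing_diff[OF k u[OF t] u[OF t0(3)]] by (simp add: W_def[abs_def])
  also have "\<dots> \<le> (w * M) * t"
  proof (rule mult_right_mono)
    have "pairing \<sigma> k (v x) \<le> w * sobolev_norm \<sigma> (v x)"
      using abs_pairing_le[OF k vx] lk by simp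
    also have "\<dots> \<le> w * M" using w M[OF xT] by (intro mult_left_mono) auto
    finally show "pairing \<sigma> k (v x) \<le> w * M" .
  qed (use t0 in simp)
  finally have "w * w \<le> w * (M * t)" by (simp add: power2_eq_square mult.assoc)
  with w have "w \<le> M * t" by simp
  then show ?thesis by (simp add: w_def W_def[abs_def])
qed

section \<open>The essential supremum in time\<close>

lemma AE_lborel_ex:
  assumes "AE x in lborel. P (x :: real)" "a < b"
  shows "\<exists>x\<in>{a<..<b}. P x"
proof (rule ccontr)
  assume "\<not> ?thesis"
  then have "AE x in lborel. x \<notin> {a<..<b}"
    using assms(1) by (auto elim!: eventually_mono)
  then have "emeasure lborel {a<..<b} = 0"
    by (subst (asm) AE_iff_measurable[of "{a<..<b}"]) auto
  with assms(2) show False by simp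
qed

lemma Linf_sobolev_norm_AE:
  assumes "Linf_sobolev_norm \<gamma> T u \<le> ennreal B" "0 \<le> B"
  shows "AE t in lborel. t \<in> {0<..<T} \<longrightarrow> sobolev_norm \<gamma> (u t) \<le> B"
proof -
  have le: "esssup (restrict_space lborel {0<..<T}) (\<lambda>t. ennreal (sobolev_norm \<gamma> (u t))) \<le> ennreal B"
    using assms by (auto simp: Linf_sobolev_norm_def top_unique split: if_splits)
  have "AE t in restrict_space lborel {0<..<T}. sobolev_norm \<gamma> (u t) \<le> B"
    using esssup_AE[of "\<lambda>t. ennreal (sobolev_norm \<gamma> (u t))" "restrict_space lborel {0<..<T}"]
  proof eventually_elim
    case (elim t)
    from order_trans[OF this le] show ?case using assms(2) by simp
  qed
  then show ?thesis by (subst (asm) AE_restrict_space_iff) auto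
qed

text \<open>If the bound failed at \<open>t\<close>, continuity would make it fail on an interval with endpoint \<open>t\<close>, which has
  positive measure.\<close>

lemma Linf_sobolev_norm_bound:
  assumes c: "continuous_sobolev s T u" and \<gamma>: "\<gamma> \<le> s" and T: "0 < T"
    and le: "Linf_sobolev_norm \<gamma> T u \<le> ennreal B" and B: "0 \<le> B" and t: "t \<in> {0..T}"
  shows "sobolev_norm \<gamma> (u t) \<le> B"
proof (rule ccontr)
  assume "\<not> ?thesis"
  then have d: "0 < sobolev_norm \<gamma> (u t) - B" by simp
  have us: "\<And>\<tau>. \<tau> \<in> {0..T} \<Longrightarrow> u \<tau> \<in> sobolev s"
    and lim: "((\<lambda>\<tau>. sobolev_norm s (\<lambda>x. u \<tau> x - u t x)) \<longlongrightarrow> 0) (at t within {0..T})"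
    using c t by (auto simp: continuous_sobolev_def)
  from order_tendstoD(2)[OF lim d] obtain \<epsilon> where \<epsilon>: "0 < \<epsilon>"
    and near: "\<And>\<tau>. \<tau> \<in> {0..T} \<Longrightarrow> \<tau> \<noteq> t \<Longrightarrow> dist \<tau> t < \<epsilon> \<Longrightarrow> sobolev_norm s (\<lambda>x. u \<tau> x - u t x) < sobolev_norm \<gamma> (u t) - B"
    by (auto simp: eventually_at)
  have big: "B < sobolev_norm \<gamma> (u \<tau>)" if \<tau>: "\<tau> \<in> {0..T}" "\<tau> \<noteq> t" "dist \<tau> t < \<epsilon>" for \<tau>
  proof -
    have ut: "u t \<in> sobolev \<gamma>" "u \<tau> \<in> sobolev \<gamma>" using sobolev_mono(1)[OF us \<gamma>] t \<tau> by auto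
    have "sobolev_norm \<gamma> (u t) = sobolev_norm \<gamma> (\<lambda>x. u \<tau> x - (u \<tau> x - u t x))" by simp
    also have "\<dots> \<le> sobolev_norm \<gamma> (u \<tau>) + sobolev_norm \<gamma> (\<lambda>x. u \<tau> x - u t x)"
      by (rule sobolev_norm_diff_le[OF ut(2) sobolev_diff[OF ut(2,1)]])
    also have "sobolev_norm \<gamma> (\<lambda>x. u \<tau> x - u t x) \<le> sobolev_norm s (\<lambda>x. u \<tau> x - u t x)"
      by (rule sobolev_mono(2)[OF sobolev_diff[OF us[OF \<tau>(1)] us[OF t]] \<gamma>])
    finally show ?thesis using near[OF \<tau>] by simp
  qed
  note ae = Linf_sobolev_norm_AE[OF le B]
  show False
  proof (cases "t < T")
    case True
    obtain \<tau> where "\<tau> \<in> {t<..<min T (t + \<epsilon>)}" "\<tau> \<in> {0<..<T} \<longrightarrow> sobolev_norm \<gamma> (u \<tau>) \<le> B"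
      using AE_lborel_ex[OF ae, of t "min T (t + \<epsilon>)"] True \<epsilon> by auto
    then show False using big[of \<tau>] t by (auto simp: dist_real_def)
  next
    case False
    with t have "t = T" by simp
    obtain \<tau> where "\<tau> \<in> {max 0 (T - \<epsilon>)<..<T}" "\<tau> \<in> {0<..<T} \<longrightarrow> sobolev_norm \<gamma> (u \<tau>) \<le> B"
      using AE_lborel_ex[OF ae, of "max 0 (T - \<epsilon>)" T] T \<epsilon> by auto
    then show False using big[of \<tau>] \<open>t = T\<close> by (auto simp: dist_real_def)
  qed
qed

lemma Linf_sobolev_norm_ge:
  assumes ab: "0 \<le> a" "a < b" "b \<le> T" and ge: "\<And>t. a < t \<Longrightarrow> t < b \<Longrightarrow> c \<le> sobolev_norm s (U t)"
  shows "ennreal c \<le> Linf_sobolev_norm s T U"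
proof (cases "AE t in restrict_space lborel {0<..<T}. U t \<in> sobolev s")
  case True
  define E where "E = esssup (restrict_space lborel {0<..<T}) (\<lambda>t. ennreal (sobolev_norm s (U t)))"
  have "AE t in restrict_space lborel {0<..<T}. ennreal (sobolev_norm s (U t)) \<le> E"
    unfolding E_def by (rule esssup_AE)
  then have "AE t in lborel. t \<in> {0<..<T} \<longrightarrow> ennreal (sobolev_norm s (U t)) \<le> E"
    by (subst (asm) AE_restrict_space_iff) auto
  from AE_lborel_ex[OF this ab(2)] obtain t where t: "t \<in> {a<..<b}" "t \<in> {0<..<T} \<longrightarrow> ennreal (sobolev_norm s (U t)) \<le> E" by blast
  then have "ennreal c \<le> ennreal (sobolev_norm s (U t))" using ge by (intro ennreal_leI) auto
  also have "\<dots> \<le> E" using t ab by auto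
  finally show ?thesis using True by (simp add: Linf_sobolev_norm_def E_def)
qed (simp add: Linf_sobolev_norm_def)

section \<open>The time derivative\<close>

lemma symbol_denominator_pos: "0 < 1 + \<alpha>\<^sup>2 * (\<xi>::real)\<^sup>2"
  by (intro add_pos_nonneg) auto

lemma damping_bounds:
  "0 \<le> \<alpha>\<^sup>2 * \<xi>\<^sup>2 / (1 + \<alpha>\<^sup>2 * (\<xi>::real)\<^sup>2)" "\<alpha>\<^sup>2 * \<xi>\<^sup>2 / (1 + \<alpha>\<^sup>2 * \<xi>\<^sup>2) \<le> 1"
  using symbol_denominator_pos[of \<alpha> \<xi>] by (simp_all add: divide_le_eq)

lemma flux_symbol_bounds: "0 \<le> flux_symbol \<alpha> \<xi>" "flux_symbol \<alpha> \<xi> \<le> 3 / 2"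
  using damping_bounds[of \<alpha> \<xi>] unfolding flux_symbol_def by linarith+

lemma gradient_symbol_bounds: "0 \<le> gradient_symbol \<alpha> \<xi>" "gradient_symbol \<alpha> \<xi> \<le> \<alpha>\<^sup>2 / 2"
proof -
  show "0 \<le> gradient_symbol \<alpha> \<xi>"
    using symbol_denominator_pos[of \<alpha> \<xi>] by (simp add: gradient_symbol_def)
  have "\<alpha>\<^sup>2 / 2 * 1 \<le> \<alpha>\<^sup>2 / 2 * (1 + \<alpha>\<^sup>2 * \<xi>\<^sup>2)"
    by (rule mult_left_mono) auto
  then show "gradient_symbol \<alpha> \<xi> \<le> \<alpha>\<^sup>2 / 2"
    unfolding gradient_symbol_def by (subst pos_divide_le_eq[OF symbol_denominator_pos]) simp
qed

lemma abs_mult_gradient_symbol_le: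
  assumes "0 \<le> \<alpha>"
  shows "\<bar>\<xi>\<bar> * gradient_symbol \<alpha> \<xi> \<le> \<alpha>"
proof -
  have n: "0 \<le> \<alpha> * \<bar>\<xi>\<bar>" using assms by simp
  have "2 * (\<alpha> * \<bar>\<xi>\<bar>) \<le> 1 + \<alpha>\<^sup>2 * \<xi>\<^sup>2"
    using sum_squares_bound[of 1 "\<alpha> * \<bar>\<xi>\<bar>"] by (simp add: power_mult_distrib)
  with n have "\<alpha> * \<bar>\<xi>\<bar> / (1 + \<alpha>\<^sup>2 * \<xi>\<^sup>2) \<le> 1"
    using symbol_denominator_pos[of \<alpha> \<xi>] by (simp add: divide_le_eq)
  moreover have "0 \<le> \<alpha> * \<bar>\<xi>\<bar> / (1 + \<alpha>\<^sup>2 * \<xi>\<^sup>2)"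
    using n symbol_denominator_pos[of \<alpha> \<xi>] by (intro divide_nonneg_nonneg) auto
  ultimately have "\<alpha> / 2 * (\<alpha> * \<bar>\<xi>\<bar> / (1 + \<alpha>\<^sup>2 * \<xi>\<^sup>2)) \<le> \<alpha> * 1"
    using assms by (intro mult_mono) auto
  moreover have "\<bar>\<xi>\<bar> * gradient_symbol \<alpha> \<xi> = \<alpha> / 2 * (\<alpha> * \<bar>\<xi>\<bar> / (1 + \<alpha>\<^sup>2 * \<xi>\<^sup>2))"
    by (simp add: gradient_symbol_def power2_eq_square)
  ultimately show ?thesis by simp
qed

text \<open>The transformed equation at one time: \<open>w\<close> is the state and \<open>v\<close> its time derivative.\<close>

definition evolves :: "real \<Rightarrow> (real \<Rightarrow> real) \<Rightarrow> (real \<Rightarrow> real) \<Rightarrow> bool"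
  where "evolves \<alpha> w v \<longleftrightarrow> (AE \<xi> in lborel. fourier v \<xi> = - \<i> * complex_of_real \<xi> *
       (complex_of_real (flux_symbol \<alpha> \<xi>) * fourier (\<lambda>x. (w x)\<^sup>2) \<xi>
        + complex_of_real (gradient_symbol \<alpha> \<xi>) * fourier (\<lambda>x. (Dx w x)\<^sup>2) \<xi>))"

lemma sobolev_product_algebra:
  assumes "1 / 2 < \<sigma>"
  shows "\<exists>C\<ge>0. \<forall>f g. f \<in> sobolev \<sigma> \<longrightarrow> g \<in> sobolev \<sigma> \<longrightarrow> (\<lambda>x. f x * g x) \<in> sobolev \<sigma> \<and>
     sobolev_norm \<sigma> (\<lambda>x. f x * g x) \<le> C * sobolev_norm \<sigma> f * sobolev_norm \<sigma> g"
proof -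
  obtain C where C: "C \<ge> 0" "\<And>f g. f \<in> sobolev \<sigma> \<Longrightarrow> g \<in> sobolev \<sigma> \<Longrightarrow> (\<lambda>x. f x * g x) \<in> sobolev \<sigma> \<and>
     sobolev_norm \<sigma> (\<lambda>x. f x * g x) \<le> C * (sobolev_norm \<sigma> f * sobolev_norm \<sigma> g + sobolev_norm \<sigma> f * sobolev_norm \<sigma> g)"
    using sobolev_product[OF assms order_refl] by blast
  show ?thesis
  proof (intro exI[of _ "2 * C"] conjI allI impI)
    fix f g assume "f \<in> sobolev \<sigma>" "g \<in> sobolev \<sigma>"
    from C(2)[OF this] show "(\<lambda>x. f x * g x) \<in> sobolev \<sigma>"
      "sobolev_norm \<sigma> (\<lambda>x. f x * g x) \<le> 2 * C * sobolev_norm \<sigma> f * sobolev_norm \<sigma> g"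
      by (auto simp: algebra_simps)
  qed (use C in simp)
qed

text \<open>The derivative outside the flux raises the order of the \<open>u\<^sup>2\<close> term by one, which the product estimate pays
  for with a single high norm; on the gradient term it is absorbed by the inverse Helmholtz operator, leaving
  a factor \<open>\<alpha>\<close>.  For data at frequency \<open>N = 1 / \<alpha>\<close> both contributions are of size \<open>1 / N\<close>.\<close>

lemma evolves_bound:
  assumes s: "3 / 2 < s"
  shows "\<exists>C\<ge>0. \<forall>\<alpha> w v. 0 \<le> \<alpha> \<longrightarrow> w \<in> sobolev s \<longrightarrow> v \<in> sobolev (s - 1) \<longrightarrow> evolves \<alpha> w v \<longrightarrow>
    sobolev_norm (s - 1) v \<le> C * (sobolev_norm s w * sobolev_norm (s - 1) w + \<alpha> * (sobolev_norm s w)\<^sup>2)"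
proof -
  have s1: "1 / 2 < s - 1" "s - 1 \<le> s" "1 \<le> s" using s by auto
  obtain C where C: "C \<ge> 0" "\<And>f g. f \<in> sobolev s \<Longrightarrow> g \<in> sobolev s \<Longrightarrow> (\<lambda>x. f x * g x) \<in> sobolev s \<and>
     sobolev_norm s (\<lambda>x. f x * g x) \<le> C * (sobolev_norm s f * sobolev_norm (s - 1) g + sobolev_norm (s - 1) f * sobolev_norm s g)"
    using sobolev_product[OF s1(1,2)] by blast
  obtain D where D: "D \<ge> 0" "\<And>f g. f \<in> sobolev (s - 1) \<Longrightarrow> g \<in> sobolev (s - 1) \<Longrightarrow> (\<lambda>x. f x * g x) \<in> sobolev (s - 1) \<and>
     sobolev_norm (s - 1) (\<lambda>x. f x * g x) \<le> D * sobolev_norm (s - 1) f * sobolev_norm (s - 1) g"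
    using sobolev_product_algebra[OF s1(1)] by blast
  have "sobolev_norm (s - 1) v \<le> (3 * C + D) * (sobolev_norm s w * sobolev_norm (s - 1) w + \<alpha> * (sobolev_norm s w)\<^sup>2)"
    if \<alpha>: "0 \<le> \<alpha>" and w: "w \<in> sobolev s" and v: "v \<in> sobolev (s - 1)" and ev: "evolves \<alpha> w v" for \<alpha> w v
  proof -
    define q where "q x = (w x)\<^sup>2" for x
    define p where "p x = (Dx w x)\<^sup>2" for x
    have q: "q \<in> sobolev s" "sobolev_norm s q \<le> 2 * C * (sobolev_norm s w * sobolev_norm (s - 1) w)"
      using C(2)[OF w w] by (auto simp: q_def[abs_def] power2_eq_square algebra_simps)
    note Dw = sobolev_Dx[OF w s1(3)]
    have p: "p \<in> sobolev (s - 1)" using D(2)[OF Dw Dw] by (auto simp: p_def[abs_def] power2_eq_square)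
    have "sobolev_norm (s - 1) p \<le> D * sobolev_norm (s - 1) (Dx w) * sobolev_norm (s - 1) (Dx w)"
      using D(2)[OF Dw Dw] by (auto simp: p_def[abs_def] power2_eq_square)
    also have "\<dots> \<le> D * sobolev_norm s w * sobolev_norm s w"
      using sobolev_norm_Dx[OF w s1(3)] D(1) by (intro mult_mono mult_nonneg_nonneg) auto
    finally have pn: "sobolev_norm (s - 1) p \<le> D * (sobolev_norm s w)\<^sup>2" by (simp add: power2_eq_square mult.assoc)
    define X where "X \<xi> = complex_of_real (cmod (complex_of_real (bracket s \<xi>) * fourier q \<xi>))" for \<xi>
    define Y where "Y \<xi> = complex_of_real (cmod (complex_of_real (bracket (s - 1) \<xi>) * fourier p \<xi>))" for \<xi>
    note [measurable] = sobolevD(3)[OF q(1)] sobolevD(3)[OF p] sobolevD(3)[OF v]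
    have X: "square_integrable X" "l2norm X = sobolev_norm s q"
      unfolding X_def sobolev_norm_eq
      using square_integrableI_bound[OF _ sobolevD(2)[OF q(1)], of "\<lambda>\<xi>. complex_of_real (cmod (complex_of_real (bracket s \<xi>) * fourier q \<xi>))" 1]
      by (auto simp: l2norm_def)
    have Y: "square_integrable Y" "l2norm Y = sobolev_norm (s - 1) p"
      unfolding Y_def sobolev_norm_eq
      using square_integrableI_bound[OF _ sobolevD(2)[OF p(1)], of "\<lambda>\<xi>. complex_of_real (cmod (complex_of_real (bracket (s - 1) \<xi>) * fourier p \<xi>))" 1]
      by (auto simp: l2norm_def)
    define c where "c = complex_of_real (3 / 2)"
    define d where "d = complex_of_real \<alpha>"
    have sq: "square_integrable (\<lambda>\<xi>. c * X \<xi> + d * Y \<xi>)"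
      by (intro square_integrable_add square_integrable_cmult X Y)
    have "AE \<xi> in lborel. cmod (complex_of_real (bracket (s - 1) \<xi>) * fourier v \<xi>) \<le> 1 * cmod (c * X \<xi> + d * Y \<xi>)"
      using ev unfolding evolves_def q_def[symmetric] p_def[symmetric]
    proof eventually_elim
      case (elim \<xi>)
      have j: "bracket (s - 1) \<xi> * \<bar>\<xi>\<bar> \<le> bracket s \<xi>"
        using mult_left_mono[OF bracket_one[of \<xi>], of "bracket (s - 1) \<xi>"] by (simp flip: bracket_add)
      have "cmod (complex_of_real (bracket (s - 1) \<xi>) * fourier v \<xi>)
        \<le> (bracket (s - 1) \<xi> * \<bar>\<xi>\<bar>) * cmod (complex_of_real (flux_symbol \<alpha> \<xi>) * fourier q \<xi> + complex_of_real (gradient_symbol \<alpha> \<xi>) * fourier p \<xi>)"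
        unfolding elim by (simp add: norm_mult)
      also have "\<dots> \<le> (bracket (s - 1) \<xi> * \<bar>\<xi>\<bar>) * (cmod (complex_of_real (flux_symbol \<alpha> \<xi>) * fourier q \<xi>) + cmod (complex_of_real (gradient_symbol \<alpha> \<xi>) * fourier p \<xi>))"
        by (intro mult_left_mono norm_triangle_ineq) auto
      also have "\<dots> = (bracket (s - 1) \<xi> * \<bar>\<xi>\<bar>) * flux_symbol \<alpha> \<xi> * cmod (fourier q \<xi>) + (\<bar>\<xi>\<bar> * gradient_symbol \<alpha> \<xi>) * (bracket (s - 1) \<xi> * cmod (fourier p \<xi>))"
        using flux_symbol_bounds(1)[of \<alpha> \<xi>] gradient_symbol_bounds(1)[of \<alpha> \<xi>] by (simp add: norm_mult algebra_simps)
      also have "\<dots> \<le> bracket s \<xi> * (3 / 2) * cmod (fourier q \<xi>) + \<alpha> * (bracket (s - 1) \<xi> * cmod (fourier p \<xi>))"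
        using j flux_symbol_bounds[of \<alpha> \<xi>] abs_mult_gradient_symbol_le[OF \<alpha>, of \<xi>]
        by (intro add_mono mult_right_mono mult_mono) auto
      also have "\<dots> = Re (c * X \<xi> + d * Y \<xi>)"
        by (simp add: c_def d_def X_def Y_def norm_mult)
      also have "\<dots> \<le> 1 * cmod (c * X \<xi> + d * Y \<xi>)"
        using complex_Re_le_cmod[of "c * X \<xi> + d * Y \<xi>"] by (simp only: mult_1)
      finally show ?case .
    qed
    then have "sobolev_norm (s - 1) v \<le> 1 * l2norm (\<lambda>\<xi>. c * X \<xi> + d * Y \<xi>)"
      unfolding sobolev_norm_eq by (intro l2norm_mono sq) auto
    also have "\<dots> \<le> 3 / 2 * l2norm X + \<alpha> * l2norm Y"
      using l2norm_triangle[OF square_integrable_cmult[OF X(1), of c] square_integrable_cmult[OF Y(1), of d]] \<alpha>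
      unfolding l2norm_cmult by (simp add: c_def d_def)
    also have "\<dots> \<le> 3 / 2 * (2 * C * (sobolev_norm s w * sobolev_norm (s - 1) w)) + \<alpha> * (D * (sobolev_norm s w)\<^sup>2)"
      unfolding X(2) Y(2) using q(2) pn \<alpha> by (intro add_mono mult_left_mono) auto
    also have "\<dots> = 3 * C * (sobolev_norm s w * sobolev_norm (s - 1) w) + D * (\<alpha> * (sobolev_norm s w)\<^sup>2)"
      by (simp add: algebra_simps)
    also have "\<dots> \<le> (3 * C + D) * (sobolev_norm s w * sobolev_norm (s - 1) w) + (3 * C + D) * (\<alpha> * (sobolev_norm s w)\<^sup>2)"
      using C(1) D(1) \<alpha> by (intro add_mono mult_right_mono) auto
    finally show ?thesis by (simp add: distrib_left)
  qed
  then show ?thesis using C(1) D(1) by (intro exI[of _ "3 * C + D"]) auto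
qed

section \<open>A frequency band\<close>

definition band :: "real \<Rightarrow> real set"
  where "band N = {N - 1..N + 1}"

text \<open>The imaginary part is the relevant one: transforms of the data are real, and the flux enters the
  time derivative with the factor \<open>- i \<xi>\<close>.\<close>

definition band_mass :: "real \<Rightarrow> (real \<Rightarrow> real) \<Rightarrow> real"
  where "band_mass N U = (LINT \<xi>|lborel. indicator (band N) \<xi> * Im (fourier U \<xi>))"

lemma band_measurable [measurable]: "band N \<in> sets borel"
  by (simp add: band_def)

lemma l2norm_band: "l2norm (indicator (band N)) = sqrt 2"
proof -
  have "(\<lambda>x. (cmod (indicator (band N) x))\<^sup>2) = (indicator (band N) :: real \<Rightarrow> real)"
    by (auto simp: indicator_def)
  then show ?thesis by (simp add: l2norm_def band_def)
qed

lemma square_integrable_band: "square_integrable (indicator (band N) :: real \<Rightarrow> complex)"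
  by (rule square_integrable_indicator) (auto simp: band_def)

lemma bracket_band_ge:
  assumes N: "2 \<le> N" and \<xi>: "\<xi> \<in> band N" and r: "0 \<le> r"
  shows "(N / 2) powr r \<le> bracket r \<xi>"
proof -
  have \<xi>0: "N / 2 \<le> \<xi>" "0 \<le> \<xi>" using assms by (auto simp: band_def)
  have "(N / 2) powr r \<le> \<xi> powr r" using N \<xi>0 r by (intro powr_mono2) auto
  also have "\<dots> = (\<xi>\<^sup>2) powr (r / 2)"
    using \<xi>0 by (simp add: powr_powr flip: powr_numeral)
  also have "\<dots> \<le> bracket r \<xi>" unfolding bracket_def using r by (intro powr_mono2) auto
  finally show ?thesis .
qed

lemma
  fixes m :: "real \<Rightarrow> complex"
  assumes N: "2 \<le> N" and r: "0 \<le> r" and [measurable]: "m \<in> borel_measurable borel" and m: "\<And>\<xi>. \<xi> \<in> band N \<Longrightarrow> cmod (m \<xi>) \<le> B" and B: "0 \<le> B"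
  shows square_integrable_band_weight: "square_integrable (\<lambda>\<xi>. indicator (band N) \<xi> * m \<xi> / complex_of_real (bracket r \<xi>))"
    and l2norm_band_weight: "l2norm (\<lambda>\<xi>. indicator (band N) \<xi> * m \<xi> / complex_of_real (bracket r \<xi>)) \<le> B * (N / 2) powr (- r) * sqrt 2"
proof -
  have "cmod (indicator (band N) \<xi> * m \<xi> / complex_of_real (bracket r \<xi>)) \<le> B * (N / 2) powr (- r) * cmod (indicator (band N) \<xi>)" for \<xi>
  proof (cases "\<xi> \<in> band N")
    case True
    have "cmod (m \<xi>) / bracket r \<xi> \<le> B / (N / 2) powr r"
      using m[OF True] bracket_band_ge[OF N True r] B N by (intro frac_le) auto
    also have "\<dots> = B * (N / 2) powr (- r)" by (simp only: powr_minus_divide) simp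
    finally show ?thesis using True by (simp add: norm_divide)
  qed simp
  then have le: "AE \<xi> in lborel. cmod (indicator (band N) \<xi> * m \<xi> / complex_of_real (bracket r \<xi>)) \<le> B * (N / 2) powr (- r) * cmod (indicator (band N) \<xi>)"
    by simp
  show "square_integrable (\<lambda>\<xi>. indicator (band N) \<xi> * m \<xi> / complex_of_real (bracket r \<xi>))"
    by (rule square_integrableI_bound[OF _ square_integrable_band le]) measurable
  show "l2norm (\<lambda>\<xi>. indicator (band N) \<xi> * m \<xi> / complex_of_real (bracket r \<xi>)) \<le> B * (N / 2) powr (- r) * sqrt 2"
    unfolding l2norm_band[of N, symmetric]
    by (rule l2norm_mono[OF _ square_integrable_band le]) (use B N in \<open>measurable, auto\<close>)
qed

lemma band_weight_mult:
  "indicator (band N) \<xi> * m / complex_of_real (bracket r \<xi>) * (complex_of_real (bracket r \<xi>) * z) = indicator (band N) \<xi> * m * z"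
  using bracket_pos(3)[of r \<xi>] by simp

text \<open>The same functional is represented at every order \<open>r\<close>: time derivatives exist at order \<open>s - 1\<close>, while the
  final lower bound is read off at order \<open>s\<close>.\<close>

lemma band_mass_eq_pairing:
  assumes N: "2 \<le> N" and r: "0 \<le> r" and U: "U \<in> sobolev r"
  shows "band_mass N U = pairing r (\<lambda>\<xi>. indicator (band N) \<xi> * (- \<i>) / complex_of_real (bracket r \<xi>)) U"
proof -
  have i: "integrable lborel (\<lambda>\<xi>. indicator (band N) \<xi> * (- \<i>) * fourier U \<xi>)"
    using integrable_mult_sqint[OF square_integrable_band_weight[OF N r, of "\<lambda>_. - \<i>" 1] sobolevD(2)[OF U]]
    unfolding band_weight_mult by simp
  have "Re (indicator (band N) \<xi> * (- \<i>) * fourier U \<xi>) = indicator (band N) \<xi> * Im (fourier U \<xi>)" for \<xi>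
    by (simp add: indicator_def)
  then show ?thesis
    unfolding pairing_def band_weight_mult band_mass_def
    by (subst integral_Re[OF i, symmetric]) simp
qed

text \<open>On the band the weight of order \<open>r\<close> is at least \<open>(N / 2) powr r\<close>, and the band has length \<open>2\<close>.\<close>

lemma band_mass_le:
  assumes N: "2 \<le> N" and r: "0 \<le> r" and U: "U \<in> sobolev r"
  shows "\<bar>band_mass N U\<bar> \<le> (N / 2) powr (- r) * sqrt 2 * sobolev_norm r U"
proof -
  note W = square_integrable_band_weight[OF N r, of "\<lambda>_. - \<i>" 1] l2norm_band_weight[OF N r, of "\<lambda>_. - \<i>" 1]
  have "\<bar>band_mass N U\<bar> \<le> l2norm (\<lambda>\<xi>. indicator (band N) \<xi> * (- \<i>) / complex_of_real (bracket r \<xi>)) * sobolev_norm r U"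
    unfolding band_mass_eq_pairing[OF assms] by (rule abs_pairing_le[OF _ U]) (use W(1) in simp)
  also have "\<dots> \<le> ((N / 2) powr (- r) * sqrt 2) * sobolev_norm r U"
    using W(2) by (intro mult_right_mono) simp_all
  finally show ?thesis .
qed

lemma
  assumes N: "2 \<le> N" and r: "0 \<le> r" and U: "U \<in> sobolev r"
  shows integrable_band_weighted: "integrable lborel (\<lambda>\<xi>. indicator (band N) \<xi> * (\<xi> * cmod (fourier U \<xi>)))"
    and integral_band_weighted: "(LINT \<xi>|lborel. indicator (band N) \<xi> * (\<xi> * cmod (fourier U \<xi>))) \<le> 2 * N * (N / 2) powr (- r) * sqrt 2 * sobolev_norm r U"
proof -
  have m: "\<And>\<xi>. \<xi> \<in> band N \<Longrightarrow> cmod (complex_of_real \<xi>) \<le> 2 * N"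
    using N by (auto simp: band_def)
  note W = square_integrable_band_weight[OF N r _ m] l2norm_band_weight[OF N r _ m]
  have eq: "cmod (indicator (band N) \<xi> * complex_of_real \<xi> / complex_of_real (bracket r \<xi>) * (complex_of_real (bracket r \<xi>) * fourier U \<xi>))
     = indicator (band N) \<xi> * (\<xi> * cmod (fourier U \<xi>))" for \<xi>
    unfolding band_weight_mult using N by (auto simp: indicator_def norm_mult band_def)
  have w1: "square_integrable (\<lambda>\<xi>. indicator (band N) \<xi> * complex_of_real \<xi> / complex_of_real (bracket r \<xi>))"
    using W(1) N by simp
  have w2: "l2norm (\<lambda>\<xi>. indicator (band N) \<xi> * complex_of_real \<xi> / complex_of_real (bracket r \<xi>)) \<le> 2 * N * (N / 2) powr (- r) * sqrt 2"
    using W(2) N by simp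
  from integrable_norm[OF integrable_mult_sqint[OF w1 sobolevD(2)[OF U]]]
  show "integrable lborel (\<lambda>\<xi>. indicator (band N) \<xi> * (\<xi> * cmod (fourier U \<xi>)))" unfolding eq .
  have "(LINT \<xi>|lborel. indicator (band N) \<xi> * (\<xi> * cmod (fourier U \<xi>)))
      \<le> l2norm (\<lambda>\<xi>. indicator (band N) \<xi> * complex_of_real \<xi> / complex_of_real (bracket r \<xi>)) * sobolev_norm r U"
    using l2norm_Cauchy_Schwarz[OF w1 sobolevD(2)[OF U]] unfolding eq sobolev_norm_eq .
  also have "\<dots> \<le> 2 * N * (N / 2) powr (- r) * sqrt 2 * sobolev_norm r U"
    by (intro mult_right_mono w2) simp
  finally show "(LINT \<xi>|lborel. indicator (band N) \<xi> * (\<xi> * cmod (fourier U \<xi>))) \<le> 2 * N * (N / 2) powr (- r) * sqrt 2 * sobolev_norm r U" .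
qed

lemma integrable_band_Im:
  assumes N: "2 \<le> N" and r: "0 \<le> r" and U: "U \<in> sobolev r"
  shows "integrable lborel (\<lambda>\<xi>. indicator (band N) \<xi> * Im (fourier U \<xi>))"
proof (rule Bochner_Integration.integrable_bound[OF integrable_band_weighted[OF assms]])
  note [measurable] = sobolevD(3)[OF U]
  show "(\<lambda>\<xi>. indicator (band N) \<xi> * Im (fourier U \<xi>)) \<in> borel_measurable lborel" by measurable
  have "\<bar>Im (fourier U \<xi>)\<bar> \<le> \<bar>\<xi>\<bar> * cmod (fourier U \<xi>)" if "\<xi> \<in> band N" for \<xi>
  proof -
    have "1 \<le> \<bar>\<xi>\<bar>" using that N by (auto simp: band_def)
    then have "1 * cmod (fourier U \<xi>) \<le> \<bar>\<xi>\<bar> * cmod (fourier U \<xi>)" by (intro mult_right_mono) auto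
    then show ?thesis using abs_Im_le_cmod[of "fourier U \<xi>"] by simp
  qed
  then show "AE \<xi> in lborel. norm (indicator (band N) \<xi> * Im (fourier U \<xi>)) \<le> norm (indicator (band N) \<xi> * (\<xi> * cmod (fourier U \<xi>)))"
    by (intro AE_I2) (simp add: indicator_def abs_mult)
qed

text \<open>This is the mechanism that separates the two evolutions.  For \<open>\<alpha> = 1 / N\<close> the damping
  \<open>m = \<alpha>\<^sup>2\<xi>\<^sup>2 / (1 + \<alpha>\<^sup>2\<xi>\<^sup>2)\<close> lies between \<open>1/5\<close> and \<open>1\<close> on the band, so the two fluxes differ there by a fixed
  fraction of the square of the state.  The state is compared with a reference \<open>w\<close>, and all other
  differences are errors measured in \<open>H\<^sup>s\<^sup>-\<^sup>1\<close>.\<close>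

lemma band_mass_derivative_lower:
  assumes N: "3 \<le> N" and s: "3 / 2 < s"
    and u: "u \<in> sobolev s" and v: "v \<in> sobolev s" and w: "w \<in> sobolev s"
    and du: "du \<in> sobolev (s - 1)" "evolves (1 / N) u du" and dv: "dv \<in> sobolev (s - 1)" "evolves 0 v dv"
    and g: "0 \<le> g" "AE \<xi> in lborel. \<xi> \<in> band N \<longrightarrow> g \<le> Re (fourier (\<lambda>x. (w x)\<^sup>2) \<xi>)"
  defines "\<kappa> \<equiv> 2 * N * (N / 2) powr (- (s - 1)) * sqrt 2"
  shows "N / 5 * g - \<kappa> * (sobolev_norm (s - 1) (\<lambda>x. (u x)\<^sup>2 - (w x)\<^sup>2) + 3 / 2 * sobolev_norm (s - 1) (\<lambda>x. (u x)\<^sup>2 - (v x)\<^sup>2)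
       + 1 / (2 * N\<^sup>2) * sobolev_norm (s - 1) (\<lambda>x. (Dx u x)\<^sup>2))
     \<le> band_mass N du - band_mass N dv"
proof -
  have N2: "2 \<le> N" and s1: "0 \<le> s - 1" "1 / 2 < s - 1" "s - 1 \<le> s" "1 \<le> s" using N s by auto
  have sq: "(\<lambda>x. (f x)\<^sup>2) \<in> sobolev (s - 1)" if "f \<in> sobolev (s - 1)" for f
    using sobolev_product_algebra[OF s1(2)] that by (auto simp: power2_eq_square)
  note us = sq[OF sobolev_mono(1)[OF u s1(3)]] and vs = sq[OF sobolev_mono(1)[OF v s1(3)]] and ws = sq[OF sobolev_mono(1)[OF w s1(3)]]
  define p where "p x = (Dx u x)\<^sup>2" for x
  have p: "p \<in> sobolev (s - 1)" unfolding p_def[abs_def] by (rule sq[OF sobolev_Dx[OF u s1(4)]])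
  define d1 where "d1 x = (u x)\<^sup>2 - (w x)\<^sup>2" for x
  define d2 where "d2 x = (u x)\<^sup>2 - (v x)\<^sup>2" for x
  have d1: "d1 \<in> sobolev (s - 1)" unfolding d1_def[abs_def] by (rule sobolev_diff[OF us ws])
  have d2: "d2 \<in> sobolev (s - 1)" unfolding d2_def[abs_def] by (rule sobolev_diff[OF us vs])
  define E where "E f = (LINT \<xi>|lborel. indicator (band N) \<xi> * (\<xi> * cmod (fourier f \<xi>)))" for f
  note Ei = integrable_band_weighted[OF N2 s1(1)]
  have El: "E f \<le> \<kappa> * sobolev_norm (s - 1) f" if "f \<in> sobolev (s - 1)" for f
    unfolding E_def \<kappa>_def by (rule integral_band_weighted[OF N2 s1(1) that])
  let ?I = "indicator (band N) :: real \<Rightarrow> real"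
  have Ii: "integrable lborel ?I" by (simp add: band_def)
  define low where "low \<xi> = ?I \<xi> * ((N / 10) * g) - (?I \<xi> * (\<xi> * cmod (fourier d1 \<xi>)) + 3 / 2 * (?I \<xi> * (\<xi> * cmod (fourier d2 \<xi>)))
       + 1 / (2 * N\<^sup>2) * (?I \<xi> * (\<xi> * cmod (fourier p \<xi>))))" for \<xi>
  have lowi: "integrable lborel low"
    unfolding low_def[abs_def]
    by (intro Bochner_Integration.integrable_diff Bochner_Integration.integrable_add integrable_mult_right integrable_mult_left Ei d1 d2 p Ii)
  have "N / 5 * g - (E d1 + 3 / 2 * E d2 + 1 / (2 * N\<^sup>2) * E p) = (LINT \<xi>|lborel. low \<xi>)"
    unfolding low_def E_def using Ei[OF d1] Ei[OF d2] Ei[OF p] Ii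
    by (simp add: band_def)
  also have "\<dots> \<le> (LINT \<xi>|lborel. ?I \<xi> * Im (fourier du \<xi>) - ?I \<xi> * Im (fourier dv \<xi>))"
  proof (rule integral_mono_AE[OF lowi])
    show "integrable lborel (\<lambda>\<xi>. ?I \<xi> * Im (fourier du \<xi>) - ?I \<xi> * Im (fourier dv \<xi>))"
      by (intro Bochner_Integration.integrable_diff integrable_band_Im[OF N2 s1(1)] du dv)
    show "AE \<xi> in lborel. low \<xi> \<le> ?I \<xi> * Im (fourier du \<xi>) - ?I \<xi> * Im (fourier dv \<xi>)"
      using du(2)[unfolded evolves_def, folded p_def] dv(2)[unfolded evolves_def]
        fourier_diff[OF sobolevD(1)[OF us] sobolevD(1)[OF ws], folded d1_def]
        fourier_diff[OF sobolevD(1)[OF us] sobolevD(1)[OF vs], folded d2_def] g(2)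
    proof eventually_elim
      case (elim \<xi>)
      show ?case
      proof (cases "\<xi> \<in> band N")
        case True
        define m where "m = (1 / N)\<^sup>2 * \<xi>\<^sup>2 / (1 + (1 / N)\<^sup>2 * \<xi>\<^sup>2)"
        define B where "B = gradient_symbol (1 / N) \<xi>"
        define qu where "qu = Re (fourier (\<lambda>x. (u x)\<^sup>2) \<xi>)"
        define qv where "qv = Re (fourier (\<lambda>x. (v x)\<^sup>2) \<xi>)"
        define qw where "qw = Re (fourier (\<lambda>x. (w x)\<^sup>2) \<xi>)"
        have \<xi>: "N / 2 \<le> \<xi>" "0 \<le> \<xi>" using True N by (auto simp: band_def)
        have m1: "0 \<le> m" "m \<le> 1" unfolding m_def by (rule damping_bounds)+
        \<comment> \<open>\<open>\<xi> / N \<ge> 1/2\<close> on the band, and \<open>y / (1 + y) \<ge> 1/5\<close> for \<open>y \<ge> 1/4\<close>.\<close>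
        have m2: "1 / 5 \<le> m"
        proof -
          define y where "y = (1 / N)\<^sup>2 * \<xi>\<^sup>2"
          have "(1 / 2)\<^sup>2 \<le> (1 / N * \<xi>)\<^sup>2"
            using \<xi> N by (intro power_mono) (auto simp: field_simps)
          then have "1 / 4 \<le> y" by (simp add: y_def power_mult_distrib power2_eq_square)
          then show ?thesis unfolding m_def y_def[symmetric] by (simp add: field_simps)
        qed
        have B: "0 \<le> B" "B \<le> 1 / (2 * N\<^sup>2)"
          using gradient_symbol_bounds[of "1 / N" \<xi>] by (auto simp: B_def power_divide)
        have "Im (fourier du \<xi>) = - \<xi> * ((3 / 2 - m) * qu + B * Re (fourier p \<xi>))"
          unfolding elim(1) by (simp add: flux_symbol_def m_def B_def qu_def)
        moreover have "Im (fourier dv \<xi>) = - \<xi> * (3 / 2 * qv)"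
          unfolding elim(2) by (simp add: flux_symbol_def gradient_symbol_def qv_def)
        ultimately have "Im (fourier du \<xi>) - Im (fourier dv \<xi>)
            = - \<xi> * ((3 / 2 - m) * qu + B * Re (fourier p \<xi>)) - (- \<xi> * (3 / 2 * qv))"
          by simp
        also have "\<dots> = \<xi> * m * qw + \<xi> * m * (qu - qw) - 3 / 2 * (\<xi> * (qu - qv)) - \<xi> * B * Re (fourier p \<xi>)"
          by (simp add: field_simps)
        finally have "Im (fourier du \<xi>) - Im (fourier dv \<xi>)
            = \<xi> * m * qw + \<xi> * m * (qu - qw) - 3 / 2 * (\<xi> * (qu - qv)) - \<xi> * B * Re (fourier p \<xi>)" .
        \<comment> \<open>The main term; integrated over the band, of length \<open>2\<close>, it contributes \<open>N / 5 * g\<close>.\<close>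
        moreover have "N / 10 * g \<le> \<xi> * m * qw"
        proof -
          have "(N / 2 * (1 / 5)) * g \<le> (\<xi> * m) * qw"
            using \<xi> m1 m2 N g(1) elim(5) True by (intro mult_mono) (auto simp: qw_def)
          then show ?thesis by simp
        qed
        moreover have "- (\<xi> * cmod (fourier d1 \<xi>)) \<le> \<xi> * m * (qu - qw)"
        proof -
          have "\<bar>qu - qw\<bar> \<le> cmod (fourier d1 \<xi>)"
            unfolding elim(3) qu_def qw_def using abs_Re_le_cmod[of "fourier (\<lambda>x. (u x)\<^sup>2) \<xi> - fourier (\<lambda>x. (w x)\<^sup>2) \<xi>"] by simp
          then have "(\<xi> * m) * \<bar>qu - qw\<bar> \<le> (\<xi> * 1) * cmod (fourier d1 \<xi>)"
            using \<xi> m1 by (intro mult_mono) auto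
          moreover have "\<bar>\<xi> * m * (qu - qw)\<bar> = (\<xi> * m) * \<bar>qu - qw\<bar>" using \<xi> m1 by (simp add: abs_mult)
          ultimately show ?thesis by (simp add: abs_le_iff)
        qed
        moreover have "\<xi> * (qu - qv) \<le> \<xi> * cmod (fourier d2 \<xi>)"
        proof -
          have "\<bar>qu - qv\<bar> \<le> cmod (fourier d2 \<xi>)"
            unfolding elim(4) qu_def qv_def using abs_Re_le_cmod[of "fourier (\<lambda>x. (u x)\<^sup>2) \<xi> - fourier (\<lambda>x. (v x)\<^sup>2) \<xi>"] by simp
          then show ?thesis using \<xi> by (intro mult_left_mono) auto
        qed
        moreover have "\<xi> * B * Re (fourier p \<xi>) \<le> 1 / (2 * N\<^sup>2) * (\<xi> * cmod (fourier p \<xi>))"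
        proof -
          have "\<xi> * B * Re (fourier p \<xi>) \<le> \<xi> * B * cmod (fourier p \<xi>)"
            using \<xi> B complex_Re_le_cmod by (intro mult_left_mono) auto
          also have "\<dots> = B * (\<xi> * cmod (fourier p \<xi>))" by simp
          also have "\<dots> \<le> 1 / (2 * N\<^sup>2) * (\<xi> * cmod (fourier p \<xi>))"
            using \<xi> B by (intro mult_right_mono) auto
          finally show ?thesis .
        qed
        ultimately have "N / 10 * g - (\<xi> * cmod (fourier d1 \<xi>) + 3 / 2 * (\<xi> * cmod (fourier d2 \<xi>)) + 1 / (2 * N\<^sup>2) * (\<xi> * cmod (fourier p \<xi>)))
            \<le> Im (fourier du \<xi>) - Im (fourier dv \<xi>)"
          by linarith
        then show ?thesis using True by (simp add: low_def)
      qed (simp add: low_def)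
    qed
  qed
  also have "\<dots> = band_mass N du - band_mass N dv"
    unfolding band_mass_def
    by (intro Bochner_Integration.integral_diff integrable_band_Im[OF N2 s1(1)] du dv)
  finally have *: "N / 5 * g - (E d1 + 3 / 2 * E d2 + 1 / (2 * N\<^sup>2) * E p) \<le> band_mass N du - band_mass N dv" .
  have "1 / (2 * N\<^sup>2) * E p \<le> 1 / (2 * N\<^sup>2) * (\<kappa> * sobolev_norm (s - 1) p)"
    using El[OF p] by (intro mult_left_mono) auto
  then have "E d1 + 3 / 2 * E d2 + 1 / (2 * N\<^sup>2) * E p
    \<le> \<kappa> * (sobolev_norm (s - 1) d1 + 3 / 2 * sobolev_norm (s - 1) d2 + 1 / (2 * N\<^sup>2) * sobolev_norm (s - 1) p)"
    using El[OF d1] El[OF d2] by (simp add: algebra_simps)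
  with * show ?thesis unfolding d1_def[abs_def] d2_def[abs_def] p_def[abs_def] by linarith
qed

section \<open>Initial data\<close>

text \<open>The datum is prescribed on the Fourier side: height \<open>a = A / N\<close> on \<open>[-1, 1]\<close> and height \<open>b\<close> on the bands around
  \<open>N\<close> and \<open>- N\<close>.  The convolution of the low with the high part is at least \<open>a b\<close> on the band.  The height \<open>b\<close>,
  which is of order \<open>N powr (- s)\<close>, is tuned to give the norm exactly the value \<open>R\<close>: the a priori bounds
  depend on this norm in an unspecified way, so it must not vary with \<open>N\<close>.  The factor \<open>1 / N\<close> in the low part
  makes the norm of order \<open>s - 1\<close> small, which is what limits the motion of the datum.\<close>

lemma initial_datum:
  assumes s: "1 \<le> s" "3 / 2 < s" and R: "0 < R" and A: "0 < A"
  shows "\<exists>K N0. 0 < K \<and> 3 \<le> N0 \<and> (\<forall>N\<ge>N0. \<exists>u0 b. u0 \<in> sobolev s \<and> sobolev_norm s u0 = R \<and> sobolev_norm (s - 1) u0 \<le> K / N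
     \<and> R / (sqrt 8 * 2 powr s) * N powr (- s) \<le> b
     \<and> (AE \<xi> in lborel. \<xi> \<in> band N \<longrightarrow> A / N * b / (2 * pi) \<le> Re (fourier (\<lambda>x. (u0 x)\<^sup>2) \<xi>)))"
proof -
  define L :: "real set" where "L = {-1..1}"
  define k where "k r = (LINT \<xi>|lborel. indicator L \<xi> * (bracket r \<xi>)\<^sup>2)" for r
  have k0: "0 \<le> k r" for r unfolding k_def by (intro Bochner_Integration.integral_nonneg) auto
  define K where "K = sqrt (A\<^sup>2 * k (s - 1) + 4 * R\<^sup>2)"
  have Kp: "0 < A\<^sup>2 * k (s - 1) + 4 * R\<^sup>2" using k0 R by (intro add_nonneg_pos) auto
  \<comment> \<open>For \<open>N \<ge> N0\<close> the low part uses at most half of \<open>R\<^sup>2\<close>, and the band lies away from \<open>[-1, 1]\<close>.\<close>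
  define N0 where "N0 = 3 + A * sqrt (2 * k s) / R"
  have jc: "continuous_on S (\<lambda>\<xi>. (bracket r \<xi>)\<^sup>2)" for S r
    unfolding bracket_def by (intro continuous_intros) auto
  have int: "integrable lborel (\<lambda>\<xi>. indicator S \<xi> * (bracket r \<xi>)\<^sup>2)" if "compact S" for S r
    using borel_integrable_compact[OF that jc] by simp
  have "\<exists>u0 b. u0 \<in> sobolev s \<and> sobolev_norm s u0 = R \<and> sobolev_norm (s - 1) u0 \<le> K / N
     \<and> R / (sqrt 8 * 2 powr s) * N powr (- s) \<le> b
     \<and> (AE \<xi> in lborel. \<xi> \<in> band N \<longrightarrow> A / N * b / (2 * pi) \<le> Re (fourier (\<lambda>x. (u0 x)\<^sup>2) \<xi>))"
    if N: "N0 \<le> N" for N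
  proof -
    have N3: "3 \<le> N" and NA: "A * sqrt (2 * k s) / R \<le> N"
      using N A R k0[of s] by (auto simp: N0_def add_increasing2 intro: order_trans[rotated])
    define J where "J = band N \<union> band (- N)"
    have J: "compact J" by (auto simp: J_def band_def)
    have [measurable]: "J \<in> sets borel" "L \<in> sets borel" by (auto simp: J_def L_def)
    have JL: "J \<inter> L = {}" using N3 by (auto simp: J_def L_def band_def)
    have Jsq: "(N / 2)\<^sup>2 \<le> \<xi>\<^sup>2" "\<xi>\<^sup>2 \<le> (N + 1)\<^sup>2" if "\<xi> \<in> J" for \<xi>
    proof -
      have *: "N / 2 \<le> \<bar>\<xi>\<bar>" "\<bar>\<xi>\<bar> \<le> N + 1" using that N3 by (auto simp: J_def band_def)
      have "(N / 2)\<^sup>2 \<le> \<bar>\<xi>\<bar>\<^sup>2" by (rule power_mono) (use * N3 in auto)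
      moreover have "\<bar>\<xi>\<bar>\<^sup>2 \<le> (N + 1)\<^sup>2" by (rule power_mono) (use * in auto)
      ultimately show "(N / 2)\<^sup>2 \<le> \<xi>\<^sup>2" "\<xi>\<^sup>2 \<le> (N + 1)\<^sup>2" by auto
    qed
    define \<beta> where "\<beta> r = (LINT \<xi>|lborel. indicator J \<xi> * (bracket r \<xi>)\<^sup>2)" for r
    have disj: "band N \<inter> band (- N) = {}" using N3 by (auto simp: band_def)
    have J4: "(LINT \<xi>|lborel. indicator J \<xi>) = (4 :: real)"
    proof -
      have "measure lborel J = measure lborel (band N) + measure lborel (band (- N))"
      proof -
        have fm: "band M \<in> fmeasurable lborel" for M
          by (rule fmeasurableI) (auto simp: band_def emeasure_lborel_Icc_eq)
        have "band (- N) - band N = band (- N)" using disj by blast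
        then show ?thesis using measure_Un2[OF fm fm, of N "- N"] by (simp add: J_def)
      qed
      then show ?thesis by (simp add: band_def)
    qed
    have Ji: "integrable lborel (indicator J :: real \<Rightarrow> real)"
      using emeasure_compact_finite[OF J] by simp
    have \<beta>lo: "4 \<le> \<beta> s"
      unfolding \<beta>_def J4[symmetric]
    proof (rule integral_mono[OF Ji int[OF J]])
      fix \<xi>
      have "1 \<le> bracket s \<xi>" using s by (intro bracket_ge_1) simp
      then have "1 \<le> (bracket s \<xi>)\<^sup>2" by (simp add: one_le_power)
      then show "indicator J \<xi> \<le> indicator J \<xi> * (bracket s \<xi>)\<^sup>2" by (simp add: indicator_def)
    qed
    have \<beta>hi: "\<beta> s \<le> (4 * N\<^sup>2) powr s * 4"
    proof -
      have "\<beta> s \<le> (LINT \<xi>|lborel. (4 * N\<^sup>2) powr s * indicator J \<xi>)"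
        unfolding \<beta>_def
      proof (rule integral_mono[OF int[OF J]])
        fix \<xi>
        have "1 + (N + 1)\<^sup>2 \<le> 4 * N\<^sup>2"
        proof -
          have "3 * N \<le> N * N" using N3 by (intro mult_right_mono) auto
          moreover have "(N + 1)\<^sup>2 = N * N + 2 * N + 1" "4 * N\<^sup>2 = 4 * (N * N)"
            by (simp_all add: power2_eq_square algebra_simps)
          ultimately show ?thesis using N3 by linarith
        qed
        then have "(1 + \<xi>\<^sup>2) powr s \<le> (4 * N\<^sup>2) powr s" if "\<xi> \<in> J"
          using Jsq[OF that] s by (intro powr_mono2) auto
        then show "indicator J \<xi> * (bracket s \<xi>)\<^sup>2 \<le> (4 * N\<^sup>2) powr s * indicator J \<xi>"
          by (simp add: indicator_def bracket_sq)
      qed (use Ji in auto)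
      then show ?thesis using J4 by simp
    qed
    have \<beta>1: "\<beta> (s - 1) \<le> 4 / N\<^sup>2 * \<beta> s"
    proof -
      have "\<beta> (s - 1) \<le> (LINT \<xi>|lborel. 4 / N\<^sup>2 * (indicator J \<xi> * (bracket s \<xi>)\<^sup>2))"
        unfolding \<beta>_def
      proof (rule integral_mono[OF int[OF J]])
        fix \<xi>
        show "indicator J \<xi> * (bracket (s - 1) \<xi>)\<^sup>2 \<le> 4 / N\<^sup>2 * (indicator J \<xi> * (bracket s \<xi>)\<^sup>2)"
        proof (cases "\<xi> \<in> J")
          case True
          have "(bracket s \<xi>)\<^sup>2 = (1 + \<xi>\<^sup>2) * (bracket (s - 1) \<xi>)\<^sup>2"
            unfolding bracket_sq using powr_add[of "1 + \<xi>\<^sup>2" 1 "s - 1"] by (simp add: less_imp_le)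
          moreover have "1 \<le> 4 / N\<^sup>2 * (1 + \<xi>\<^sup>2)"
            using Jsq(1)[OF True] N3 by (simp add: power_divide field_simps)
          then have "1 * (bracket (s - 1) \<xi>)\<^sup>2 \<le> 4 / N\<^sup>2 * (1 + \<xi>\<^sup>2) * (bracket (s - 1) \<xi>)\<^sup>2"
            by (intro mult_right_mono) auto
          ultimately have "(bracket (s - 1) \<xi>)\<^sup>2 \<le> 4 / N\<^sup>2 * (bracket s \<xi>)\<^sup>2"
            by (simp only: mult_1 mult.assoc)
          then show ?thesis using True by simp
        qed simp
      qed (use int[OF J, of s] in auto)
      then show ?thesis by (simp add: \<beta>_def)
    qed
    define a where "a = A / N"
    have a: "0 < a" using A N3 by (simp add: a_def)
    have ak: "a\<^sup>2 * k s \<le> R\<^sup>2 / 2"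
    proof -
      have "A * sqrt (2 * k s) \<le> N * R" using NA R by (simp add: field_simps)
      then have "(A * sqrt (2 * k s))\<^sup>2 \<le> (N * R)\<^sup>2" using A k0[of s] by (intro power_mono) auto
      then show ?thesis using N3 k0[of s] by (simp add: a_def power_mult_distrib power_divide field_simps)
    qed
    define b where "b = sqrt ((R\<^sup>2 - a\<^sup>2 * k s) / \<beta> s)"
    have b0: "0 \<le> (R\<^sup>2 - a\<^sup>2 * k s) / \<beta> s"
    proof (rule divide_nonneg_nonneg)
      have "R\<^sup>2 / 2 \<le> R\<^sup>2" by simp
      with ak show "0 \<le> R\<^sup>2 - a\<^sup>2 * k s" by linarith
    qed (use \<beta>lo in simp)
    then have b: "0 \<le> b" "b\<^sup>2 * \<beta> s = R\<^sup>2 - a\<^sup>2 * k s" using \<beta>lo by (auto simp: b_def)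
    have blo: "R / (sqrt 8 * 2 powr s) * N powr (- s) \<le> b"
    proof (rule power2_le_imp_le[OF _ b(1)])
      have p4: "(4 * N\<^sup>2) powr s = (2 powr s * N powr s)\<^sup>2"
      proof -
        define y where "y = 2 * N"
        have y: "0 < y" using N3 by (simp add: y_def)
        have "(4 * N\<^sup>2) powr s = (y\<^sup>2) powr s" by (simp add: y_def power_mult_distrib)
        also have "\<dots> = (y powr 2) powr s" using y by simp
        also have "\<dots> = y powr (s + s)" by (simp only: powr_powr mult_2)
        also have "\<dots> = (y powr s)\<^sup>2" by (simp only: powr_add power2_eq_square)
        also have "y powr s = 2 powr s * N powr s" unfolding y_def using N3 by (subst powr_mult) auto
        finally show ?thesis .
      qed
      have "N powr (- s) = 1 / N powr s" by (rule powr_minus_divide)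
      then have "(R / (sqrt 8 * 2 powr s) * N powr (- s))\<^sup>2 = R\<^sup>2 / 2 / ((4 * N\<^sup>2) powr s * 4)"
        unfolding p4 by (simp only: power_mult_distrib power_divide) simp
      also have "\<dots> \<le> (R\<^sup>2 - a\<^sup>2 * k s) / \<beta> s"
      proof (rule frac_le)
        show "R\<^sup>2 / 2 \<le> R\<^sup>2 - a\<^sup>2 * k s" using ak by linarith
        then show "0 \<le> R\<^sup>2 - a\<^sup>2 * k s" by (rule order_trans[rotated]) simp
      qed (use \<beta>hi \<beta>lo in auto)
      also have "\<dots> = b\<^sup>2" using b0 by (simp add: b_def)
      finally show "(R / (sqrt 8 * 2 powr s) * N powr (- s))\<^sup>2 \<le> b\<^sup>2" .
    qed
    define h where "h \<xi> = a * indicator L \<xi> + b * indicator J \<xi>" for \<xi> :: real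
    have [measurable]: "h \<in> borel_measurable borel" unfolding h_def by measurable
    have h0: "0 \<le> h \<xi>" for \<xi> using a b by (simp add: h_def)
    have hsq: "(bracket r \<xi> * h \<xi>)\<^sup>2 = a\<^sup>2 * (indicator L \<xi> * (bracket r \<xi>)\<^sup>2) + b\<^sup>2 * (indicator J \<xi> * (bracket r \<xi>)\<^sup>2)" for r \<xi>
      using JL by (auto simp: h_def indicator_def power_mult_distrib)
    have L: "compact L" by (simp add: L_def)
    have hi: "integrable lborel (\<lambda>\<xi>. (bracket r \<xi> * h \<xi>)\<^sup>2)" for r
      unfolding hsq by (intro Bochner_Integration.integrable_add integrable_mult_right int J L)
    have hI: "(LINT \<xi>|lborel. (bracket r \<xi> * h \<xi>)\<^sup>2) = a\<^sup>2 * k r + b\<^sup>2 * \<beta> r" for r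
      unfolding hsq k_def \<beta>_def by (simp add: int J L)
    define H where "H \<xi> = complex_of_real (h \<xi>)" for \<xi>
    have [measurable]: "H \<in> borel_measurable borel" unfolding H_def by measurable
    have jH: "square_integrable (\<lambda>\<xi>. complex_of_real (bracket r \<xi>) * H \<xi>)" for r
      using hi[of r] unfolding H_def square_integrable_def by (simp add: norm_mult power_mult_distrib)
    have H: "square_integrable H" using jH[of 0] by simp
    have "AE \<xi> in lborel. H (- \<xi>) = cnj (H \<xi>)"
      by (auto simp: H_def h_def L_def J_def band_def indicator_def)
    from has_fourier_transform_onto_real[OF H this] obtain u0
      where u0: "has_fourier_transform (\<lambda>x. complex_of_real (u0 x)) H" by blast
    then have u0i: "square_integrable u0" by (simp add: has_fourier_transform_iff)
    note [measurable] = measurable_fourier[OF u0i]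
    have ae: "AE \<xi> in lborel. fourier u0 \<xi> = H \<xi>" by (rule fourier_AE_eqI[OF u0])
    have ae': "AE \<xi> in lborel. complex_of_real (bracket r \<xi>) * fourier u0 \<xi> = complex_of_real (bracket r \<xi>) * H \<xi>" for r
      using ae by eventually_elim simp
    have sq: "square_integrable (\<lambda>\<xi>. complex_of_real (bracket r \<xi>) * fourier u0 \<xi>)" for r
      by (rule square_integrable_AE_cong[OF _ jH ae']) measurable
    have mem: "u0 \<in> sobolev r" for r using u0i sq by (simp add: sobolev_iff)
    have nrm: "sobolev_norm r u0 = sqrt (a\<^sup>2 * k r + b\<^sup>2 * \<beta> r)" for r
    proof -
      have "sobolev_norm r u0 = l2norm (\<lambda>\<xi>. complex_of_real (bracket r \<xi>) * H \<xi>)"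
        unfolding sobolev_norm_eq by (rule l2norm_cong_AE[OF sq jH ae'])
      also have "\<dots> = sqrt (LINT \<xi>|lborel. (bracket r \<xi> * h \<xi>)\<^sup>2)"
        by (simp add: l2norm_def H_def norm_mult power_mult_distrib)
      finally show ?thesis by (simp only: hI)
    qed
    have n1: "sobolev_norm s u0 = R" using b R by (simp add: nrm)
    have n2: "sobolev_norm (s - 1) u0 \<le> K / N"
    proof -
      have "b\<^sup>2 * \<beta> (s - 1) \<le> b\<^sup>2 * (4 / N\<^sup>2 * \<beta> s)" by (intro mult_left_mono \<beta>1) simp
      also have "\<dots> = 4 / N\<^sup>2 * (R\<^sup>2 - a\<^sup>2 * k s)" unfolding b(2)[symmetric] by simp
      also have "\<dots> \<le> 4 / N\<^sup>2 * R\<^sup>2" using k0[of s] by (intro mult_left_mono) auto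
      finally have "a\<^sup>2 * k (s - 1) + b\<^sup>2 * \<beta> (s - 1) \<le> (A\<^sup>2 * k (s - 1) + 4 * R\<^sup>2) / N\<^sup>2"
        by (simp add: a_def power_divide add_divide_distrib)
      also have "\<dots> = (K / N)\<^sup>2" using Kp by (simp add: K_def power_divide)
      finally have "sqrt (a\<^sup>2 * k (s - 1) + b\<^sup>2 * \<beta> (s - 1)) \<le> K / N"
        using Kp N3 by (intro real_le_lsqrt) (auto simp: K_def)
      then show ?thesis by (simp only: nrm)
    qed
    have s12: "1 / 2 < s" using s by simp
    have uu: "square_integrable (\<lambda>x. u0 x * u0 x)"
      by (rule square_integrable_mult_of_integrable_fourier[OF u0i integrable_fourier_sobolev[OF mem s12] u0i])
    have "AE \<xi> in lborel. \<xi> \<in> band N \<longrightarrow> A / N * b / (2 * pi) \<le> Re (fourier (\<lambda>x. (u0 x)\<^sup>2) \<xi>)"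
      using fourier_product[OF u0i u0i uu]
    proof eventually_elim
      case (elim \<xi>)
      show ?case
      proof
        assume \<xi>: "\<xi> \<in> band N"
        have "AE \<eta> in lborel. fourier u0 (\<xi> + (-1) * \<eta>) = H (\<xi> + (-1) * \<eta>)"
          by (rule AE_borel_affine[OF _ _ ae]) measurable
        then have "AE \<eta> in lborel. fourier u0 \<eta> * fourier u0 (\<xi> - \<eta>) = complex_of_real (h \<eta> * h (\<xi> - \<eta>))"
          using ae by eventually_elim (simp add: H_def)
        then have "(LINT \<eta>|lborel. fourier u0 \<eta> * fourier u0 (\<xi> - \<eta>)) = (LINT \<eta>|lborel. complex_of_real (h \<eta> * h (\<xi> - \<eta>)))"
          by (intro integral_cong_AE) auto
        also have "\<dots> = complex_of_real (LINT \<eta>|lborel. h \<eta> * h (\<xi> - \<eta>))"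
          by (rule integral_complex_of_real)
        finally have eq: "2 * pi * Re (fourier (\<lambda>x. u0 x * u0 x) \<xi>) = (LINT \<eta>|lborel. h \<eta> * h (\<xi> - \<eta>))"
          using arg_cong[OF elim, of Re] by simp
        have hr: "square_integrable h" using H by (simp add: H_def[abs_def])
        have hxi: "square_integrable (\<lambda>\<eta>. h (\<xi> - \<eta>))"
          using square_integrable_affine[OF H, of "-1" \<xi>] by (simp add: H_def)
        define I where "I = {max (N - 1) (\<xi> - 1)..min (N + 1) (\<xi> + 1)}"
        have I1: "1 \<le> measure lborel I" using \<xi> by (auto simp: I_def band_def)
        have Ii: "integrable lborel (indicator I :: real \<Rightarrow> real)"
          using emeasure_compact_finite[of I] by (intro integrable_real_indicator) (auto simp: I_def)
        have "a * b * 1 \<le> a * b * measure lborel I" using a b I1 by (intro mult_left_mono) auto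
        also have "\<dots> = (LINT \<eta>|lborel. a * b * indicator I \<eta>)" by simp
        also have "\<dots> \<le> (LINT \<eta>|lborel. h \<eta> * h (\<xi> - \<eta>))"
        proof (rule integral_mono[OF _ integrable_mult_real[OF hr hxi]])
          fix \<eta>
          show "a * b * indicator I \<eta> \<le> h \<eta> * h (\<xi> - \<eta>)"
          proof (cases "\<eta> \<in> I")
            case True
            then have "\<eta> \<in> J" "\<xi> - \<eta> \<in> L" by (auto simp: I_def J_def L_def band_def)
            then have "b \<le> h \<eta>" "a \<le> h (\<xi> - \<eta>)" using a b by (auto simp: h_def)
            then have "b * a \<le> h \<eta> * h (\<xi> - \<eta>)" using a b h0 by (intro mult_mono) auto
            then show ?thesis using True by (simp add: mult.commute)
          qed (simp add: h0)
        qed (use Ii in auto)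
        finally have "a * b \<le> 2 * pi * Re (fourier (\<lambda>x. u0 x * u0 x) \<xi>)" using eq by simp
        then show "A / N * b / (2 * pi) \<le> Re (fourier (\<lambda>x. (u0 x)\<^sup>2) \<xi>)"
          by (simp add: a_def[symmetric] pos_divide_le_eq power2_eq_square mult.commute)
      qed
    qed
    then show ?thesis using mem n1 n2 blo by blast
  qed
  moreover have "0 < K" using Kp by (simp add: K_def)
  moreover have "3 \<le> N0" using A R k0[of s] by (simp add: N0_def)
  ultimately show ?thesis by blast
qed

section \<open>Growth of the difference of two solutions\<close>

lemma solution_facts:
  assumes s: "3 / 2 < s" and \<alpha>: "0 \<le> \<alpha>" and sol: "filtered_solution s T \<alpha> u0 u"
  shows "continuous_sobolev s T u" "AE x in lborel. u 0 x = u0 x"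
    "\<exists>v. \<forall>t\<in>{0..T}. has_sobolev_derivative (s - 1) T u (v t) t \<and> evolves \<alpha> (u t) (v t)"
proof -
  show "continuous_sobolev s T u" "AE x in lborel. u 0 x = u0 x"
    using sol by (auto simp: filtered_solution_def burgers_solution_def camassa_holm_solution_def split: if_splits)
  show "\<exists>v. \<forall>t\<in>{0..T}. has_sobolev_derivative (s - 1) T u (v t) t \<and> evolves \<alpha> (u t) (v t)"
    using filtered_solution_fourier[OF s \<alpha> sol] unfolding evolves_def by (intro bchoice) blast
qed

text \<open>The time derivatives are of size \<open>1 / N\<close> in \<open>H\<^sup>s\<^sup>-\<^sup>1\<close>, so at time \<open>t\<close> both solutions are still within
  \<open>O(t / N)\<close> of the datum.  As the states are of size \<open>1 / N\<close> as well and \<open>H\<^sup>s\<^sup>-\<^sup>1\<close> is an algebra, the squares move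
  by \<open>O(t / N\<^sup>2)\<close>, which on the band amounts to \<open>O(t N powr (- s))\<close>.  Only the gradient term contributes an error
  without the factor \<open>t\<close>.\<close>

lemma band_mass_growth:
  assumes N: "3 \<le> N" and s: "3 / 2 < s" and T: "0 < T"
    and u: "filtered_solution s T (1 / N) u0 u" and v: "filtered_solution s T 0 u0 v"
    and K1: "\<And>t. t \<in> {0..T} \<Longrightarrow> sobolev_norm s (u t) \<le> K1" "\<And>t. t \<in> {0..T} \<Longrightarrow> sobolev_norm s (v t) \<le> K1"
    and K0: "\<And>t. t \<in> {0..T} \<Longrightarrow> sobolev_norm (s - 1) (u t) \<le> K0 / N" "\<And>t. t \<in> {0..T} \<Longrightarrow> sobolev_norm (s - 1) (v t) \<le> K0 / N"
    and C: "0 \<le> C" "\<And>\<alpha> w v. 0 \<le> \<alpha> \<Longrightarrow> w \<in> sobolev s \<Longrightarrow> v \<in> sobolev (s - 1) \<Longrightarrow> evolves \<alpha> w v \<Longrightarrow>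
      sobolev_norm (s - 1) v \<le> C * (sobolev_norm s w * sobolev_norm (s - 1) w + \<alpha> * (sobolev_norm s w)\<^sup>2)"
    and D: "0 \<le> D" "\<And>f g. f \<in> sobolev (s - 1) \<Longrightarrow> g \<in> sobolev (s - 1) \<Longrightarrow>
      sobolev_norm (s - 1) (\<lambda>x. f x * g x) \<le> D * sobolev_norm (s - 1) f * sobolev_norm (s - 1) g"
    and g: "0 \<le> g" "AE \<xi> in lborel. \<xi> \<in> band N \<longrightarrow> g \<le> Re (fourier (\<lambda>x. (u0 x)\<^sup>2) \<xi>)" and u0: "u0 \<in> sobolev s"
    and t: "0 < t" "t \<le> T"
  shows "(N / 5 * g - 2 powr s * sqrt 2 * N powr (- s) * (8 * D * (C * (K1 * K0 + K1\<^sup>2)) * K0 * t + D * K1\<^sup>2)) * t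
     \<le> band_mass N (\<lambda>x. u t x - v t x)"
proof -
  have N0: "0 < N" "2 \<le> N" using N by auto
  have s1: "s - 1 \<le> s" "0 \<le> s - 1" "1 \<le> s" using s by auto
  define \<sigma> where "\<sigma> = s - 1"
  define M where "M = C * (K1 * K0 + K1\<^sup>2)"
  have T0: "0 \<in> {0..T}" using T by simp
  have Knn: "0 \<le> K1" "0 \<le> K0 / N" using K1(1)[OF T0] K0(1)[OF T0] sobolev_norm_nonneg order_trans by blast+
  then have K0n: "0 \<le> K0" using N0 by (simp add: zero_le_divide_iff)
  have Mn: "0 \<le> M" using Knn K0n C(1) by (simp add: M_def)
  have aN: "0 \<le> 1 / N" using N0 by simp
  note U = solution_facts[OF s aN u] and V = solution_facts[OF s order_refl v]
  have u1: "u \<tau> \<in> sobolev s" "u \<tau> \<in> sobolev \<sigma>" if "\<tau> \<in> {0..T}" for \<tau>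
    using U(1) N0 that sobolev_mono(1)[OF _ s1(1)] by (auto simp: continuous_sobolev_def \<sigma>_def)
  have v1: "v \<tau> \<in> sobolev s" "v \<tau> \<in> sobolev \<sigma>" if "\<tau> \<in> {0..T}" for \<tau>
    using V(1) that sobolev_mono(1)[OF _ s1(1)] by (auto simp: continuous_sobolev_def \<sigma>_def)
  obtain du where du: "\<And>\<tau>. \<tau> \<in> {0..T} \<Longrightarrow> has_sobolev_derivative \<sigma> T u (du \<tau>) \<tau>" "\<And>\<tau>. \<tau> \<in> {0..T} \<Longrightarrow> evolves (1 / N) (u \<tau>) (du \<tau>)"
    using U(3) unfolding \<sigma>_def by blast
  obtain dv where dv: "\<And>\<tau>. \<tau> \<in> {0..T} \<Longrightarrow> has_sobolev_derivative \<sigma> T v (dv \<tau>) \<tau>" "\<And>\<tau>. \<tau> \<in> {0..T} \<Longrightarrow> evolves 0 (v \<tau>) (dv \<tau>)"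
    using V(3) unfolding \<sigma>_def by blast
  have dus: "du \<tau> \<in> sobolev \<sigma>" and dvs: "dv \<tau> \<in> sobolev \<sigma>" if "\<tau> \<in> {0..T}" for \<tau>
    using du(1)[OF that] dv(1)[OF that] by (auto simp: has_sobolev_derivative_def)
  have rate: "sobolev_norm \<sigma> z \<le> M / N"
    if "0 \<le> \<alpha>" "\<alpha> \<le> 1 / N" "w \<in> sobolev s" "z \<in> sobolev \<sigma>" "evolves \<alpha> w z" "sobolev_norm s w \<le> K1" "sobolev_norm \<sigma> w \<le> K0 / N" for \<alpha> w z
  proof -
    have "sobolev_norm \<sigma> z \<le> C * (sobolev_norm s w * sobolev_norm \<sigma> w + \<alpha> * (sobolev_norm s w)\<^sup>2)"
      using C(2)[OF that(1,3) _ that(5)] that(4) by (simp add: \<sigma>_def)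
    also have "\<dots> \<le> C * (K1 * (K0 / N) + 1 / N * K1\<^sup>2)"
      using that Knn C(1) N0 by (intro mult_left_mono add_mono mult_mono power_mono) auto
    also have "\<dots> = M / N" by (simp add: M_def add_divide_distrib distrib_left)
    finally show ?thesis .
  qed
  have nu: "sobolev_norm \<sigma> (du \<tau>) \<le> M / N" if "\<tau> \<in> {0..T}" for \<tau>
    using rate[OF _ _ u1(1)[OF that] dus[OF that] du(2)[OF that] K1(1)[OF that]] K0(1)[OF that] N0 by (simp add: \<sigma>_def)
  have nv: "sobolev_norm \<sigma> (dv \<tau>) \<le> M / N" if "\<tau> \<in> {0..T}" for \<tau>
    using rate[OF _ _ v1(1)[OF that] dvs[OF that] dv(2)[OF that] K1(2)[OF that]] K0(2)[OF that] N0 by (simp add: \<sigma>_def)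
  have iu: "sobolev_norm \<sigma> (\<lambda>x. u \<tau> x - u 0 x) \<le> M / N * \<tau>" if "\<tau> \<in> {0..T}" for \<tau>
    by (rule sobolev_increment_le[OF u1(2) du(1) nu that])
  have iv: "sobolev_norm \<sigma> (\<lambda>x. v \<tau> x - v 0 x) \<le> M / N * \<tau>" if "\<tau> \<in> {0..T}" for \<tau>
    by (rule sobolev_increment_le[OF v1(2) dv(1) nv that])
  have uv0: "AE x in lborel. u 0 x = v 0 x"
    using U(2) V(2) by eventually_elim simp
  have iuv: "sobolev_norm \<sigma> (\<lambda>x. u \<tau> x - v \<tau> x) \<le> 2 * (M / N * \<tau>)" if \<tau>: "\<tau> \<in> {0..T}" for \<tau>
  proof -
    have a: "(\<lambda>x. u \<tau> x - u 0 x) \<in> sobolev \<sigma>" and b: "(\<lambda>x. v \<tau> x - v 0 x) \<in> sobolev \<sigma>"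
      and c: "(\<lambda>x. u \<tau> x - v \<tau> x) \<in> sobolev \<sigma>"
      by (intro sobolev_diff u1(2) v1(2) \<tau> T0)+
    have "sobolev_norm \<sigma> (\<lambda>x. u \<tau> x - v \<tau> x) = sobolev_norm \<sigma> (\<lambda>x. (u \<tau> x - u 0 x) - (v \<tau> x - v 0 x))"
      by (rule sobolev_cong_AE(2)[OF sobolev_diff[OF a b] sobolevD(4)[OF c]]) (use uv0 in \<open>eventually_elim, simp\<close>)
    also have "\<dots> \<le> sobolev_norm \<sigma> (\<lambda>x. u \<tau> x - u 0 x) + sobolev_norm \<sigma> (\<lambda>x. v \<tau> x - v 0 x)"
      by (rule sobolev_norm_diff_le[OF a b])
    finally show ?thesis using iu[OF \<tau>] iv[OF \<tau>] by simp
  qed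
  have sqdiff: "sobolev_norm \<sigma> (\<lambda>x. (f x)\<^sup>2 - (h x)\<^sup>2) \<le> D * e * (2 * (K0 / N))"
    if f: "f \<in> sobolev \<sigma>" and h: "h \<in> sobolev \<sigma>" and e: "sobolev_norm \<sigma> (\<lambda>x. f x - h x) \<le> e"
      and fn: "sobolev_norm \<sigma> f \<le> K0 / N" and hn: "sobolev_norm \<sigma> h \<le> K0 / N" for f h e
  proof -
    have e0: "0 \<le> e" using e sobolev_norm_nonneg order_trans by blast
    have "sobolev_norm \<sigma> (\<lambda>x. (f x)\<^sup>2 - (h x)\<^sup>2) = sobolev_norm \<sigma> (\<lambda>x. (f x - h x) * (f x + h x))"
      by (simp add: power2_eq_square algebra_simps)
    also have "\<dots> \<le> D * sobolev_norm \<sigma> (\<lambda>x. f x - h x) * sobolev_norm \<sigma> (\<lambda>x. f x + h x)"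
      unfolding \<sigma>_def by (rule D(2)) (use sobolev_diff[OF f h] sobolev_add[OF f h] in \<open>simp_all add: \<sigma>_def\<close>)
    also have "\<dots> \<le> D * e * (2 * (K0 / N))"
      using sobolev_norm_add_le[OF f h] fn hn e e0 D(1) by (intro mult_mono mult_left_mono mult_nonneg_nonneg) auto
    finally show ?thesis .
  qed
  define \<kappa> where "\<kappa> = 2 * N * (N / 2) powr (- \<sigma>) * sqrt 2"
  have \<kappa>0: "0 \<le> \<kappa>" using N0 by (simp add: \<kappa>_def)
  \<comment> \<open>\<open>\<kappa>\<close> is the norm of the weighted band functional on \<open>H\<^sup>s\<^sup>-\<^sup>1\<close>; the errors carry the factor \<open>1 / N\<^sup>2\<close>.\<close>
  have \<kappa>eq: "\<kappa> / N\<^sup>2 = 2 powr s * sqrt 2 * N powr (- s)"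
  proof -
    have "(N / 2) powr (- \<sigma>) = N powr (1 - s) * 2 powr (s - 1)"
      using N0 by (simp add: \<sigma>_def powr_divide powr_minus_divide[symmetric] divide_powr_uminus)
    moreover have "N powr (1 - s) = N * N powr (- s)" using N0 powr_add[of N 1 "- s"] by simp
    moreover have "2 powr s = 2 * 2 powr (s - 1)" using powr_add[of 2 1 "s - 1"] by simp
    ultimately show ?thesis using N0 by (simp add: \<kappa>_def power2_eq_square)
  qed
  have w0: "AE \<xi> in lborel. \<xi> \<in> band N \<longrightarrow> g \<le> Re (fourier (\<lambda>x. (u 0 x)\<^sup>2) \<xi>)"
  proof -
    have m: "(\<lambda>x. (u 0 x)\<^sup>2) \<in> borel_measurable borel" using sobolevD(4)[OF u1(1)[OF T0]] by measurable
    have "AE x in lborel. (u 0 x)\<^sup>2 = (u0 x)\<^sup>2" using U(2) by eventually_elim simp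
    from fourier_cong_AE[OF fourier_mult_Dx(2)[OF u0 s] m this] g(2)
    show ?thesis by (auto elim: eventually_elim2)
  qed
  define \<phi>' where "\<phi>' \<tau> = band_mass N (du \<tau>) - band_mass N (dv \<tau>)" for \<tau>
  have lower: "N / 5 * g - 2 powr s * sqrt 2 * N powr (- s) * (8 * D * M * K0 * \<tau> + D * K1\<^sup>2) \<le> \<phi>' \<tau>" if \<tau>: "\<tau> \<in> {0..T}" for \<tau>
  proof -
    have Dx: "sobolev_norm \<sigma> (\<lambda>x. (Dx (u \<tau>) x)\<^sup>2) \<le> D * K1\<^sup>2"
    proof -
      have d: "Dx (u \<tau>) \<in> sobolev (s - 1)" "sobolev_norm (s - 1) (Dx (u \<tau>)) \<le> K1"
        using sobolev_Dx[OF u1(1)[OF \<tau>] s1(3)] sobolev_norm_Dx[OF u1(1)[OF \<tau>] s1(3)] K1(1)[OF \<tau>] by auto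
      have "sobolev_norm \<sigma> (\<lambda>x. (Dx (u \<tau>) x)\<^sup>2) \<le> D * sobolev_norm (s - 1) (Dx (u \<tau>)) * sobolev_norm (s - 1) (Dx (u \<tau>))"
        using D(2)[OF d(1) d(1)] by (simp add: \<sigma>_def power2_eq_square)
      also have "\<dots> \<le> D * K1 * K1" using d(2) D(1) Knn by (intro mult_mono mult_nonneg_nonneg) auto
      finally show ?thesis by (simp add: power2_eq_square mult.assoc)
    qed
    have e1: "sobolev_norm \<sigma> (\<lambda>x. (u \<tau> x)\<^sup>2 - (u 0 x)\<^sup>2) \<le> D * (M / N * \<tau>) * (2 * (K0 / N))"
      using sqdiff[OF u1(2)[OF \<tau>] u1(2)[OF T0] iu[OF \<tau>]] K0(1)[OF \<tau>] K0(1)[OF T0] by (simp add: \<sigma>_def)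
    have e2: "sobolev_norm \<sigma> (\<lambda>x. (u \<tau> x)\<^sup>2 - (v \<tau> x)\<^sup>2) \<le> D * (2 * (M / N * \<tau>)) * (2 * (K0 / N))"
      using sqdiff[OF u1(2)[OF \<tau>] v1(2)[OF \<tau>] iuv[OF \<tau>]] K0(1)[OF \<tau>] K0(2)[OF \<tau>] by (simp add: \<sigma>_def)
    have "sobolev_norm \<sigma> (\<lambda>x. (u \<tau> x)\<^sup>2 - (u 0 x)\<^sup>2) + 3 / 2 * sobolev_norm \<sigma> (\<lambda>x. (u \<tau> x)\<^sup>2 - (v \<tau> x)\<^sup>2)
       + 1 / (2 * N\<^sup>2) * sobolev_norm \<sigma> (\<lambda>x. (Dx (u \<tau>) x)\<^sup>2)
       \<le> D * (M / N * \<tau>) * (2 * (K0 / N)) + 3 / 2 * (D * (2 * (M / N * \<tau>)) * (2 * (K0 / N))) + 1 / (2 * N\<^sup>2) * (D * K1\<^sup>2)"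
      using e1 e2 Dx by (intro add_mono mult_left_mono) auto
    also have "\<dots> = (8 * D * M * K0 * \<tau> + D * K1\<^sup>2 / 2) / N\<^sup>2"
      using N0 by (simp add: power2_eq_square field_simps)
    also have "\<dots> \<le> (8 * D * M * K0 * \<tau> + D * K1\<^sup>2) / N\<^sup>2"
      using D(1) by (intro divide_right_mono) auto
    finally have "\<kappa> * (sobolev_norm \<sigma> (\<lambda>x. (u \<tau> x)\<^sup>2 - (u 0 x)\<^sup>2) + 3 / 2 * sobolev_norm \<sigma> (\<lambda>x. (u \<tau> x)\<^sup>2 - (v \<tau> x)\<^sup>2)
       + 1 / (2 * N\<^sup>2) * sobolev_norm \<sigma> (\<lambda>x. (Dx (u \<tau>) x)\<^sup>2)) \<le> \<kappa> * ((8 * D * M * K0 * \<tau> + D * K1\<^sup>2) / N\<^sup>2)"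
      by (rule mult_left_mono[OF _ \<kappa>0])
    also have "\<dots> = 2 powr s * sqrt 2 * N powr (- s) * (8 * D * M * K0 * \<tau> + D * K1\<^sup>2)"
      unfolding \<kappa>eq[symmetric] by simp
    finally show ?thesis
      using band_mass_derivative_lower[OF N s u1(1)[OF \<tau>] v1(1)[OF \<tau>] u1(1)[OF T0] _ du(2)[OF \<tau>] _ dv(2)[OF \<tau>] g(1) w0] dus[OF \<tau>] dvs[OF \<tau>]
      unfolding \<phi>'_def \<kappa>_def \<sigma>_def by linarith
  qed
  define ker where "ker \<xi> = indicator (band N) \<xi> * (- \<i>) / complex_of_real (bracket \<sigma> \<xi>)" for \<xi>
  have \<sigma>0: "0 \<le> \<sigma>" using s1 by (simp add: \<sigma>_def)
  have ker: "square_integrable ker"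
    unfolding ker_def using square_integrable_band_weight[OF N0(2) \<sigma>0, of "\<lambda>_. - \<i>" 1] by simp
  have bm: "band_mass N f = pairing \<sigma> ker f" if "f \<in> sobolev \<sigma>" for f
    unfolding ker_def by (rule band_mass_eq_pairing[OF N0(2) \<sigma>0 that])
  define \<phi> where "\<phi> \<tau> = pairing \<sigma> ker (u \<tau>) - pairing \<sigma> ker (v \<tau>)" for \<tau>
  have d\<phi>: "(\<phi> has_real_derivative \<phi>' \<tau>) (at \<tau> within {0..T})" if \<tau>: "\<tau> \<in> {0..T}" for \<tau>
    unfolding \<phi>_def[abs_def] \<phi>'_def bm[OF dus[OF \<tau>]] bm[OF dvs[OF \<tau>]]
    by (intro DERIV_diff pairing_has_derivative[OF ker u1(2) du(1)[OF \<tau>] \<tau>] pairing_has_derivative[OF ker v1(2) dv(1)[OF \<tau>] \<tau>])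
  from real_MVT_within[OF d\<phi> t] obtain x where x: "x \<in> {0<..<t}" "\<phi> t - \<phi> 0 = \<phi>' x * t" by blast
  have "\<phi> 0 = 0"
  proof -
    have "AE \<xi> in lborel. fourier (u 0) \<xi> = fourier (v 0) \<xi>"
      using fourier_cong_AE[OF sobolevD(1)[OF v1(1)[OF T0]] sobolevD(4)[OF u1(1)[OF T0]] uv0] by simp
    from pairing_cong[OF ker u1(2)[OF T0] v1(2)[OF T0] this] show ?thesis by (simp add: \<phi>_def)
  qed
  have tT: "t \<in> {0..T}" and xT: "x \<in> {0..T}" using t x by auto
  have xt: "8 * D * M * K0 * x \<le> 8 * D * M * K0 * t" using x(1) D(1) Mn K0n by (intro mult_left_mono) auto
  have "2 powr s * sqrt 2 * N powr (- s) * (8 * D * M * K0 * x + D * K1\<^sup>2) \<le> 2 powr s * sqrt 2 * N powr (- s) * (8 * D * M * K0 * t + D * K1\<^sup>2)"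
    using xt by (intro mult_left_mono) auto
  with lower[OF xT] have "N / 5 * g - 2 powr s * sqrt 2 * N powr (- s) * (8 * D * M * K0 * t + D * K1\<^sup>2) \<le> \<phi>' x" by linarith
  then have "(N / 5 * g - 2 powr s * sqrt 2 * N powr (- s) * (8 * D * M * K0 * t + D * K1\<^sup>2)) * t \<le> \<phi>' x * t"
    using t by (intro mult_right_mono) auto
  also have "\<dots> = \<phi> t" using x(2) \<open>\<phi> 0 = 0\<close> by simp
  also have "\<dots> = band_mass N (\<lambda>x. u t x - v t x)"
    unfolding \<phi>_def bm[OF sobolev_diff[OF u1(2)[OF tT] v1(2)[OF tT]]]
    by (rule pairing_diff[OF ker u1(2)[OF tT] v1(2)[OF tT], symmetric])
  finally show ?thesis by (simp add: M_def)
qed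

section \<open>Failure of uniform convergence\<close>

text \<open>The constant of the bound at order \<open>s - 1\<close> is an arbitrary function of the \<open>H\<^sup>s\<close> norm of the datum, so it is
  uniform only over data of one fixed norm.  Continuity in time upgrades the essential bounds to bounds at
  every time.\<close>

lemma common_existence_time_bounds:
  assumes ct: "common_existence_time s R T" and s: "3 / 2 < s"
  shows "0 < T" "\<exists>K1\<ge>0. \<exists>c\<ge>0. \<forall>\<alpha>\<in>{0..<1}. \<forall>u0. u0 \<in> sobolev s \<longrightarrow> sobolev_norm s u0 = R \<longrightarrow>
    (\<forall>u. filtered_solution s T \<alpha> u0 u \<longrightarrow> (\<forall>t\<in>{0..T}. sobolev_norm s (u t) \<le> K1 \<and> sobolev_norm (s - 1) (u t) \<le> c * sobolev_norm (s - 1) u0))"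
proof -
  show T: "0 < T" using ct by (simp add: common_existence_time_def)
  obtain C1 where C1: "\<And>\<alpha> u0 u. \<alpha> \<in> {0..<1} \<Longrightarrow> u0 \<in> sobolev_ball s R \<Longrightarrow> filtered_solution s T \<alpha> u0 u \<Longrightarrow>
      Linf_sobolev_norm s T u \<le> ennreal (C1 * sobolev_norm s u0)"
    using ct unfolding common_existence_time_def by blast
  have "\<exists>C2 :: real \<Rightarrow> real. \<forall>\<alpha>\<in>{0..<1}. \<forall>u0\<in>sobolev_ball s R \<inter> sobolev (s - 1). \<forall>u. filtered_solution s T \<alpha> u0 u \<longrightarrow>
       Linf_sobolev_norm (s - 1) T u \<le> ennreal (C2 (sobolev_norm s u0) * sobolev_norm (s - 1) u0)"
    using ct unfolding common_existence_time_def by blast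
  then obtain C2 where C2: "\<And>\<alpha> u0 u. \<alpha> \<in> {0..<1} \<Longrightarrow> u0 \<in> sobolev_ball s R \<Longrightarrow> u0 \<in> sobolev (s - 1) \<Longrightarrow> filtered_solution s T \<alpha> u0 u \<Longrightarrow>
      Linf_sobolev_norm (s - 1) T u \<le> ennreal (C2 (sobolev_norm s u0) * sobolev_norm (s - 1) u0)"
    by blast
  have R0: "0 \<le> \<bar>R\<bar>" by simp
  have "sobolev_norm s (u t) \<le> \<bar>C1\<bar> * \<bar>R\<bar> \<and> sobolev_norm (s - 1) (u t) \<le> \<bar>C2 R\<bar> * sobolev_norm (s - 1) u0"
    if \<alpha>: "\<alpha> \<in> {0..<1}" and u0: "u0 \<in> sobolev s" "sobolev_norm s u0 = R" and u: "filtered_solution s T \<alpha> u0 u" and t: "t \<in> {0..T}" for \<alpha> u0 u t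
  proof
    have ball: "u0 \<in> sobolev_ball s R" using u0 by (simp add: sobolev_ball_def)
    have u0': "u0 \<in> sobolev (s - 1)" by (rule sobolev_mono(1)[OF u0(1)]) simp
    have c: "continuous_sobolev s T u" using solution_facts(1)[OF s _ u] \<alpha> by simp
    have "Linf_sobolev_norm s T u \<le> ennreal (C1 * R)" using C1[OF \<alpha> ball u] u0 by simp
    also have "\<dots> \<le> ennreal (\<bar>C1\<bar> * \<bar>R\<bar>)" by (intro ennreal_leI) (metis abs_ge_self abs_mult)
    finally show "sobolev_norm s (u t) \<le> \<bar>C1\<bar> * \<bar>R\<bar>"
      by (intro Linf_sobolev_norm_bound[OF c order_refl T _ _ t]) auto
    have "Linf_sobolev_norm (s - 1) T u \<le> ennreal (C2 R * sobolev_norm (s - 1) u0)" using C2[OF \<alpha> ball u0' u] u0 by simp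
    also have "\<dots> \<le> ennreal (\<bar>C2 R\<bar> * sobolev_norm (s - 1) u0)" by (intro ennreal_leI mult_right_mono) auto
    finally show "sobolev_norm (s - 1) (u t) \<le> \<bar>C2 R\<bar> * sobolev_norm (s - 1) u0"
      by (intro Linf_sobolev_norm_bound[OF c _ T _ _ t]) auto
  qed
  then show "\<exists>K1\<ge>0. \<exists>c\<ge>0. \<forall>\<alpha>\<in>{0..<1}. \<forall>u0. u0 \<in> sobolev s \<longrightarrow> sobolev_norm s u0 = R \<longrightarrow>
    (\<forall>u. filtered_solution s T \<alpha> u0 u \<longrightarrow> (\<forall>t\<in>{0..T}. sobolev_norm s (u t) \<le> K1 \<and> sobolev_norm (s - 1) (u t) \<le> c * sobolev_norm (s - 1) u0))"
    by (intro exI[of _ "\<bar>C1\<bar> * \<bar>R\<bar>"] exI[of _ "\<bar>C2 R\<bar>"] conjI) auto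
qed

text \<open>The constants are fixed in this order: first \<open>A\<close>, large enough for the interaction of the low with the high
  part of the datum to exceed the gradient error, which is independent of \<open>A\<close>; then \<open>\<delta>\<close>, small enough to control the
  error that grows in time, whose constant depends on \<open>A\<close>.  Both are independent of \<open>N\<close>.\<close>

lemma uniform_separation:
  assumes s: "3 / 2 < s" and R: "0 < R" and ct: "common_existence_time s R T"
  shows "\<exists>N0\<ge>3. \<exists>\<delta>>0. \<delta> \<le> T \<and> (\<forall>N\<ge>N0. \<exists>u0\<in>sobolev_ball s R. \<forall>u v.
     filtered_solution s T (1 / N) u0 u \<longrightarrow> filtered_solution s T 0 u0 v \<longrightarrow>
     (\<forall>t. 0 < t \<longrightarrow> t \<le> \<delta> \<longrightarrow> t / (2 powr s * sqrt 2) \<le> sobolev_norm s (\<lambda>x. u t x - v t x)))"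
proof -
  have s1: "1 \<le> s" "1 / 2 < s - 1" "0 \<le> s" using s by auto
  note T = common_existence_time_bounds(1)[OF ct s]
  obtain K1 c where K1: "0 \<le> K1" and c: "0 \<le> c" and Kb: "\<And>\<alpha> u0 u t. \<alpha> \<in> {0..<1} \<Longrightarrow> u0 \<in> sobolev s \<Longrightarrow> sobolev_norm s u0 = R \<Longrightarrow>
    filtered_solution s T \<alpha> u0 u \<Longrightarrow> t \<in> {0..T} \<Longrightarrow> sobolev_norm s (u t) \<le> K1 \<and> sobolev_norm (s - 1) (u t) \<le> c * sobolev_norm (s - 1) u0"
    using common_existence_time_bounds(2)[OF ct s] by blast
  obtain C where C: "0 \<le> C" "\<And>\<alpha> w v. 0 \<le> \<alpha> \<Longrightarrow> w \<in> sobolev s \<Longrightarrow> v \<in> sobolev (s - 1) \<Longrightarrow> evolves \<alpha> w v \<Longrightarrow>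
      sobolev_norm (s - 1) v \<le> C * (sobolev_norm s w * sobolev_norm (s - 1) w + \<alpha> * (sobolev_norm s w)\<^sup>2)"
    using evolves_bound[OF s] by blast
  obtain D where D: "0 \<le> D" "\<And>f g. f \<in> sobolev (s - 1) \<Longrightarrow> g \<in> sobolev (s - 1) \<Longrightarrow> (\<lambda>x. f x * g x) \<in> sobolev (s - 1) \<and>
      sobolev_norm (s - 1) (\<lambda>x. f x * g x) \<le> D * sobolev_norm (s - 1) f * sobolev_norm (s - 1) g"
    using sobolev_product_algebra[OF s1(2)] by blast
  define c0 where "c0 = R / (sqrt 8 * 2 powr s)"
  have c0: "0 < c0" using R by (simp add: c0_def)
  define \<kappa> where "\<kappa> = 2 powr s * sqrt 2"
  have \<kappa>: "0 < \<kappa>" by (simp add: \<kappa>_def)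
  define A where "A = 10 * pi / c0 * (\<kappa> * (D * K1\<^sup>2) + 2)"
  have A: "0 < A" using c0 \<kappa> D(1) unfolding A_def by (intro mult_pos_pos add_nonneg_pos) auto
  obtain K N0 where K: "0 < K" and N0: "3 \<le> N0" and data: "\<And>N. N0 \<le> N \<Longrightarrow> \<exists>u0 b. u0 \<in> sobolev s \<and> sobolev_norm s u0 = R \<and> sobolev_norm (s - 1) u0 \<le> K / N
     \<and> c0 * N powr (- s) \<le> b \<and> (AE \<xi> in lborel. \<xi> \<in> band N \<longrightarrow> A / N * b / (2 * pi) \<le> Re (fourier (\<lambda>x. (u0 x)\<^sup>2) \<xi>))"
    using initial_datum[OF s1(1) s R A] unfolding c0_def by blast
  define K0 where "K0 = c * K"
  have K0: "0 \<le> K0" using c K by (simp add: K0_def)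
  define Q where "Q = \<kappa> * (8 * D * (C * (K1 * K0 + K1\<^sup>2)) * K0)"
  have Q: "0 \<le> Q" using \<kappa> D(1) C(1) K1 K0 by (simp add: Q_def)
  define \<delta> where "\<delta> = min T (1 / (1 + Q))"
  have \<delta>: "0 < \<delta>" "\<delta> \<le> T" using T Q by (auto simp: \<delta>_def)
  have "\<exists>u0\<in>sobolev_ball s R. \<forall>u v. filtered_solution s T (1 / N) u0 u \<longrightarrow> filtered_solution s T 0 u0 v \<longrightarrow>
     (\<forall>t. 0 < t \<longrightarrow> t \<le> \<delta> \<longrightarrow> t / (2 powr s * sqrt 2) \<le> sobolev_norm s (\<lambda>x. u t x - v t x))" if N: "N0 \<le> N" for N
  proof -
    have N3: "3 \<le> N" "0 < N" "2 \<le> N" using N N0 by auto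
    from data[OF N] obtain u0 b where u0: "u0 \<in> sobolev s" "sobolev_norm s u0 = R" "sobolev_norm (s - 1) u0 \<le> K / N"
      and b: "c0 * N powr (- s) \<le> b" and low: "AE \<xi> in lborel. \<xi> \<in> band N \<longrightarrow> A / N * b / (2 * pi) \<le> Re (fourier (\<lambda>x. (u0 x)\<^sup>2) \<xi>)"
      by blast
    have b0: "0 \<le> b" using b c0 by (intro order_trans[OF _ b]) auto
    define g where "g = A / N * b / (2 * pi)"
    have g: "0 \<le> g" using A b0 N3 by (simp add: g_def)
    have Ng: "N powr (- s) * (\<kappa> * (D * K1\<^sup>2) + 2) \<le> N / 5 * g"
    proof -
      have "N powr (- s) * (\<kappa> * (D * K1\<^sup>2) + 2) = A / (10 * pi) * (c0 * N powr (- s))"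
        using c0 by (simp add: A_def)
      also have "\<dots> \<le> A / (10 * pi) * b" using A b by (intro mult_left_mono) auto
      also have "\<dots> = N / 5 * g" using N3 by (simp add: g_def)
      finally show ?thesis .
    qed
    have "t / (2 powr s * sqrt 2) \<le> sobolev_norm s (\<lambda>x. u t x - v t x)"
      if u: "filtered_solution s T (1 / N) u0 u" and v: "filtered_solution s T 0 u0 v" and t: "0 < t" "t \<le> \<delta>" for u v t
    proof -
      have \<alpha>: "1 / N \<in> {0..<1}" "(0::real) \<in> {0..<1}" using N3 by auto
      have tT: "t \<le> T" "t \<in> {0..T}" using t \<delta> by auto
      have cK: "c * sobolev_norm (s - 1) u0 \<le> K0 / N"
        using mult_left_mono[OF u0(3) c] by (simp add: K0_def)
      note Ku = Kb[OF \<alpha>(1) u0(1,2) u] and Kv = Kb[OF \<alpha>(2) u0(1,2) v]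
      have grow: "(N / 5 * g - 2 powr s * sqrt 2 * N powr (- s) * (8 * D * (C * (K1 * K0 + K1\<^sup>2)) * K0 * t + D * K1\<^sup>2)) * t
         \<le> band_mass N (\<lambda>x. u t x - v t x)"
      proof (rule band_mass_growth[OF N3(1) s T u v _ _ _ _ C D(1) _ g low[folded g_def] u0(1) t(1) tT(1)])
        show "sobolev_norm s (u \<tau>) \<le> K1" "sobolev_norm (s - 1) (u \<tau>) \<le> K0 / N" if "\<tau> \<in> {0..T}" for \<tau>
          using Ku[OF that] cK by auto
        show "sobolev_norm s (v \<tau>) \<le> K1" "sobolev_norm (s - 1) (v \<tau>) \<le> K0 / N" if "\<tau> \<in> {0..T}" for \<tau>
          using Kv[OF that] cK by auto
      qed (use D(2) in auto)
      have Qt: "Q * t \<le> 1"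
      proof -
        have "Q * t \<le> Q * (1 / (1 + Q))" using t Q by (intro mult_left_mono) (auto simp: \<delta>_def)
        also have "\<dots> \<le> 1" using Q by simp
        finally show ?thesis .
      qed
      have "N powr (- s) \<le> N powr (- s) * (\<kappa> * (D * K1\<^sup>2) + 2) - N powr (- s) * (Q * t + \<kappa> * (D * K1\<^sup>2))"
        using mult_left_mono[OF Qt, of "N powr (- s)"] by (simp add: algebra_simps)
      also have "N powr (- s) * (Q * t + \<kappa> * (D * K1\<^sup>2)) = 2 powr s * sqrt 2 * N powr (- s) * (8 * D * (C * (K1 * K0 + K1\<^sup>2)) * K0 * t + D * K1\<^sup>2)"
        by (simp add: Q_def \<kappa>_def algebra_simps)
      finally have "N powr (- s) \<le> N / 5 * g - 2 powr s * sqrt 2 * N powr (- s) * (8 * D * (C * (K1 * K0 + K1\<^sup>2)) * K0 * t + D * K1\<^sup>2)"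
        using Ng by linarith
      then have "N powr (- s) * t \<le> band_mass N (\<lambda>x. u t x - v t x)"
        using t by (intro order_trans[OF mult_right_mono grow]) auto
      also have "\<dots> \<le> (N / 2) powr (- s) * sqrt 2 * sobolev_norm s (\<lambda>x. u t x - v t x)"
      proof (rule order_trans[OF abs_ge_self band_mass_le[OF N3(3) s1(3)]])
        have "u t \<in> sobolev s" "v t \<in> sobolev s"
          using solution_facts(1)[OF s _ u] solution_facts(1)[OF s _ v] N3 tT by (auto simp: continuous_sobolev_def)
        then show "(\<lambda>x. u t x - v t x) \<in> sobolev s" by (rule sobolev_diff)
      qed
      also have "(N / 2) powr (- s) = N powr (- s) * 2 powr s"
        using N3 by (simp add: powr_divide powr_minus_divide)
      finally have "N powr (- s) * t \<le> N powr (- s) * (2 powr s * sqrt 2 * sobolev_norm s (\<lambda>x. u t x - v t x))"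
        by (simp add: mult_ac)
      then have "t \<le> (2 powr s * sqrt 2) * sobolev_norm s (\<lambda>x. u t x - v t x)"
        using N3 by simp
      then show ?thesis by (simp add: pos_divide_le_eq mult.commute)
    qed
    moreover have "u0 \<in> sobolev_ball s R" using u0 by (simp add: sobolev_ball_def)
    ultimately show ?thesis by blast
  qed
  then show ?thesis using N0 \<delta> by blast
qed

theorem theorem1p2:
  fixes s R T :: real
    and S :: "real \<Rightarrow> (real \<Rightarrow> real) \<Rightarrow> real \<Rightarrow> real \<Rightarrow> real"
  assumes "s > 3 / 2" and "R > 0"
    and "common_existence_time s R T"
    and "\<And>\<alpha> u0. 0 < \<alpha> \<Longrightarrow> \<alpha> < 1 \<Longrightarrow> u0 \<in> sobolev_ball s R \<Longrightarrow>
           camassa_holm_solution s T \<alpha> u0 (S \<alpha> u0)"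
    and "\<And>u0. u0 \<in> sobolev_ball s R \<Longrightarrow> burgers_solution s T u0 (S 0 u0)"
  shows "\<not> (\<forall>\<epsilon>>0. \<forall>\<^sub>F \<alpha> in at_right 0. \<forall>u0\<in>sobolev_ball s R.
            Linf_sobolev_norm s T (\<lambda>t x. S \<alpha> u0 t x - S 0 u0 t x) < ennreal \<epsilon>) \<and>
         (\<exists>(u0 :: nat \<Rightarrow> real \<Rightarrow> real) (\<alpha> :: nat \<Rightarrow> real) (T0 :: real) (\<eta>0 :: real).
            (\<forall>n. u0 n \<in> sobolev_ball s R) \<and>
            (\<forall>n. 0 < \<alpha> n \<and> \<alpha> n < 1) \<and> \<alpha> \<longlonglongrightarrow> 0 \<and>
            0 < T0 \<and> T0 \<le> T \<and> \<eta>0 > 0 \<and>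
            liminf (\<lambda>n. Linf_sobolev_norm s T0
                     (\<lambda>t x. S (\<alpha> n) (u0 n) t x - S 0 (u0 n) t x)) \<ge> ennreal \<eta>0)"
proof -
  have T: "0 < T" using assms(3) by (simp add: common_existence_time_def)
  obtain N0 \<delta> where N0: "3 \<le> N0" and \<delta>: "0 < \<delta>" "\<delta> \<le> T"
    and sep: "\<And>N. N0 \<le> N \<Longrightarrow> \<exists>u0\<in>sobolev_ball s R. \<forall>u v.
     filtered_solution s T (1 / N) u0 u \<longrightarrow> filtered_solution s T 0 u0 v \<longrightarrow>
     (\<forall>t. 0 < t \<longrightarrow> t \<le> \<delta> \<longrightarrow> t / (2 powr s * sqrt 2) \<le> sobolev_norm s (\<lambda>x. u t x - v t x))"
    using uniform_separation[OF assms(1,2,3)] by blast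
  define N where "N n = N0 + real n" for n
  define \<alpha> where "\<alpha> n = 1 / N n" for n
  have N: "N0 \<le> N n" "3 \<le> N n" for n using N0 by (auto simp: N_def)
  have \<alpha>: "0 < \<alpha> n" "\<alpha> n < 1" for n using N(2)[of n] by (auto simp: \<alpha>_def)
  have "\<forall>n. \<exists>u0. u0 \<in> sobolev_ball s R \<and> (\<forall>u v.
     filtered_solution s T (\<alpha> n) u0 u \<longrightarrow> filtered_solution s T 0 u0 v \<longrightarrow>
     (\<forall>t. 0 < t \<longrightarrow> t \<le> \<delta> \<longrightarrow> t / (2 powr s * sqrt 2) \<le> sobolev_norm s (\<lambda>x. u t x - v t x)))"
    unfolding \<alpha>_def using sep[OF N(1)] unfolding Bex_def by (intro allI)
  note choice[OF this]
  then obtain u0 where u0: "\<And>n. u0 n \<in> sobolev_ball s R"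
    and sep': "\<And>n u v t. filtered_solution s T (\<alpha> n) (u0 n) u \<Longrightarrow> filtered_solution s T 0 (u0 n) v \<Longrightarrow> 0 < t \<Longrightarrow> t \<le> \<delta> \<Longrightarrow>
       t / (2 powr s * sqrt 2) \<le> sobolev_norm s (\<lambda>x. u t x - v t x)"
    by blast
  \<comment> \<open>Taking \<open>T0 = T\<close> is possible because the times in \<open>(\<delta>/2, \<delta>)\<close> already bound the essential supremum below.\<close>
  define \<eta> where "\<eta> = \<delta> / 2 / (2 powr s * sqrt 2)"
  have \<eta>: "0 < \<eta>" using \<delta> by (simp add: \<eta>_def)
  have big: "ennreal \<eta> \<le> Linf_sobolev_norm s T (\<lambda>t x. S (\<alpha> n) (u0 n) t x - S 0 (u0 n) t x)" for n
  proof (rule Linf_sobolev_norm_ge[of "\<delta> / 2" \<delta>])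
    fix t assume t: "\<delta> / 2 < t" "t < \<delta>"
    have "\<eta> \<le> t / (2 powr s * sqrt 2)"
      unfolding \<eta>_def using t by (intro divide_right_mono) auto
    also have "\<dots> \<le> sobolev_norm s (\<lambda>x. S (\<alpha> n) (u0 n) t x - S 0 (u0 n) t x)"
      using sep'[of n "S (\<alpha> n) (u0 n)" "S 0 (u0 n)" t] assms(4)[OF \<alpha> u0] assms(5)[OF u0] \<alpha>(1)[of n] t \<delta>
      by (simp add: filtered_solution_def)
    finally show "\<eta> \<le> sobolev_norm s (\<lambda>x. S (\<alpha> n) (u0 n) t x - S 0 (u0 n) t x)" .
  qed (use \<delta> in auto)
  have \<alpha>0: "\<alpha> \<longlonglongrightarrow> 0"
    unfolding \<alpha>_def N_def
    by (intro tendsto_divide_0[OF tendsto_const] filterlim_at_top_imp_at_infinity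
        filterlim_tendsto_add_at_top[OF tendsto_const] filterlim_real_sequentially)
  have "\<not> (\<forall>\<epsilon>>0. \<forall>\<^sub>F \<alpha> in at_right 0. \<forall>u0\<in>sobolev_ball s R.
            Linf_sobolev_norm s T (\<lambda>t x. S \<alpha> u0 t x - S 0 u0 t x) < ennreal \<epsilon>)"
  proof
    assume "\<forall>\<epsilon>>0. \<forall>\<^sub>F \<alpha> in at_right 0. \<forall>u0\<in>sobolev_ball s R.
            Linf_sobolev_norm s T (\<lambda>t x. S \<alpha> u0 t x - S 0 u0 t x) < ennreal \<epsilon>"
    then have "\<forall>\<^sub>F \<alpha> in at_right 0. \<forall>u0\<in>sobolev_ball s R.
            Linf_sobolev_norm s T (\<lambda>t x. S \<alpha> u0 t x - S 0 u0 t x) < ennreal \<eta>" using \<eta> by blast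
    moreover have "filterlim \<alpha> (at_right 0) sequentially"
      using \<alpha>0 \<alpha>(1) by (auto simp: filterlim_at less_imp_neq[symmetric])
    ultimately have "\<forall>\<^sub>F n in sequentially. \<forall>u0\<in>sobolev_ball s R.
            Linf_sobolev_norm s T (\<lambda>t x. S (\<alpha> n) u0 t x - S 0 u0 t x) < ennreal \<eta>"
      by (rule eventually_compose_filterlim)
    then obtain n where "\<forall>u0\<in>sobolev_ball s R. Linf_sobolev_norm s T (\<lambda>t x. S (\<alpha> n) u0 t x - S 0 u0 t x) < ennreal \<eta>"
      using eventually_happens'[OF sequentially_bot] by blast
    with u0[of n] big[of n] show False by (meson leD)
  qed
  moreover have "ennreal \<eta> \<le> liminf (\<lambda>n. Linf_sobolev_norm s T (\<lambda>t x. S (\<alpha> n) (u0 n) t x - S 0 (u0 n) t x))"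
    by (rule Liminf_bounded) (simp add: big)
  ultimately show ?thesis using u0 \<alpha> \<alpha>0 T \<eta> by blast
qed

end
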